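(* Let $G$ be a finite connected graph and let $\rho\in[0,1]$. If $-n,m\to\infty$ in such a way that $\lim(-n/m)=\rho/(1-\rho)$ (interpreted as $+\infty$ when $\rho=1$), then, in the sense of weak convergence, $$\lim\mu_{n,m}=\rho\,\mu^{\rm L}+(1-\rho)\,\mu^{\rm R}.$$ Consequently, the set of weak limit points of $\{\mu_{n,m}\}$ as $n\to-\infty$, $m\to\infty$ consists of all convex combinations of $\mu^{\rm L}$ and $\mu^{\rm R}$.
   Context: Let $\deg_G(x)$ be the degree of $x$ in the finite connected graph $G$, and $m(x):=\deg_G(x)+2$. The graph $\Lambda=G\times\mathbb{Z}$ has an edge between $(x,k)$ and $(y,\ell)$ iff either $x\sim y$ in $G$ and $k=\ell$, or $x=y$ and $|k-\ell|=1$. $\Lambda_{n,m}$ is the subgraph induced on $G\times\{n,\dots,m\}$; similarly $\Lambda_{-\infty,m}$ and $\Lambda_{n,\infty}$. The matrix $\Delta$ on $\Lambda$ has $\Delta_{uu}=m(x)$ for $u=(x,k)$, $\Delta_{uv}=-1$ for neighbours $u,v$, and $0$ otherwise; $\Delta_V$ is its restriction to $V\times V$. Set $S_V=\prod_{u\in V}\{1,\dots,\Delta_{uu}\}$. For finite $V$, $\Omega_V\subset S_V$ is the set of recurrent configurations of the Abelian sandpile on $V$ with toppling matrix $\Delta_V$; equivalently, $\eta\in S_V$ is in $\Omega_V$ iff every nonempty $F\subset V$ contains a site $u$ with $\eta(u)>|\{v\in F: v\sim u\}|$. The measure $\mu_{n,m}$ is uniform on $\Omega_{\Lambda_{n,m}}$.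 For finite $V\subset\Lambda$, $V^-$ (resp. $V^+$) is the connected component of $\Lambda\setminus V$ containing $\Lambda_{-\infty,k}$ (resp. $\Lambda_{k,\infty}$) for some $k$ (they may coincide), and $\partial_0^{\rm L}V$ (resp. $\partial_0^{\rm R}V$) is the set of $v\in V$ having a neighbour in $V^-$ (resp. $V^+$). A configuration $\eta\in S_V$ is left-burnable if there is an enumeration $v_1,\dots,v_{|V|}$ of $V$ such that for each $i$, with $V_i:=V\setminus\{v_1,\dots,v_{i-1}\}$: (i) $v_i\in\partial_0^{\rm L}V_i$; (ii) $\eta(v_i)>\Delta_{v_iv_i}-|\{u\in V_i^-:u\sim v_i\}|$. Right-burnable is defined analogously with $\partial_0^{\rm R}$ and $V_i^+$. $\Omega^{\rm L}_V,\Omega^{\rm R}_V$ are the sets of left-, right-burnable configurations on $V$. The measures $\mu^{\rm L}_{n,m},\mu^{\rm R}_{n,m}$ are uniform on $\Omega^{\rm L}_{\Lambda_{n,m}},\Omega^{\rm R}_{\Lambda_{n,m}}$, and $\mu^{\rm L},\mu^{\rm R}$ are their weak limits (which exist) as $n\to-\infty$, $m\to\infty$. Weak convergence means convergence of the probabilities of all cylinder events (events depending on the configuration in $\Lambda_{-k,k}$ for some $k$).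
   Formalization: The roles of μ^L and μ^R are exchanged in the displayed limit: it is proved that lim μ_{n,m} = ρ μ^R + (1−ρ) μ^L, since the printed formula fails under the given definitions (e.g. for G = K_2, ρ = 0). *)

theory Defs
  imports "HOL-Probability.Probability" "Graph_Theory.Graph_Theory"
begin

definition ladder :: "'a pair_pre_digraph \<Rightarrow> ('a \<times> int) pair_pre_digraph" where
  "ladder G = \<lparr> pverts = pverts G \<times> UNIV,
     parcs = {((x, k), (y, l)) | x k y l.
       (x, y) \<in> parcs G \<and> k = l \<or> x \<in> pverts G \<and> x = y \<and> \<bar>k - l\<bar> = 1} \<rparr>"

definition segment :: "'a pair_pre_digraph \<Rightarrow> int \<Rightarrow> int \<Rightarrow> ('a \<times> int) set" where
  "segment G n m = pverts G \<times> {n..m}"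

definition toppling_matrix :: "'a pair_pre_digraph \<Rightarrow> 'a \<times> int \<Rightarrow> 'a \<times> int \<Rightarrow> int" where
  "toppling_matrix G u v =
    (if u = v then int (out_degree (with_proj G) (fst u)) + 2
     else if (u, v) \<in> parcs (ladder G) then - 1 else 0)"

definition stable_configs :: "'a pair_pre_digraph \<Rightarrow> ('a \<times> int) set \<Rightarrow> ('a \<times> int \<Rightarrow> int) set" where
  "stable_configs G V = (\<Pi>\<^sub>E u\<in>V. {1..toppling_matrix G u u})"


text \<open>
  The sandpile Markov chain on a finite \<open>V\<close> adds a grain at a random site (every site having
  positive probability) and then topples unstable sites until the configuration is stable.
  Recurrence of a state of this finite chain is expressed through accessibility.
\<close>

definition topple_step :: "'a pair_pre_digraph \<Rightarrow> ('a \<times> int) set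
    \<Rightarrow> ('a \<times> int \<Rightarrow> int) \<Rightarrow> ('a \<times> int \<Rightarrow> int) \<Rightarrow> bool" where
  "topple_step G V \<eta> \<xi> \<longleftrightarrow> (\<exists>v\<in>V. \<eta> v > toppling_matrix G v v \<and>
     \<xi> = (\<lambda>u\<in>V. \<eta> u - toppling_matrix G v u))"

definition sandpile_step :: "'a pair_pre_digraph \<Rightarrow> ('a \<times> int) set
    \<Rightarrow> ('a \<times> int \<Rightarrow> int) \<Rightarrow> ('a \<times> int \<Rightarrow> int) \<Rightarrow> bool" where
  "sandpile_step G V \<eta> \<xi> \<longleftrightarrow> \<xi> \<in> stable_configs G V \<and>
     (\<exists>v\<in>V. (topple_step G V)\<^sup>*\<^sup>* (\<eta>(v := \<eta> v + 1)) \<xi>)"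

definition recurrent_configs :: "'a pair_pre_digraph \<Rightarrow> ('a \<times> int) set \<Rightarrow> ('a \<times> int \<Rightarrow> int) set" where
  "recurrent_configs G V = {\<eta> \<in> stable_configs G V.
     \<forall>\<xi>. (sandpile_step G V)\<^sup>*\<^sup>* \<eta> \<xi> \<longrightarrow> (sandpile_step G V)\<^sup>*\<^sup>* \<xi> \<eta>}"


text \<open>
  The ladder is a symmetric digraph, so its strongly connected components are the connected
  components of the undirected graph.
\<close>

definition complement_components :: "'a pair_pre_digraph \<Rightarrow> ('a \<times> int) set \<Rightarrow> ('a \<times> int) set set" where
  "complement_components G V =
     pre_digraph.sccs_verts (with_proj (ladder G) \<restriction> (pverts (ladder G) - V))"

definition left_component :: "'a pair_pre_digraph \<Rightarrow> ('a \<times> int) set \<Rightarrow> ('a \<times> int) set" where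
  "left_component G V =
     (THE C. C \<in> complement_components G V \<and> (\<exists>k. pverts G \<times> {..k} \<subseteq> C))"

definition right_component :: "'a pair_pre_digraph \<Rightarrow> ('a \<times> int) set \<Rightarrow> ('a \<times> int) set" where
  "right_component G V =
     (THE C. C \<in> complement_components G V \<and> (\<exists>k. pverts G \<times> {k..} \<subseteq> C))"

definition boundary_towards :: "'a pair_pre_digraph \<Rightarrow> ('a \<times> int) set \<Rightarrow> ('a \<times> int) set \<Rightarrow> ('a \<times> int) set" where
  "boundary_towards G C V = {v \<in> V. \<exists>u\<in>C. (v, u) \<in> parcs (ladder G)}"

text \<open>
  With the enumeration \<open>vs\<close> indexed from 0, the set of sites not yet burnt
  before step \<open>i\<close> is \<open>set (drop i vs)\<close>.
  The parameter \<open>side\<close> is \<open>left_component G\<close> or \<open>right_component G\<close>.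
\<close>

definition burnable_configs :: "'a pair_pre_digraph \<Rightarrow> (('a \<times> int) set \<Rightarrow> ('a \<times> int) set)
    \<Rightarrow> ('a \<times> int) set \<Rightarrow> ('a \<times> int \<Rightarrow> int) set" where
  "burnable_configs G side V = {\<eta> \<in> stable_configs G V.
     \<exists>vs. distinct vs \<and> set vs = V \<and>
       (\<forall>i < length vs. let v = vs ! i; W = set (drop i vs) in
          v \<in> boundary_towards G (side W) W \<and>
          \<eta> v > toppling_matrix G v v - int (card {u \<in> side W. (u, v) \<in> parcs (ladder G)}))}"

definition left_burnable_configs :: "'a pair_pre_digraph \<Rightarrow> ('a \<times> int) set \<Rightarrow> ('a \<times> int \<Rightarrow> int) set" where
  "left_burnable_configs G V = burnable_configs G (left_component G) V"

definition right_burnable_configs :: "'a pair_pre_digraph \<Rightarrow> ('a \<times> int) set \<Rightarrow> ('a \<times> int \<Rightarrow> int) set" where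
  "right_burnable_configs G V = burnable_configs G (right_component G) V"


definition infinite_config_space :: "'a pair_pre_digraph \<Rightarrow> ('a \<times> int \<Rightarrow> int) measure" where
  "infinite_config_space G =
     (\<Pi>\<^sub>M u\<in>pverts (ladder G). count_space {1..toppling_matrix G u u})"

text \<open>
  The measures \<open>M i\<close> may live on configurations on different sets of sites. For a fixed \<open>k\<close>, the
  restriction to \<open>segment G (- k) k\<close> is meaningful as soon as the set of sites of \<open>M i\<close> contains that
  segment, which holds eventually in all uses below.
\<close>

definition weak_limit :: "'a pair_pre_digraph \<Rightarrow> ('i \<Rightarrow> ('a \<times> int \<Rightarrow> int) measure)
    \<Rightarrow> ('a \<times> int \<Rightarrow> int) measure \<Rightarrow> 'i filter \<Rightarrow> bool" where
  "weak_limit G M \<nu> F \<longleftrightarrow>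
     prob_space \<nu> \<and> sets \<nu> = sets (infinite_config_space G) \<and>
     (\<forall>k::nat. \<forall>A \<subseteq> stable_configs G (segment G (- int k) (int k)).
        ((\<lambda>i. measure (M i) {\<eta> \<in> space (M i). restrict \<eta> (segment G (- int k) (int k)) \<in> A})
          \<longlongrightarrow> measure \<nu> {\<eta> \<in> space \<nu>. restrict \<eta> (segment G (- int k) (int k)) \<in> A}) F)"

definition mu :: "'a pair_pre_digraph \<Rightarrow> int \<Rightarrow> int \<Rightarrow> ('a \<times> int \<Rightarrow> int) measure" where
  "mu G n m = uniform_count_measure (recurrent_configs G (segment G n m))"

definition mu_left :: "'a pair_pre_digraph \<Rightarrow> ('a \<times> int \<Rightarrow> int) measure" where
  "mu_left G = (THE \<nu>. weak_limit G
     (\<lambda>(n, m). uniform_count_measure (left_burnable_configs G (segment G n m))) \<nu>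
     (at_bot \<times>\<^sub>F at_top))"

definition mu_right :: "'a pair_pre_digraph \<Rightarrow> ('a \<times> int \<Rightarrow> int) measure" where
  "mu_right G = (THE \<nu>. weak_limit G
     (\<lambda>(n, m). uniform_count_measure (right_burnable_configs G (segment G n m))) \<nu>
     (at_bot \<times>\<^sub>F at_top))"

text \<open>
  Orientation: in a typical recurrent configuration on \<open>segment G n m\<close>, the fires started at the two
  ends meet at a roughly uniform position, and the origin is burnt from the left iff they meet to
  the right of it. Hence \<open>mu_left G\<close> carries the limit of \<open>m / (m - n)\<close> as its weight, and
  \<open>mu_right G\<close> carries the limit of \<open>- n / (m - n)\<close>.
\<close>

definition convex_combination :: "real \<Rightarrow> 'b measure \<Rightarrow> 'b measure \<Rightarrow> 'b measure" where
  "convex_combination p M N = measure_of (space M) (sets M)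
     (\<lambda>A. ennreal p * emeasure M A + ennreal (1 - p) * emeasure N A)"

definition weak_limit_points :: "'a pair_pre_digraph \<Rightarrow> ('a \<times> int \<Rightarrow> int) measure set" where
  "weak_limit_points G = {\<nu>. \<exists>n m :: nat \<Rightarrow> int.
     filterlim n at_bot sequentially \<and> filterlim m at_top sequentially \<and>
     weak_limit G (\<lambda>i. mu G (n i) (m i)) \<nu> sequentially}"

end

theory Submission
  imports Defs "HOL-Computational_Algebra.Formal_Power_Series" "HOL-Real_Asymp.Real_Asymp"
begin

text \<open>
  A left-burnable configuration splits at every column of maximal height into two shorter
  left-burnable configurations, and conversely. Hence the left-burnable configurations on
  \<open>G \<times> {n..m}\<close> form a renewal structure with the full columns as renewals; avoiding full columns
  is exponentially costly, so the renewal theorem gives their number as \<open>c \<lambda>\<^sup>N\<close> with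
  \<open>N = m - n\<close>, and the window between the last full column before and the first full column after
  \<open>{-k..k}\<close> has a limiting law, which defines \<open>mu_left G\<close>. A recurrent configuration, cut at its
  full columns, consists of left-burnable blocks, at most one recurrent block that is not
  left-burnable, and right-burnable blocks after it. The exceptional block has about \<open>N\<close> possible
  positions, all asymptotically equally likely, so the window lies to its left with probability tending to
  the limit of \<open>m / (m - n)\<close>, and then looks like \<open>mu_left G\<close>; otherwise it looks like \<open>mu_right G\<close>.
\<close>

section \<open>Renewal sequences\<close>

text \<open>Left burning, right burning and recurrence are put into one form,
  \<open>burnable C V \<eta>\<close>: every nonempty \<open>W\<close> inside \<open>V\<close> has a
  site higher than the number of its neighbours outside \<open>C W\<close>. Here \<open>C W\<close>
  is the complement of \<open>W\<close> for recurrence, and for one-sided burning it is the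
  component \<open>far s W\<close> that the fire from one end has reached. No enumeration occurs, so
  shrinking \<open>V\<close> and raising heights trivially preserve burnability, and the splitting
  at a full column becomes an argument about sets from which no site can be removed. Reflection of
  the ladder shows that left- and right-burnable words are equally many. Hence the two sides of the
  exceptional block grow at the same rate, no position is favoured, and recurrent words outnumber
  left-burnable ones by a factor of order N. The remaining difficulty is circular: exceptional
  blocks are known to be few only relative to all recurrent words, whose number is itself a
  convolution with these blocks. The exponential cost of avoiding full columns closes this
  loop.\<close>

lemma tendsto_infsum_dominated:
  fixes f :: "'i \<Rightarrow> 'k \<Rightarrow> real"
  assumes lim: "\<And>k. k \<in> A \<Longrightarrow> ((\<lambda>i. f i k) \<longlongrightarrow> g k) F"
    and bound: "eventually (\<lambda>i. \<forall>k\<in>A. \<bar>f i k\<bar> \<le> M k) F"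
    and M: "M summable_on A"
  shows "((\<lambda>i. infsum (f i) A) \<longlongrightarrow> infsum g A) F"
proof (cases "F = bot")
  case False
  have M0: "0 \<le> M k" if "k \<in> A" for k
    using eventually_happens'[OF False bound] that by fastforce
  have g_bound: "\<bar>g k\<bar> \<le> M k" if k: "k \<in> A" for k
    by (rule tendsto_upperbound[OF tendsto_rabs[OF lim[OF k]] _ False])
       (use bound k in \<open>auto elim: eventually_mono\<close>)
  have summ: "h summable_on B" if "B \<subseteq> A" "\<forall>k\<in>A. \<bar>h k\<bar> \<le> M k" for h :: "'k \<Rightarrow> real" and B
  proof -
    have "(\<lambda>k. norm (h k)) summable_on A"
      by (rule summable_on_comparison_test[OF M]) (use that(2) in auto)
    then have "h summable_on A" by (rule abs_summable_summable)
    then show ?thesis by (rule summable_on_subset_banach[OF _ that(1)])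
  qed
  show ?thesis
  \<comment> \<open>Interchange of two limits: the finite partial sums converge to the full sum
    uniformly over all indices that obey the bound, because the tails of \<open>M\<close> control
    the error.\<close>
  proof (rule swap_uniform_limit'[where F = "finite_subsets_at_top A" and S = "{i. \<forall>k\<in>A. \<bar>f i k\<bar> \<le> M k}"
        and f = "\<lambda>X i. sum (f i) X" and g = "\<lambda>X. sum g X"])
    show "\<forall>\<^sub>F X in finite_subsets_at_top A. ((\<lambda>i. sum (f i) X) \<longlongrightarrow> sum g X) F"
      by (intro eventually_finite_subsets_at_top_weakI tendsto_sum) (use lim in auto)
    show "(sum g \<longlongrightarrow> infsum g A) (finite_subsets_at_top A)"
      using has_sum_infsum[OF summ[of A g]] g_bound by (auto simp: has_sum_def)
    show "\<forall>\<^sub>F x in F. x \<in> {i. \<forall>k\<in>A. \<bar>f i k\<bar> \<le> M k}"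
      using bound by simp
    show "uniform_limit {i. \<forall>k\<in>A. \<bar>f i k\<bar> \<le> M k} (\<lambda>X i. sum (f i) X) (\<lambda>i. infsum (f i) A) (finite_subsets_at_top A)"
    proof (rule uniform_limitI)
      fix e :: real assume "e > 0"
      have "(sum M \<longlongrightarrow> infsum M A) (finite_subsets_at_top A)"
        using has_sum_infsum[OF M] by (simp add: has_sum_def)
      then have "\<forall>\<^sub>F X in finite_subsets_at_top A. dist (sum M X) (infsum M A) < e"
        using \<open>e > 0\<close> by (rule tendstoD)
      moreover have "\<forall>\<^sub>F X in finite_subsets_at_top A. finite X \<and> X \<subseteq> A"
        by (rule eventually_finite_subsets_at_top_weakI) auto
      ultimately show "\<forall>\<^sub>F X in finite_subsets_at_top A. \<forall>i\<in>{i. \<forall>k\<in>A. \<bar>f i k\<bar> \<le> M k}.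
          dist (sum (f i) X) (infsum (f i) A) < e"
      proof eventually_elim
        case (elim X)
        show ?case
        proof
          fix i assume i: "i \<in> {i. \<forall>k\<in>A. \<bar>f i k\<bar> \<le> M k}"
          have MX: "M summable_on (A - X)" by (rule summable_on_subset_banach[OF M]) auto
          have split: "infsum h A = sum h X + infsum h (A - X)" if "\<forall>k\<in>A. \<bar>h k\<bar> \<le> M k" for h :: "'k \<Rightarrow> real"
          proof -
            have "X \<union> (A - X) = A" "finite X" using elim by auto
            moreover have "infsum h (X \<union> (A - X)) = infsum h X + infsum h (A - X)"
              using elim that by (intro infsum_Un_disjoint summ) auto
            ultimately show ?thesis by simp
          qed
          have "\<bar>infsum (f i) (A - X)\<bar> \<le> infsum M (A - X)"
          proof -
            have "f i summable_on (A - X)" by (rule summ) (use i in auto)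
            from norm_infsum_le[OF has_sum_infsum[OF this] has_sum_infsum[OF MX]] i
            show ?thesis by auto
          qed
          moreover have "infsum (f i) A = sum (f i) X + infsum (f i) (A - X)"
            by (rule split) (use i in auto)
          moreover have "infsum M A = sum M X + infsum M (A - X)"
            by (rule split) (use M0 in auto)
          ultimately show "dist (sum (f i) X) (infsum (f i) A) < e"
            using elim(1) unfolding dist_real_def by linarith
        qed
      qed
    qed
  qed auto
qed auto

text \<open>For fixed \<open>j\<close> the factor \<open>z (N - j)\<close> tends to
  \<open>l\<close>; since \<open>z\<close> is bounded, a multiple of \<open>\<bar>p j\<bar>\<close>
  is a summable majorant.\<close>

lemma convolution_tendsto:
  fixes p z :: "nat \<Rightarrow> real"
  assumes p: "(\<lambda>j. \<bar>p j\<bar>) summable_on UNIV" and z: "z \<longlonglongrightarrow> l"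
  shows "(\<lambda>N. \<Sum>j\<le>N. p j * z (N - j)) \<longlonglongrightarrow> infsum p UNIV * l"
proof -
  obtain B where B: "\<And>n. \<bar>z n\<bar> \<le> B"
    using convergent_imp_Bseq[of z] z by (auto simp: convergent_def Bseq_def)
  have "(\<lambda>N. infsum (\<lambda>j. if j \<le> N then p j * z (N - j) else 0) UNIV) \<longlonglongrightarrow> infsum (\<lambda>j. p j * l) UNIV"
  proof (rule tendsto_infsum_dominated[where M = "\<lambda>j. \<bar>p j\<bar> * B"])
    fix k :: nat
    have "(\<lambda>N. p k * z (N - k)) \<longlonglongrightarrow> p k * l"
      by (intro tendsto_mult tendsto_const filterlim_compose[OF z] filterlim_minus_const_nat_at_top)
    then show "(\<lambda>N. if k \<le> N then p k * z (N - k) else 0) \<longlonglongrightarrow> p k * l"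
      by (rule Lim_transform_eventually) (rule eventually_mono[OF eventually_ge_at_top[of k]], simp)
  next
    show "\<forall>\<^sub>F i in sequentially. \<forall>k\<in>UNIV. \<bar>if k \<le> i then p k * z (i - k) else 0\<bar> \<le> \<bar>p k\<bar> * B"
      using B order_trans[OF abs_ge_zero B] by (auto simp: abs_mult mult_left_mono)
    show "(\<lambda>j. \<bar>p j\<bar> * B) summable_on UNIV"
      by (intro summable_on_cmult_left p)
  qed
  moreover have "infsum (\<lambda>j. if j \<le> N then p j * z (N - j) else 0) UNIV = (\<Sum>j\<le>N. p j * z (N - j))" for N
    by (subst infsum_cong_neutral[where T = "{..N}" and g = "\<lambda>j. p j * z (N - j)"]) auto
  ultimately show ?thesis
    by (simp add: infsum_cmult_left')
qed

text \<open>Feller's subsequence argument: along indices where \<open>w\<close> approaches its upper limit, so do all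
  the shifted values, because every value is an average of earlier ones and \<open>p 1 > 0\<close>.\<close>

lemma renewal_limsup_le:
  fixes p w r :: "nat \<Rightarrow> real"
  assumes p: "\<And>j. 0 \<le> p j" "p 0 = 0" "0 < p 1" "p sums 1"
    and r: "\<And>k. r k = 1 - sum p {..k}" "r summable_on UNIV"
    and w: "\<And>N. \<bar>w N\<bar> \<le> 1" "\<And>N. 0 < N \<Longrightarrow> w N = (\<Sum>j\<le>N. p j * w (N - j))"
    and s: "\<And>N. (\<Sum>k\<le>N. r k * w (N - k)) = s"
    and e: "0 < e"
  shows "\<forall>\<^sub>F N in sequentially. w N \<le> s / infsum r UNIV + e"
proof -
  have r0: "0 \<le> r k" for k
    using sum_le_suminf[of p "{..k}"] p unfolding r(1) by (auto simp: sums_iff)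
  have p_sum: "p summable_on UNIV" "infsum p UNIV = 1"
    using p norm_summable_imp_summable_on[of p] norm_summable_imp_has_sum[of p 1]
    by (auto simp: sums_iff infsumI)
  obtain \<sigma> where \<sigma>: "strict_mono \<sigma>" "((\<lambda>n. ereal (w n)) \<circ> \<sigma>) \<longlonglongrightarrow> limsup (\<lambda>n. ereal (w n))"
    using limsup_subseq_lim by blast
  have "limsup (\<lambda>n. ereal (w n)) \<le> 1"
    by (rule Limsup_bounded) (use w(1) in \<open>auto simp: abs_le_iff\<close>)
  moreover have "ereal (-1) \<le> limsup (\<lambda>n. ereal (w n))"
    by (rule order_trans[OF Liminf_bounded Liminf_le_Limsup])
       (use w(1) in \<open>auto simp: abs_le_iff minus_le_iff\<close>)
  ultimately obtain E where E: "limsup (\<lambda>n. ereal (w n)) = ereal E"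
    by (cases "limsup (\<lambda>n. ereal (w n))") auto
  \<comment> \<open>The overshoot of \<open>w\<close> above its upper limit \<open>E\<close>. It
    tends to 0, so in the renewal equation every earlier value may be bounded by \<open>E\<close> at
    a vanishing total cost.\<close>
  define z where "z n = max (w n - E) 0" for n
  have upper: "\<forall>\<^sub>F n in sequentially. w n < E + \<epsilon>" if "0 < \<epsilon>" for \<epsilon>
    using Limsup_lessD[of sequentially "\<lambda>n. ereal (w n)" "ereal (E + \<epsilon>)"] that E by simp
  have z: "z \<longlonglongrightarrow> 0"
  proof (rule tendstoI)
    fix \<epsilon> :: real assume "0 < \<epsilon>"
    show "\<forall>\<^sub>F n in sequentially. dist (z n) 0 < \<epsilon>"
      using upper[OF \<open>0 < \<epsilon>\<close>] by eventually_elim (use \<open>0 < \<epsilon>\<close> in \<open>auto simp: z_def dist_real_def\<close>)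
  qed
  have z_bound: "(\<lambda>N. \<Sum>j\<le>N. p j * z (N - j)) \<longlonglongrightarrow> 0"
    using convolution_tendsto[of p z 0] p p_sum z by simp
  have psum: "(\<lambda>N. \<Sum>j\<le>N. p j) \<longlonglongrightarrow> 1"
    using p(4) by (simp add: sums_def_le)
  have step: "(\<lambda>n. w (\<tau> n - 1)) \<longlonglongrightarrow> E" if \<tau>: "filterlim \<tau> at_top sequentially" "(\<lambda>n. w (\<tau> n)) \<longlonglongrightarrow> E" for \<tau> :: "nat \<Rightarrow> nat"
  proof -
    \<comment> \<open>The renewal equation solved for the term with \<open>p 1\<close>, all other
      values being replaced by their bound \<open>E + z\<close>. This gives a lower bound for
      \<open>w (\<tau> n - 1)\<close>, and it tends to \<open>E\<close>.\<close>
    define lo where "lo n = (w (\<tau> n) - E * (\<Sum>j\<le>\<tau> n. p j) - (\<Sum>j\<le>\<tau> n. p j * z (\<tau> n - j))) / p 1 + E" for n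
    have "lo \<longlonglongrightarrow> (E - E * 1 - 0) / p 1 + E"
      unfolding lo_def
      by (intro tendsto_intros \<tau> filterlim_compose[OF psum \<tau>(1)] filterlim_compose[OF z_bound \<tau>(1)])
         (use p in auto)
    then have lo: "lo \<longlonglongrightarrow> E" by simp
    have "(\<lambda>n. E + z (\<tau> n - 1)) \<longlonglongrightarrow> E + 0"
      by (intro tendsto_intros filterlim_compose[OF z] filterlim_compose[OF filterlim_minus_const_nat_at_top \<tau>(1)])
    then have hi: "(\<lambda>n. E + z (\<tau> n - 1)) \<longlonglongrightarrow> E" by simp
    have ge: "\<forall>\<^sub>F n in sequentially. lo n \<le> w (\<tau> n - 1)"
      using filterlim_at_top[THEN iffD1, OF \<tau>(1), rule_format, of 1]
    proof eventually_elim
      case (elim n)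
      let ?N = "\<tau> n"
      have "w ?N - E * (\<Sum>j\<le>?N. p j) - (\<Sum>j\<le>?N. p j * z (?N - j)) =
          (\<Sum>j\<le>?N. p j * (w (?N - j) - E - z (?N - j)))"
        using w(2)[of ?N] elim by (simp add: sum_subtractf[symmetric] sum_distrib_left algebra_simps)
      also have "\<dots> \<le> (\<Sum>j\<le>?N. if j = 1 then p 1 * (w (?N - 1) - E) else 0)"
        using p(1) by (intro sum_mono) (auto simp: z_def intro!: mult_left_mono mult_nonneg_nonpos)
      also have "\<dots> = p 1 * (w (?N - 1) - E)" using elim by simp
      finally show ?case
        unfolding lo_def using p(3) by (simp add: field_simps)
    qed
    show ?thesis
      by (rule tendsto_sandwich[OF ge _ lo hi]) (auto simp: z_def max_def intro!: always_eventually)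
  qed
  have shift: "(\<lambda>n. w (\<sigma> n - k)) \<longlonglongrightarrow> E" for k
  proof (induction k)
    case 0
    show ?case using \<sigma>(2) E by (simp add: o_def)
  next
    case (Suc k)
    have "filterlim (\<lambda>n. \<sigma> n - k) at_top sequentially"
      by (rule filterlim_compose[OF filterlim_minus_const_nat_at_top filterlim_subseq[OF \<sigma>(1)]])
    from step[OF this Suc] show ?case by simp
  qed
  \<comment> \<open>All shifted values tend to \<open>E\<close> along \<open>\<sigma>\<close>, so
    the conserved sum \<open>s\<close> passes to the limit and determines \<open>E\<close>.\<close>
  have "(\<lambda>n. infsum (\<lambda>k. if k \<le> \<sigma> n then r k * w (\<sigma> n - k) else 0) UNIV) \<longlonglongrightarrow> infsum (\<lambda>k. r k * E) UNIV"
  proof (rule tendsto_infsum_dominated[where M = r])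
    fix k :: nat
    have "(\<lambda>n. r k * w (\<sigma> n - k)) \<longlonglongrightarrow> r k * E" by (intro tendsto_intros shift)
    then show "(\<lambda>n. if k \<le> \<sigma> n then r k * w (\<sigma> n - k) else 0) \<longlonglongrightarrow> r k * E"
      by (rule Lim_transform_eventually)
         (rule eventually_mono[OF filterlim_at_top[THEN iffD1, OF filterlim_subseq[OF \<sigma>(1)], rule_format, of k]], simp)
  next
    show "\<forall>\<^sub>F i in sequentially. \<forall>k\<in>UNIV. \<bar>if k \<le> \<sigma> i then r k * w (\<sigma> i - k) else 0\<bar> \<le> r k"
      using r0 w(1) by (auto simp: abs_mult mult_left_le)
  qed (rule r)
  moreover have "infsum (\<lambda>k. if k \<le> \<sigma> n then r k * w (\<sigma> n - k) else 0) UNIV = s" for n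
    by (subst infsum_cong_neutral[where T = "{..\<sigma> n}" and g = "\<lambda>k. r k * w (\<sigma> n - k)"]) (auto simp: s)
  ultimately have "s = infsum r UNIV * E"
    by (simp add: infsum_cmult_left' LIMSEQ_const_iff)
  moreover have "r 0 \<le> infsum r UNIV"
    using finite_sum_le_infsum[OF r(2), of "{0}"] r0 by simp
  moreover have "r 0 = 1" by (simp add: r p)
  ultimately have "E = s / infsum r UNIV" by (auto simp: field_simps)
  then show ?thesis using upper[OF e] by (auto elim: eventually_mono)
qed

text \<open>The tails \<open>r k\<close> turn the recursion into a conserved quantity, which leaves
  \<open>1 / infsum r UNIV\<close> as the only possible limit. Their summability says that the mean
  gap is finite and makes this limit positive; \<open>0 < p 1\<close> provides aperiodicity.\<close>

lemma renewal_theorem: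
  fixes p v :: "nat \<Rightarrow> real"
  assumes p: "\<And>j. 0 \<le> p j" "p 0 = 0" "0 < p 1" "p sums 1"
    and r: "(\<lambda>k. 1 - sum p {..k}) summable_on UNIV"
    and v: "v 0 = 1" "\<And>N. 0 < N \<Longrightarrow> v N = (\<Sum>j\<le>N. p j * v (N - j))"
  obtains c where "0 < c" "v \<longlonglongrightarrow> c"
proof -
  define r where "r k = 1 - sum p {..k}" for k
  have r0: "0 \<le> r k" for k
    using sum_le_suminf[of p "{..k}"] p unfolding r_def by (auto simp: sums_iff)
  have rSuc: "r (Suc k) = r k - p (Suc k)" for k by (simp add: r_def)
  have r_0: "r 0 = 1" by (simp add: r_def p)
  have v0: "0 \<le> v N" for N
  proof (induction N rule: less_induct)
    case (less N)
    show ?case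
    proof (cases "N = 0")
      case False
      then show ?thesis
        using less p(1,2) v(2)[of N]
        by (auto intro!: sum_nonneg) (metis diff_less less_or_eq_imp_le mult_nonneg_nonneg mult_zero_left neq0_conv order_refl)
    qed (simp add: v)
  qed
  \<comment> \<open>Probabilistically: there is exactly one last renewal up to time
    \<open>N\<close>, and the gap after it exceeds the remaining time.\<close>
  have conv1: "(\<Sum>k\<le>N. r k * v (N - k)) = 1" for N
  proof (induction N)
    case 0
    then show ?case by (simp add: r_0 v)
  next
    case (Suc N)
    have "(\<Sum>k\<le>Suc N. r k * v (Suc N - k)) = v (Suc N) + (\<Sum>k\<le>N. r (Suc k) * v (N - k))"
      by (subst sum.atMost_Suc_shift) (simp add: r_0)
    also have "\<dots> = v (Suc N) - (\<Sum>k\<le>N. p (Suc k) * v (N - k)) + (\<Sum>k\<le>N. r k * v (N - k))"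
      by (simp add: rSuc algebra_simps sum.distrib sum_subtractf)
    also have "(\<Sum>k\<le>N. p (Suc k) * v (N - k)) = v (Suc N)"
      by (subst v(2), simp, subst sum.atMost_Suc_shift) (simp add: p)
    finally show ?case by (simp add: Suc)
  qed
  have v1: "\<bar>v N\<bar> \<le> 1" for N
    using member_le_sum[of 0 "{..N}" "\<lambda>k. r k * v (N - k)"] r0 v0 conv1[of N] by (simp add: r_0)
  have "r 0 \<le> infsum r UNIV"
    using finite_sum_le_infsum[of r UNIV "{0}"] r r0 by (simp add: r_def[abs_def])
  then have pos: "0 < 1 / infsum r UNIV" using r_0 by simp
  have "v \<longlonglongrightarrow> 1 / infsum r UNIV"
  proof (rule tendstoI)
    fix e :: real assume "0 < e"
    then have e2: "0 < e / 2" by simp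
    have "\<forall>\<^sub>F N in sequentially. v N \<le> 1 / infsum r UNIV + e / 2"
      by (rule renewal_limsup_le[OF p r_def _ v1 v(2) conv1 e2]) (use r in \<open>simp_all add: r_def\<close>)
    \<comment> \<open>The same upper estimate applied to \<open>- v\<close>, whose conserved sum is
      -1, bounds \<open>v\<close> from below.\<close>
    moreover have "\<forall>\<^sub>F N in sequentially. - v N \<le> (-1) / infsum r UNIV + e / 2"
      by (rule renewal_limsup_le[OF p r_def _ _ _ _ e2])
         (use r v1 v(2) conv1 in \<open>simp_all add: r_def sum_negf\<close>)
    ultimately show "\<forall>\<^sub>F N in sequentially. dist (v N) (1 / infsum r UNIV) < e"
      by eventually_elim (use \<open>0 < e\<close> in \<open>auto simp: dist_real_def abs_if field_simps\<close>)
  qed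
  with pos show ?thesis using that by blast
qed

text \<open>With capitals for generating series, \<open>(1 - P) * V = 1\<close> and
  \<open>(1 - P) * X = B\<close>, hence \<open>X = V * B\<close>.\<close>

lemma renewal_equation_solution:
  fixes p v x b :: "nat \<Rightarrow> real"
  assumes "p 0 = 0" "v 0 = 1" "\<And>N. 0 < N \<Longrightarrow> v N = (\<Sum>j\<le>N. p j * v (N - j))"
    and "\<And>N. x N = (\<Sum>j\<le>N. p j * x (N - j)) + b N"
  shows "x N = (\<Sum>j\<le>N. v j * b (N - j))"
proof -
  have V: "Abs_fps v = Abs_fps p * Abs_fps v + 1"
  proof (rule fps_ext)
    fix N show "fps_nth (Abs_fps v) N = fps_nth (Abs_fps p * Abs_fps v + 1) N"
      by (cases "N = 0") (simp_all add: fps_mult_nth atLeast0AtMost assms(1,2) assms(3)[symmetric])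
  qed
  have X: "Abs_fps x = Abs_fps p * Abs_fps x + Abs_fps b"
    by (rule fps_ext) (simp add: fps_mult_nth atLeast0AtMost assms(4)[symmetric])
  have "(1 - Abs_fps p) * Abs_fps v = 1" using V by (simp add: algebra_simps)
  moreover have "(1 - Abs_fps p) * Abs_fps x = Abs_fps b" using X by (simp add: algebra_simps)
  ultimately have "Abs_fps x = Abs_fps v * Abs_fps b"
    by (metis mult.commute mult.left_commute mult.right_neutral)
  then have "fps_nth (Abs_fps x) N = fps_nth (Abs_fps v * Abs_fps b) N" by simp
  then show ?thesis by (simp add: fps_mult_nth atMost_atLeast0)
qed

lemma cesaro_null:
  fixes x :: "nat \<Rightarrow> real"
  assumes "x \<longlonglongrightarrow> 0"
  shows "(\<lambda>N. (\<Sum>i\<le>N. x i) / (N + 1)) \<longlonglongrightarrow> 0"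
proof (rule tendstoI)
  fix e :: real assume "0 < e"
  then have "\<forall>\<^sub>F n in sequentially. dist (x n) 0 < e / 2"
    by (intro tendstoD[OF assms]) simp
  then obtain n0 where n0: "\<And>n. n0 \<le> n \<Longrightarrow> \<bar>x n\<bar> < e / 2"
    by (auto simp: eventually_sequentially)
  define K where "K = (\<Sum>i<n0. \<bar>x i\<bar>)"
  have "(\<lambda>N. K / real (N + 1)) \<longlonglongrightarrow> 0"
    by (rule LIMSEQ_Suc[OF lim_const_over_n, unfolded Suc_eq_plus1])
  then have "\<forall>\<^sub>F N in sequentially. dist (K / real (N + 1)) 0 < e / 2"
    using \<open>0 < e\<close> by (intro tendstoD) auto
  then show "\<forall>\<^sub>F N in sequentially. dist ((\<Sum>i\<le>N. x i) / real (N + 1)) 0 < e"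
  proof eventually_elim
    case (elim N)
    have "(\<Sum>i\<le>N. \<bar>x i\<bar>) \<le> (\<Sum>i\<le>N. (if i < n0 then \<bar>x i\<bar> else 0) + e / 2)"
      by (intro sum_mono) (use n0 \<open>0 < e\<close> in \<open>auto simp: not_less less_imp_le\<close>)
    also have "\<dots> = (\<Sum>i\<in>{..N} \<inter> {..<n0}. \<bar>x i\<bar>) + real (N + 1) * (e / 2)"
      by (simp add: sum.distrib sum.inter_restrict[symmetric] lessThan_def[symmetric])
         (simp add: sum.inter_restrict lessThan_def)
    also have "(\<Sum>i\<in>{..N} \<inter> {..<n0}. \<bar>x i\<bar>) \<le> K"
      unfolding K_def by (intro sum_mono2) auto
    finally have "(\<Sum>i\<le>N. \<bar>x i\<bar>) \<le> K + real (N + 1) * (e / 2)" by simp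
    then have "(\<Sum>i\<le>N. \<bar>x i\<bar>) / real (N + 1) \<le> (K + real (N + 1) * (e / 2)) / real (N + 1)"
      by (intro divide_right_mono) auto
    moreover have "(K + real (N + 1) * (e / 2)) / real (N + 1) = K / real (N + 1) + e / 2"
      by (simp only: add_divide_distrib nonzero_mult_div_cancel_left[of "real (N + 1)"])
    ultimately have "(\<Sum>i\<le>N. \<bar>x i\<bar>) / real (N + 1) \<le> K / real (N + 1) + e / 2"
      by simp
    moreover have "\<bar>\<Sum>i\<le>N. x i\<bar> / real (N + 1) \<le> (\<Sum>i\<le>N. \<bar>x i\<bar>) / real (N + 1)"
      by (intro divide_right_mono sum_abs) auto
    moreover have "K / real (N + 1) < e / 2"
      using elim unfolding dist_real_def by linarith
    moreover have "dist ((\<Sum>i\<le>N. x i) / real (N + 1)) 0 = \<bar>\<Sum>i\<le>N. x i\<bar> / real (N + 1)"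
      by (simp add: dist_real_def)
    ultimately show ?case by linarith
  qed
qed

text \<open>Replacing first \<open>v\<close> by \<open>c\<close> and then \<open>b\<close> by
  \<open>\<beta>\<close> costs a Cesaro mean of a null sequence each time. This is the source of the
  linear factor in the number of recurrent words: each position of the exceptional block contributes
  about the same.\<close>

lemma convolution_cesaro:
  fixes v b :: "nat \<Rightarrow> real"
  assumes v: "v \<longlonglongrightarrow> c" and b: "b \<longlonglongrightarrow> \<beta>"
  shows "(\<lambda>N. (\<Sum>j\<le>N. v j * b (N - j)) / (N + 1)) \<longlonglongrightarrow> c * \<beta>"
proof -
  obtain B where B: "\<And>n. \<bar>b n\<bar> \<le> B"
    using convergent_imp_Bseq[of b] b by (auto simp: convergent_def Bseq_def)
  have 1: "(\<lambda>N. (\<Sum>i\<le>N. \<bar>v i - c\<bar>) / (N + 1)) \<longlonglongrightarrow> 0"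
    by (intro cesaro_null tendsto_rabs_zero) (use v in \<open>simp add: LIM_zero\<close>)
  have 2: "(\<lambda>N. (\<Sum>i\<le>N. \<bar>b i - \<beta>\<bar>) / (N + 1)) \<longlonglongrightarrow> 0"
    by (intro cesaro_null tendsto_rabs_zero) (use b in \<open>simp add: LIM_zero\<close>)
  have 3: "(\<lambda>N. B * ((\<Sum>i\<le>N. \<bar>v i - c\<bar>) / (N + 1)) + \<bar>c\<bar> * ((\<Sum>i\<le>N. \<bar>b i - \<beta>\<bar>) / (N + 1))) \<longlonglongrightarrow> 0"
    using tendsto_add[OF tendsto_mult_left[OF 1, of B] tendsto_mult_left[OF 2, of "\<bar>c\<bar>"]] by simp
  have "(\<lambda>N. (\<Sum>j\<le>N. v j * b (N - j)) / (N + 1) - c * \<beta>) \<longlonglongrightarrow> 0"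
  proof (rule Lim_null_comparison[OF _ 3], intro always_eventually allI)
    fix N :: nat
    have rev: "(\<Sum>j\<le>N. \<bar>b (N - j) - \<beta>\<bar>) = (\<Sum>j\<le>N. \<bar>b j - \<beta>\<bar>)"
      using sum.atLeastAtMost_rev[of "\<lambda>j. \<bar>b j - \<beta>\<bar>" 0 N] by (simp add: atMost_atLeast0)
    have "\<bar>(\<Sum>j\<le>N. v j * b (N - j)) - (N + 1) * (c * \<beta>)\<bar> = \<bar>\<Sum>j\<le>N. (v j - c) * b (N - j) + c * (b (N - j) - \<beta>)\<bar>"
      by (simp add: algebra_simps sum.distrib sum_subtractf)
    also have "\<dots> \<le> (\<Sum>j\<le>N. \<bar>(v j - c) * b (N - j) + c * (b (N - j) - \<beta>)\<bar>)"
      by (rule sum_abs)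
    also have "\<dots> \<le> (\<Sum>j\<le>N. \<bar>v j - c\<bar> * B + \<bar>c\<bar> * \<bar>b (N - j) - \<beta>\<bar>)"
      by (intro sum_mono order_trans[OF abs_triangle_ineq])
         (auto simp: abs_mult intro!: add_mono mult_left_mono B)
    also have "\<dots> = B * (\<Sum>j\<le>N. \<bar>v j - c\<bar>) + \<bar>c\<bar> * (\<Sum>j\<le>N. \<bar>b j - \<beta>\<bar>)"
      by (simp add: sum.distrib sum_distrib_left sum_distrib_right mult.commute rev[symmetric])
    finally have le: "\<bar>(\<Sum>j\<le>N. v j * b (N - j)) - (N + 1) * (c * \<beta>)\<bar>
        \<le> B * (\<Sum>j\<le>N. \<bar>v j - c\<bar>) + \<bar>c\<bar> * (\<Sum>j\<le>N. \<bar>b j - \<beta>\<bar>)" .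
    have "norm ((\<Sum>j\<le>N. v j * b (N - j)) / real (N + 1) - c * \<beta>)
        = \<bar>(\<Sum>j\<le>N. v j * b (N - j)) - (N + 1) * (c * \<beta>)\<bar> / real (N + 1)"
    proof -
      have "(\<Sum>j\<le>N. v j * b (N - j)) / real (N + 1) - c * \<beta>
          = ((\<Sum>j\<le>N. v j * b (N - j)) - (N + 1) * (c * \<beta>)) / real (N + 1)"
        by (simp add: diff_divide_distrib)
      then show ?thesis by (simp add: abs_divide)
    qed
    also have "\<dots> \<le> (B * (\<Sum>j\<le>N. \<bar>v j - c\<bar>) + \<bar>c\<bar> * (\<Sum>j\<le>N. \<bar>b j - \<beta>\<bar>)) / real (N + 1)"
      using le by (intro divide_right_mono) auto
    finally show "norm ((\<Sum>j\<le>N. v j * b (N - j)) / real (N + 1) - c * \<beta>)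
        \<le> B * ((\<Sum>i\<le>N. \<bar>v i - c\<bar>) / (N + 1)) + \<bar>c\<bar> * ((\<Sum>i\<le>N. \<bar>b i - \<beta>\<bar>) / (N + 1))"
      by (simp add: add_divide_distrib)
  qed
  then show ?thesis by (simp add: LIM_zero_iff)
qed

lemma summable_on_nat_iff_nonneg:
  fixes g :: "nat \<Rightarrow> real"
  assumes "summable g" "\<And>n. 0 \<le> g n"
  shows "g summable_on UNIV"
  using norm_summable_imp_summable_on[of g] assms by simp

text \<open>That \<open>p\<close> has total mass 1 is derived, not assumed. For \<open>x < 1\<close>
  the generating functions satisfy \<open>P(x) V(x) = V(x) - 1\<close>, so
  \<open>P(x) \<le> 1\<close>, and letting \<open>x\<close> tend to 1 bounds the mass by 1. If the
  mass were smaller, then \<open>P(s) < 1\<close> for some \<open>s > 1\<close>, because the bound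
  on \<open>p\<close> gives a radius of convergence beyond 1; then
  \<open>v n \<le> s ^ (- n)\<close> contradicts \<open>rate\<close>.\<close>

lemma renewal_limit:
  fixes p v :: "nat \<Rightarrow> real"
  assumes \<theta>: "0 < \<theta>" "\<theta> < 1"
    and p: "\<And>j. 0 \<le> p j" "\<And>j. p j \<le> B * \<theta> ^ j" "p 0 = 0" "0 < p 1"
    and v: "v 0 = 1" "\<And>N. 0 < N \<Longrightarrow> v N = (\<Sum>j\<le>N. p j * v (N - j))"
    and v01: "\<And>N. 0 \<le> v N" "\<And>N. v N \<le> 1"
    and rate: "\<And>t. 0 < t \<Longrightarrow> t < 1 \<Longrightarrow> \<exists>n. t ^ n < v n"
  obtains c where "0 < c" "v \<longlonglongrightarrow> c"
proof -
  have B: "0 \<le> B" using p(1,2)[of 0] by simp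
  have geo: "summable (\<lambda>j. B * \<theta> ^ j)" using \<theta> by (intro summable_mult summable_geometric) auto
  have summ: "summable p"
    by (rule summable_comparison_test'[OF geo, of 0]) (use p in auto)
  have partial_le: "(\<Sum>j\<le>J. p j * x ^ j) \<le> 1" if x: "0 < x" "x < 1" for x J
  proof -
    have sv: "summable (\<lambda>n. v n * x ^ n)"
      by (rule summable_comparison_test'[OF summable_geometric, of x 0])
         (use x v01 in \<open>auto intro: mult_left_le_one_le\<close>)
    have sp: "summable (\<lambda>n. p n * x ^ n)"
      by (rule summable_comparison_test'[OF summ, of 0])
         (use x p in \<open>auto intro!: mult_left_le power_le_one\<close>)
    let ?V = "\<Sum>n. v n * x ^ n" and ?P = "\<Sum>n. p n * x ^ n"
    have "(\<lambda>k. \<Sum>i\<le>k. (p i * x ^ i) * (v (k - i) * x ^ (k - i))) sums (?P * ?V)"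
      by (rule Cauchy_product_sums) (use sp sv p v01 x in \<open>simp_all add: abs_mult\<close>)
    moreover have "(\<Sum>i\<le>k. (p i * x ^ i) * (v (k - i) * x ^ (k - i))) = v k * x ^ k - (if k = 0 then 1 else 0)" for k
    proof -
      have "(\<Sum>i\<le>k. (p i * x ^ i) * (v (k - i) * x ^ (k - i))) = (\<Sum>i\<le>k. p i * v (k - i)) * x ^ k"
        unfolding sum_distrib_right
        by (intro sum.cong refl) (simp add: power_add[symmetric] algebra_simps)
      also have "(\<Sum>i\<le>k. p i * v (k - i)) * x ^ k = v k * x ^ k - (if k = 0 then 1 else 0)"
      proof (cases "k = 0")
        case False
        then show ?thesis by (simp add: v(2)[symmetric])
      qed (simp add: v p)
      finally show ?thesis .
    qed
    moreover have "(\<lambda>k. v k * x ^ k - (if k = 0 then 1 else 0)) sums (?V - 1)"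
      by (intro sums_diff summable_sums sv) (use sums_If_finite[of "\<lambda>k. k = 0" "\<lambda>_. 1::real"] in simp)
    ultimately have eq: "?P * ?V = ?V - 1" by (simp add: sums_unique2)
    have "(v 0 * x ^ 0) \<le> ?V"
      using sum_le_suminf[OF sv, of "{0}"] v01 x by simp
    then have "1 \<le> ?V" by (simp add: v)
    with eq have "?P * ?V \<le> 1 * ?V" by linarith
    then have "?P \<le> 1" by (rule mult_right_le_imp_le) (use \<open>1 \<le> ?V\<close> in linarith)
    moreover have "(\<Sum>j\<le>J. p j * x ^ j) \<le> ?P"
      by (rule sum_le_suminf[OF sp]) (use p x in auto)
    ultimately show ?thesis by simp
  qed
  have "(\<Sum>j\<le>J. p j) \<le> 1" for J
  proof (rule tendsto_upperbound)
    have "((\<lambda>x. \<Sum>j\<le>J. p j * x ^ j) \<longlongrightarrow> (\<Sum>j\<le>J. p j * 1 ^ j)) (at_left (1::real))"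
      by (intro tendsto_intros)
    then show "((\<lambda>x. \<Sum>j\<le>J. p j * x ^ j) \<longlongrightarrow> (\<Sum>j\<le>J. p j)) (at_left (1::real))" by simp
    show "\<forall>\<^sub>F x in at_left 1. (\<Sum>j\<le>J. p j * x ^ j) \<le> 1"
      using eventually_at_left_real[of 0 1] by (auto elim!: eventually_mono intro: partial_le)
  qed auto
  then have le1: "suminf p \<le> 1"
    by (intro suminf_le_const[OF summ]) (metis lessThan_Suc_atMost not0_implies_Suc sum.empty lessThan_0 zero_le_one)
  have ge1: "1 \<le> suminf p"
  proof (rule ccontr)
    assume "\<not> 1 \<le> suminf p"
    \<comment> \<open>A point between 1 and the radius of convergence guaranteed by the bound on
      \<open>p\<close>: \<open>\<theta> * K = sqrt \<theta>\<close> is still below 1.\<close>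
    define K where "K = 1 / sqrt \<theta>"
    have K1: "1 < K" using \<theta> by (simp add: K_def)
    have sq: "sqrt \<theta> * sqrt \<theta> = \<theta>" using \<theta> by simp
    have "summable (\<lambda>j. p j * K ^ j)"
    proof (rule summable_comparison_test'[of "\<lambda>j. B * sqrt \<theta> ^ j" 0])
      show "summable (\<lambda>j. B * sqrt \<theta> ^ j)"
        using \<theta> by (intro summable_mult summable_geometric) (auto simp: real_sqrt_lt_1_iff)
      fix j
      have "p j * K ^ j \<le> B * \<theta> ^ j * K ^ j" using p(2) K1 by (intro mult_right_mono) auto
      also have "\<dots> = B * (\<theta> * K) ^ j" by (simp add: power_mult_distrib)
      also have "\<theta> * K = sqrt \<theta>" using \<theta> sq by (simp add: K_def field_simps)
      finally show "norm (p j * K ^ j) \<le> B * sqrt \<theta> ^ j" using p(1)[of j] K1 by simp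
    qed
    then have cont: "isCont (\<lambda>x. \<Sum>j. p j * x ^ j) 1"
      by (rule isCont_powser) (use K1 in auto)
    have "((\<lambda>x. \<Sum>j. p j * x ^ j) \<longlongrightarrow> suminf p) (at_right (1::real))"
      using cont unfolding isCont_def by (auto simp: filterlim_at_split)
    then have "\<forall>\<^sub>F x in at_right (1::real). (\<Sum>j. p j * x ^ j) < 1"
      using \<open>\<not> 1 \<le> suminf p\<close> by (intro order_tendstoD) auto
    moreover have "\<forall>\<^sub>F x in at_right (1::real). x \<in> {1<..<K}"
      by (rule eventually_at_right_real[OF K1])
    ultimately have "\<forall>\<^sub>F x in at_right (1::real). (\<Sum>j. p j * x ^ j) < 1 \<and> x \<in> {1<..<K}"
      by eventually_elim auto
    then obtain s where s: "(\<Sum>j. p j * s ^ j) < 1" "1 < s" "s < K"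
      using eventually_happens[of _ "at_right (1::real)"] by (auto simp: trivial_limit_at_right_real)
    have sps: "summable (\<lambda>j. p j * s ^ j)"
      by (rule powser_inside[OF \<open>summable (\<lambda>j. p j * K ^ j)\<close>]) (use s in auto)
    have dec: "v N * s ^ N \<le> 1" for N
    proof (induction N rule: less_induct)
      case (less N)
      show ?case
      proof (cases "N = 0")
        case False
        have "v N * s ^ N = (\<Sum>j\<le>N. (p j * s ^ j) * (v (N - j) * s ^ (N - j)))"
          using False unfolding v(2)[OF False[unfolded neq0_conv]] sum_distrib_right
          by (intro sum.cong refl) (simp add: power_add[symmetric] algebra_simps)
        also have "\<dots> \<le> (\<Sum>j\<le>N. p j * s ^ j)"
        proof (rule sum_mono)
          fix j assume "j \<in> {..N}"
          show "(p j * s ^ j) * (v (N - j) * s ^ (N - j)) \<le> p j * s ^ j"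
          proof (cases "j = 0")
            case False
            then have "v (N - j) * s ^ (N - j) \<le> 1" using less \<open>N \<noteq> 0\<close> by auto
            then show ?thesis using p(1) s(2) by (intro mult_left_le) auto
          qed (simp add: p)
        qed
        also have "\<dots> \<le> (\<Sum>j. p j * s ^ j)"
          by (rule sum_le_suminf[OF sps]) (use p s in auto)
        finally show ?thesis using s by simp
      qed (simp add: v)
    qed
    obtain n where "(1 / s) ^ n < v n" using rate[of "1 / s"] s by auto
    then have "1 < v n * s ^ n" using s by (simp add: power_divide field_simps)
    then show False using dec[of n] by simp
  qed
  have psums: "p sums 1" using le1 ge1 summ by (simp add: sums_iff)
  have tail: "1 - sum p {..k} \<le> (B * \<theta> / (1 - \<theta>)) * \<theta> ^ k" for k
  proof -
    have "1 - sum p {..k} = (\<Sum>j. p (j + Suc k))"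
      using suminf_minus_initial_segment[OF summ, of "Suc k"] psums by (simp add: sums_iff lessThan_Suc_atMost)
    also have "\<dots> \<le> (\<Sum>j. (B * \<theta> ^ Suc k) * \<theta> ^ j)"
    proof (rule suminf_le)
      show "p (j + Suc k) \<le> (B * \<theta> ^ Suc k) * \<theta> ^ j" for j
        using p(2)[of "j + Suc k"] by (simp add: power_add algebra_simps)
      show "summable (\<lambda>j. p (j + Suc k))" using summ by (subst summable_iff_shift)
      show "summable (\<lambda>j. (B * \<theta> ^ Suc k) * \<theta> ^ j)"
        using \<theta> by (intro summable_mult summable_geometric) auto
    qed
    also have "\<dots> = (B * \<theta> ^ Suc k) * (1 / (1 - \<theta>))"
      using \<theta> by (subst suminf_mult) (auto simp: suminf_geometric intro!: summable_geometric)
    finally show ?thesis by (simp add: field_simps)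
  qed
  have "(\<lambda>k. 1 - sum p {..k}) summable_on UNIV"
  proof (rule summable_on_comparison_test)
    show "(\<lambda>k. (B * \<theta> / (1 - \<theta>)) * \<theta> ^ k) summable_on UNIV"
      using \<theta> B by (intro summable_on_nat_iff_nonneg summable_mult summable_geometric) auto
    show "0 \<le> 1 - sum p {..k}" for k
      using sum_le_suminf[OF summ, of "{..k}"] p(1) psums by (auto simp: sums_iff)
  qed (rule tail)
  note * = this
  show ?thesis
    by (rule renewal_theorem[where p = p and v = v, OF p(1,3,4) psums * v(1)]) (erule v(2), erule (1) that)
qed

text \<open>The shape of all window counts: \<open>i\<close> and \<open>j\<close> are the distances
  from the window to the nearest full columns, \<open>h\<close> weighs what lies between them, and
  \<open>x\<close>, \<open>y\<close> count what lies outside. Since \<open>h\<close> is summable it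
  dominates, and only the limit for fixed \<open>i\<close> and \<open>j\<close> matters.\<close>

lemma window_sum_tendsto:
  fixes x y :: "'t \<Rightarrow> nat \<Rightarrow> real" and h :: "nat \<times> nat \<Rightarrow> real"
  assumes a: "filterlim a at_top F" and b: "filterlim b at_top F"
    and h: "\<And>k. 0 \<le> h k" "h summable_on UNIV"
    and bound: "\<forall>\<^sub>F t in F. \<forall>i\<le>a t. \<forall>j\<le>b t. \<bar>x t i * y t j\<bar> \<le> B"
    and lim: "\<And>i j. ((\<lambda>t. x t i * y t j) \<longlongrightarrow> l) F"
  shows "((\<lambda>t. \<Sum>i\<le>a t. \<Sum>j\<le>b t. x t i * h (i, j) * y t j) \<longlongrightarrow> l * infsum h UNIV) F"
proof -
  let ?f = "\<lambda>t (i, j). if i \<le> a t \<and> j \<le> b t then x t i * y t j * h (i, j) else 0"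
  have "((\<lambda>t. infsum (?f t) UNIV) \<longlongrightarrow> infsum (\<lambda>k. l * h k) UNIV) F"
  proof (rule tendsto_infsum_dominated[where M = "\<lambda>k. max B 0 * h k"])
    fix k :: "nat \<times> nat"
    obtain i j where k: "k = (i, j)" by (cases k)
    have "((\<lambda>t. x t i * y t j * h (i, j)) \<longlongrightarrow> l * h k) F"
      unfolding k by (intro tendsto_mult_right lim)
    moreover have "\<forall>\<^sub>F t in F. x t i * y t j * h (i, j) = ?f t k"
      using a[unfolded filterlim_at_top, rule_format, of i] b[unfolded filterlim_at_top, rule_format, of j]
      by eventually_elim (simp add: k)
    ultimately show "((\<lambda>t. ?f t k) \<longlongrightarrow> l * h k) F"
      by (rule Lim_transform_eventually)
  next
    show "\<forall>\<^sub>F t in F. \<forall>k\<in>UNIV. \<bar>?f t k\<bar> \<le> max B 0 * h k"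
      using bound
    proof eventually_elim
      case (elim t)
      have "\<bar>x t i * y t j\<bar> * h (i, j) \<le> max B 0 * h (i, j)" if "i \<le> a t" "j \<le> b t" for i j
        using elim that h(1)[of "(i, j)"] by (intro mult_right_mono) (auto simp: le_max_iff_disj)
      then show ?case using h(1) by (auto simp: abs_mult)
    qed
    show "(\<lambda>k. max B 0 * h k) summable_on UNIV"
      by (intro summable_on_cmult_right h)
  qed
  moreover have "infsum (?f t) UNIV = (\<Sum>i\<le>a t. \<Sum>j\<le>b t. x t i * h (i, j) * y t j)" for t
  proof -
    have "infsum (?f t) UNIV = infsum (\<lambda>(i, j). x t i * h (i, j) * y t j) ({..a t} \<times> {..b t})"
      by (rule infsum_cong_neutral) (auto split: if_splits)
    then show ?thesis by (simp add: sum.cartesian_product)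
  qed
  ultimately show ?thesis
    by (simp add: infsum_cmult_right')
qed

lemma summable_on_product_nat:
  fixes f g :: "nat \<Rightarrow> real"
  assumes "f summable_on UNIV" "g summable_on UNIV" "\<And>n. 0 \<le> f n" "\<And>n. 0 \<le> g n"
  shows "(\<lambda>(i, j). f i * g j) summable_on UNIV"
proof -
  have "(\<lambda>(i, j). f i * g j) summable_on UNIV \<times> UNIV"
  proof (rule nonneg_bounded_partial_sums_imp_summable_on)
    show "\<forall>\<^sub>F X in finite_subsets_at_top (UNIV \<times> UNIV).
        sum (\<lambda>(i, j). f i * g j) X \<le> infsum f UNIV * infsum g UNIV"
    proof (rule eventually_finite_subsets_at_top_weakI)
      fix X :: "(nat \<times> nat) set" assume X: "finite X"
      have "sum (\<lambda>(i, j). f i * g j) X \<le> sum (\<lambda>(i, j). f i * g j) (fst ` X \<times> snd ` X)"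
        using X assms by (intro sum_mono2) (auto simp: subset_fst_snd)
      also have "\<dots> = sum f (fst ` X) * sum g (snd ` X)"
        by (simp add: sum_product sum.cartesian_product)
      also have "\<dots> \<le> infsum f UNIV * infsum g UNIV"
        using X assms by (intro mult_mono finite_sum_le_infsum sum_nonneg infsum_nonneg) auto
      finally show "sum (\<lambda>(i, j). f i * g j) X \<le> infsum f UNIV * infsum g UNIV" .
    qed
  qed (use assms in auto)
  then show ?thesis by simp
qed

section \<open>Words with separators\<close>

definition words :: "'c set \<Rightarrow> nat \<Rightarrow> 'c list set" where
  "words S n = {w. set w \<subseteq> S \<and> length w = n}"

text \<open>Treating the boundary of a word as one more separator makes the renewal structure exact: a prefix
  of length \<open>n - 1\<close> that stops at the boundary or just before a separator becomes a word of
  \<open>sep_last S e n\<close>, and the empty word stands for the boundary itself.\<close>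

definition sep_first :: "'c set \<Rightarrow> 'c \<Rightarrow> nat \<Rightarrow> 'c list set" where
  "sep_first S e n = (if n = 0 then {[]} else (#) e ` words S (n - 1))"

definition sep_last :: "'c set \<Rightarrow> 'c \<Rightarrow> nat \<Rightarrow> 'c list set" where
  "sep_last S e n = rev ` sep_first S e n"

lemma finite_words [simp]: "finite S \<Longrightarrow> finite (words S n)"
  unfolding words_def by (rule finite_lists_length_eq)

lemma words_0 [simp]: "words S 0 = {[]}"
  by (auto simp: words_def)

lemma words_Suc: "words S (Suc n) = (\<lambda>(c, w). c # w) ` (S \<times> words S n)"
  by (auto simp: words_def length_Suc_conv image_iff)

lemma sum_words_Suc:
  "(\<Sum>w\<in>words S (Suc n). F w) = (\<Sum>c\<in>S. \<Sum>w\<in>words S n. F (c # w))"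
  unfolding words_Suc
  by (subst sum.reindex) (auto simp: inj_on_def sum.cartesian_product case_prod_unfold)

lemma rev_words: "rev ` words S n = words S n"
proof -
  have "rev w \<in> words S n" if "w \<in> words S n" for w using that by (simp add: words_def)
  then show ?thesis by (metis (no_types, opaque_lifting) image_iff rev_rev_ident subsetI subset_antisym image_subsetI)
qed

lemma sum_words_rev: "(\<Sum>w\<in>words S n. F (rev w)) = (\<Sum>w\<in>words S n. F w)"
  using sum.reindex[of rev "words S n" F] by (simp add: rev_words)

lemma sum_words_add:
  "(\<Sum>w\<in>words S (m + n). F w) = (\<Sum>x\<in>words S m. \<Sum>y\<in>words S n. F (x @ y))"
  by (induction m arbitrary: F) (simp_all add: sum_words_Suc)

lemma card_words: "finite S \<Longrightarrow> card (words S n) = card S ^ n"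
  unfolding words_def by (rule card_lists_length_eq)

lemma sum_sep_first_Suc: "(\<Sum>z\<in>sep_first S e (Suc n). F z) = (\<Sum>w\<in>words S n. F (e # w))"
  by (simp add: sep_first_def sum.reindex)

lemma sum_sep_last: "(\<Sum>z\<in>sep_last S e n. F z) = (\<Sum>z\<in>sep_first S e n. F (rev z))"
  unfolding sep_last_def by (subst sum.reindex) (auto simp: inj_on_def)

text \<open>\<open>i\<close> is the position of the first \<open>e\<close>; \<open>i = n\<close>
  stands for a word without \<open>e\<close>, whose remainder is the empty word.\<close>

lemma sum_words_split_first:
  assumes "finite S" "e \<in> S"
  shows "(\<Sum>w\<in>words S n. F w) = (\<Sum>i\<le>n. \<Sum>p\<in>words (S - {e}) i. \<Sum>z\<in>sep_first S e (n - i). F (p @ z))"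
proof (induction n arbitrary: F)
  case 0
  then show ?case by (simp add: sep_first_def)
next
  case (Suc n)
  have "(\<Sum>i\<le>Suc n. \<Sum>p\<in>words (S - {e}) i. \<Sum>z\<in>sep_first S e (Suc n - i). F (p @ z))
      = (\<Sum>z\<in>sep_first S e (Suc n). F z)
        + (\<Sum>i\<le>n. \<Sum>c\<in>S - {e}. \<Sum>p\<in>words (S - {e}) i. \<Sum>z\<in>sep_first S e (n - i). F (c # p @ z))"
    by (subst sum.atMost_Suc_shift) (simp add: sum_words_Suc)
  also have "(\<Sum>i\<le>n. \<Sum>c\<in>S - {e}. \<Sum>p\<in>words (S - {e}) i. \<Sum>z\<in>sep_first S e (n - i). F (c # p @ z))
      = (\<Sum>c\<in>S - {e}. \<Sum>i\<le>n. \<Sum>p\<in>words (S - {e}) i. \<Sum>z\<in>sep_first S e (n - i). F (c # p @ z))"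
    by (rule sum.swap)
  also have "\<dots> = (\<Sum>c\<in>S - {e}. \<Sum>w\<in>words S n. F (c # w))"
    by (intro sum.cong refl Suc[symmetric])
  also have "(\<Sum>z\<in>sep_first S e (Suc n). F z) = (\<Sum>w\<in>words S n. F (e # w))"
    by (rule sum_sep_first_Suc)
  also have "(\<Sum>w\<in>words S n. F (e # w)) + (\<Sum>c\<in>S - {e}. \<Sum>w\<in>words S n. F (c # w))
      = (\<Sum>w\<in>words S (Suc n). F w)"
    using assms by (simp add: sum_words_Suc sum.remove)
  finally show ?case by simp
qed

lemma sum_words_split_last:
  assumes "finite S" "e \<in> S"
  shows "(\<Sum>w\<in>words S n. F w) = (\<Sum>i\<le>n. \<Sum>z\<in>sep_last S e (n - i). \<Sum>p\<in>words (S - {e}) i. F (z @ p))"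
proof -
  have "(\<Sum>w\<in>words S n. F w) = (\<Sum>w\<in>words S n. F (rev w))"
    by (simp add: sum_words_rev)
  also have "\<dots> = (\<Sum>i\<le>n. \<Sum>p\<in>words (S - {e}) i. \<Sum>z\<in>sep_first S e (n - i). F (rev z @ rev p))"
    by (subst sum_words_split_first[OF assms]) simp
  also have "\<dots> = (\<Sum>i\<le>n. \<Sum>z\<in>sep_first S e (n - i). \<Sum>p\<in>words (S - {e}) i. F (rev z @ rev p))"
    by (intro sum.cong refl sum.swap)
  also have "\<dots> = (\<Sum>i\<le>n. \<Sum>z\<in>sep_last S e (n - i). \<Sum>p\<in>words (S - {e}) i. F (z @ p))"
    unfolding sum_sep_last by (rule sum.cong[OF refl], rule sum.cong[OF refl], rule sum_words_rev)
  finally show ?thesis .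
qed

text \<open>Overwriting a letter by \<open>e\<close> is at most \<open>card S\<close>-to-one, so avoiding \<open>e\<close> at a given position
  costs a factor \<open>card S / (card S + 1)\<close>.\<close>

lemma card_avoiding_le:
  assumes S: "finite S" "e \<in> S" and I: "finite I" "I \<subseteq> {..<n}"
    and X: "X \<subseteq> words S n" "\<And>w i. w \<in> X \<Longrightarrow> i \<in> I \<Longrightarrow> w[i := e] \<in> X"
  shows "real (card {w\<in>X. \<forall>i\<in>I. w ! i \<noteq> e}) \<le> (card S / (card S + 1)) ^ card I * card X"
  using I X
proof (induction I arbitrary: X rule: finite_induct)
  case (insert i I)
  have finX: "finite X" using insert.prems(2) S finite_subset finite_words by blast
  define X' where "X' = {w\<in>X. w ! i \<noteq> e}"
  define X0 where "X0 = {w\<in>X. w ! i = e}"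
  have len: "length w = n" "set w \<subseteq> S" if "w \<in> X" for w using that insert.prems(2) by (auto simp: words_def)
  have "card X' \<le> card (X0 \<times> S)"
  proof (rule card_inj_on_le[of "\<lambda>w. (w[i := e], w ! i)"])
    show "inj_on (\<lambda>w. (w[i := e], w ! i)) X'"
    proof (rule inj_onI)
      fix w w' assume "w \<in> X'" "w' \<in> X'" "(w[i := e], w ! i) = (w'[i := e], w' ! i)"
      then have "w[i := e] = w'[i := e]" "w ! i = w' ! i" by auto
      then show "w = w'" by (metis list_update_id list_update_overwrite)
    qed
    show "(\<lambda>w. (w[i := e], w ! i)) ` X' \<subseteq> X0 \<times> S"
      using insert.prems len by (fastforce simp: X'_def X0_def)
    show "finite (X0 \<times> S)" using finX S by (auto simp: X0_def)
  qed
  also have "\<dots> = card S * card X0" by (simp add: card_cartesian_product)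
  finally have "card X' \<le> card S * card X0" .
  moreover have "card X = card X' + card X0"
    using finX by (subst card_Un_disjoint[symmetric]) (auto simp: X'_def X0_def intro: arg_cong[of _ _ card])
  ultimately have "real (card X') * (card S + 1) \<le> card S * card X"
    by (simp add: algebra_simps) (metis of_nat_le_iff of_nat_mult)
  then have *: "real (card X') \<le> (card S / (card S + 1)) * card X" by (simp add: field_simps)
  have "{w\<in>X. \<forall>k\<in>insert i I. w ! k \<noteq> e} = {w\<in>X'. \<forall>k\<in>I. w ! k \<noteq> e}" by (auto simp: X'_def)
  then have "real (card {w\<in>X. \<forall>k\<in>insert i I. w ! k \<noteq> e}) \<le> (card S / (card S + 1)) ^ card I * card X'"
  proof (simp only:, intro insert.IH)
    show "w[k := e] \<in> X'" if "w \<in> X'" "k \<in> I" for w k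
    proof -
      have "k \<noteq> i" using that insert.hyps(2) by blast
      then show ?thesis using that insert.prems(3)[of w k] by (simp add: X'_def)
    qed
  qed (use insert.prems in \<open>auto simp: X'_def\<close>)
  also have "\<dots> \<le> (card S / (card S + 1)) ^ card I * ((card S / (card S + 1)) * card X)"
    using * by (intro mult_left_mono) auto
  finally show ?case using insert(1,2) by (simp add: algebra_simps)
qed simp

text \<open>Only monotonicity is assumed; in the application \<open>e\<close> is the column of
  maximal height. This alone makes the avoidance of \<open>e\<close> exponentially rare, and it
  holds for recurrent words too, which do not split independently at \<open>e\<close>.\<close>

locale separated_words =
  fixes S :: "'c set" and e :: 'c and P :: "'c list \<Rightarrow> bool"
  assumes finite_S: "finite S" and e_in_S: "e \<in> S"
    and update: "\<And>w i. set w \<subseteq> S \<Longrightarrow> i < length w \<Longrightarrow> P w \<Longrightarrow> P (w[i := e])"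
begin

definition sparsity :: real where "sparsity = card S / (card S + 1)"

lemma sparsity: "0 < sparsity" "sparsity < 1"
proof -
  have "0 < card S" using finite_S e_in_S by (auto simp: card_gt_0_iff)
  then show "0 < sparsity" "sparsity < 1" by (simp_all add: sparsity_def)
qed

definition count :: "nat \<Rightarrow> real" where "count n = (\<Sum>w\<in>words S n. of_bool (P w))"

text \<open>The window content together with the stretches that separate it from the nearest
  \<open>e\<close> on either side, of lengths \<open>i\<close> and \<open>j\<close>.\<close>

definition window_count :: "'c list set \<Rightarrow> nat \<times> nat \<Rightarrow> real" where
  "window_count A = (\<lambda>(i, j). \<Sum>p\<in>words (S - {e}) i. \<Sum>x\<in>A. \<Sum>q\<in>words (S - {e}) j. of_bool (P (p @ x @ q)))"

lemma count_nonneg: "0 \<le> count n" by (simp add: count_def sum_nonneg)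

lemma window_count_nonneg: "0 \<le> window_count A k"
  by (simp add: window_count_def sum_nonneg split: prod.split)

text \<open>The \<open>i + j\<close> letters of \<open>p\<close> and \<open>q\<close> all avoid
  \<open>e\<close>, and by \<open>card_avoiding_le\<close> each of them costs a factor
  \<open>sparsity\<close> among the words of the same length.\<close>

lemma window_count_le:
  assumes A: "A \<subseteq> words S d"
  shows "window_count A (i, j) \<le> sparsity ^ (i + j) * count (i + d + j)"
proof -
  let ?n = "i + d + j"
  let ?I = "{..<i} \<union> {i + d..<i + d + j}"
  let ?X = "{w\<in>words S ?n. P w}"
  let ?T = "{(p, x, q) \<in> words (S - {e}) i \<times> A \<times> words (S - {e}) j. P (p @ x @ q)}"
  have finA: "finite A" using A finite_S finite_subset finite_words by blast
  let ?B = "words (S - {e}) i \<times> A \<times> words (S - {e}) j"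
  define Q where "Q = (\<lambda>(p, x, q). P (p @ x @ q))"
  have "window_count A (i, j) = (\<Sum>t\<in>?B. of_bool (Q t))"
    by (simp add: window_count_def sum.cartesian_product Q_def case_prod_unfold)
  also have "\<dots> = card (?B \<inter> {t. Q t})"
    using finite_S finA by simp
  also have "?B \<inter> {t. Q t} = ?T" by (auto simp: Q_def)
  also have "card ?T \<le> card {w\<in>?X. \<forall>k\<in>?I. w ! k \<noteq> e}"
  proof (rule card_inj_on_le[of "\<lambda>(p, x, q). p @ x @ q"])
    show "inj_on (\<lambda>(p, x, q). p @ x @ q) ?T"
      using A by (auto simp: inj_on_def words_def)
    show "(\<lambda>(p, x, q). p @ x @ q) ` ?T \<subseteq> {w\<in>?X. \<forall>k\<in>?I. w ! k \<noteq> e}"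
    proof clarsimp
      fix p x q assume *: "p \<in> words (S - {e}) i" "x \<in> A" "q \<in> words (S - {e}) j" "P (p @ x @ q)"
      then have len: "length p = i" "length x = d" "length q = j" using A by (auto simp: words_def)
      have sub: "set p \<subseteq> S - {e}" "set q \<subseteq> S - {e}" using * by (auto simp: words_def)
      have P': "p ! k \<noteq> e" if "k < i" for k using subsetD[OF sub(1) nth_mem[of k p]] len that by simp
      have Q': "q ! k \<noteq> e" if "k < j" for k using subsetD[OF sub(2) nth_mem[of k q]] len that by simp
      have "(p @ x @ q) ! k \<noteq> e" if "k \<in> ?I" for k
      proof (cases "k < i")
        case False
        then have "k - (i + d) < j" "(p @ x @ q) ! k = q ! (k - (i + d))"
          using that len by (auto simp: nth_append)
        then show ?thesis using Q' by simp
      qed (use P' len in \<open>simp add: nth_append\<close>)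
      moreover have "p @ x @ q \<in> words S (i + d + j)" using * A by (auto simp: words_def)
      ultimately show "p @ x @ q \<in> words S (i + d + j) \<and> (\<forall>k\<in>?I. (p @ x @ q) ! k \<noteq> e)"
        by blast
    qed
    show "finite {w\<in>?X. \<forall>k\<in>?I. w ! k \<noteq> e}" using finite_S by auto
  qed
  also have "real (card {w\<in>?X. \<forall>k\<in>?I. w ! k \<noteq> e}) \<le> sparsity ^ card ?I * card ?X"
    unfolding sparsity_def
  proof (rule card_avoiding_le[OF finite_S e_in_S, where n = ?n])
    fix w k assume "w \<in> ?X" "k \<in> ?I"
    then show "w[k := e] \<in> ?X"
      using e_in_S update[of w k] set_update_subset_insert[of w k e] by (auto simp: words_def)
  qed auto
  also have "card ?I = i + j" by (subst card_Un_disjoint) auto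
  also have "real (card ?X) = count ?n"
    using finite_S by (simp add: count_def Int_def)
  finally show ?thesis by (simp add: of_nat_mono)
qed

end

locale renewal_words = separated_words S e P for S :: "'c set" and e P +
  assumes Nil: "P []"
    and split: "\<And>x y. set x \<subseteq> S \<Longrightarrow> set y \<subseteq> S \<Longrightarrow> P (x @ e # y) \<longleftrightarrow> P x \<and> P y"
begin

text \<open>The index is shifted by one to count the boundary separator, so that a gap of
  \<open>i\<close> letters advances the index by \<open>i + 1\<close> and \<open>u\<close> obeys a
  renewal equation without boundary term.\<close>

definition u :: "nat \<Rightarrow> real" where "u n = (if n = 0 then 1 else count (n - 1))"

definition gap_count :: "nat \<Rightarrow> real" where
  "gap_count n = (\<Sum>w\<in>words (S - {e}) n. of_bool (P w))"

lemma u_Suc: "u (Suc n) = count n" and u_0: "u 0 = 1" by (simp_all add: u_def)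

lemma sum_sep_first: "(\<Sum>z\<in>sep_first S e n. of_bool (P z)) = u n"
proof (cases n)
  case (Suc m)
  have "P (e # w) = P w" if "w \<in> words S m" for w
    using split[of "[]" w] Nil that by (auto simp: words_def)
  then show ?thesis by (simp add: Suc sum_sep_first_Suc u_Suc count_def)
qed (simp add: sep_first_def u_0 Nil)

lemma sum_sep_last: "(\<Sum>z\<in>sep_last S e n. of_bool (P z)) = u n"
proof (cases n)
  case (Suc m)
  have "P (rev w @ [e]) = P (rev w)" if "w \<in> words S m" for w
    using split[of "rev w" "[]"] Nil that by (auto simp: words_def)
  then have "(\<Sum>z\<in>sep_last S e n. of_bool (P z)) = (\<Sum>w\<in>words S m. of_bool (P (rev w)))"
    by (simp add: Suc Submission.sum_sep_last sum_sep_first_Suc)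
  then show ?thesis by (simp add: Suc u_Suc count_def sum_words_rev[of "\<lambda>w. of_bool (P w)"])
qed (simp add: sep_last_def sep_first_def u_0 Nil)

lemma split_first:
  assumes "set p \<subseteq> S" "z \<in> sep_first S e n"
  shows "P (p @ z) \<longleftrightarrow> P p \<and> P z"
  using assms split[of p] split[of "[]"] Nil by (auto simp: sep_first_def words_def split: if_splits)

lemma split_last:
  assumes "set p \<subseteq> S" "z \<in> sep_last S e n"
  shows "P (z @ p) \<longleftrightarrow> P z \<and> P p"
proof (cases n)
  case (Suc m)
  then obtain w where "z = rev w @ [e]" "w \<in> words S m" using assms by (auto simp: sep_last_def sep_first_def)
  then show ?thesis using assms split[of "rev w" p] split[of "rev w" "[]"] Nil by (auto simp: words_def)
qed (use assms Nil in \<open>auto simp: sep_last_def sep_first_def\<close>)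

text \<open>Cut at the first \<open>e\<close>: by \<open>split_first\<close> the gap before it and
  the remainder satisfy \<open>P\<close> independently.\<close>

lemma u_renewal: "u (Suc n) = (\<Sum>i\<le>n. gap_count i * u (n - i))"
proof -
  have "u (Suc n) = (\<Sum>i\<le>n. \<Sum>p\<in>words (S - {e}) i. \<Sum>z\<in>sep_first S e (n - i). of_bool (P (p @ z)))"
    unfolding u_Suc count_def by (rule sum_words_split_first[OF finite_S e_in_S])
  also have "\<dots> = (\<Sum>i\<le>n. \<Sum>p\<in>words (S - {e}) i. \<Sum>z\<in>sep_first S e (n - i). of_bool (P p) * of_bool (P z))"
  proof (intro sum.cong refl)
    fix i p z assume "p \<in> words (S - {e}) i" "z \<in> sep_first S e (n - i)"
    then show "of_bool (P (p @ z)) = of_bool (P p) * (of_bool (P z) :: real)"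
      using split_first[of p z "n - i"] by (auto simp: words_def)
  qed
  also have "\<dots> = (\<Sum>i\<le>n. gap_count i * u (n - i))"
    by (simp add: gap_count_def sum_distrib_left[symmetric] sum_distrib_right[symmetric] sum_sep_first)
  finally show ?thesis .
qed

lemma gap_count_le: "gap_count n \<le> sparsity ^ n * u (Suc n)"
  using window_count_le[of "{[]}" 0 n 0] by (simp add: window_count_def gap_count_def u_Suc)

lemma gap_count_nonneg: "0 \<le> gap_count n" by (simp add: gap_count_def sum_nonneg)

lemma u_nonneg: "0 \<le> u n" by (simp add: u_def count_nonneg)

lemma u_ge_1: "1 \<le> u n"
proof (induction n)
  case (Suc n)
  have "gap_count 0 * u (n - 0) \<le> (\<Sum>i\<le>n. gap_count i * u (n - i))"
    by (rule member_le_sum[of 0 "{..n}" "\<lambda>i. gap_count i * u (n - i)"])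
       (auto intro!: mult_nonneg_nonneg gap_count_nonneg u_nonneg)
  moreover have "gap_count 0 = 1" by (simp add: gap_count_def Nil)
  ultimately show ?case using Suc by (simp add: u_renewal)
qed (simp add: u_0)

lemma u_le_power: "u n \<le> (real (card S) + 1) ^ n"
proof (cases n)
  case (Suc m)
  have "count m \<le> (\<Sum>w\<in>words S m. 1)" unfolding count_def by (intro sum_mono) auto
  also have "\<dots> = real (card S) ^ m" by (simp add: card_words finite_S)
  also have "\<dots> \<le> (real (card S) + 1) ^ m" by (intro power_mono) auto
  also have "\<dots> \<le> (real (card S) + 1) ^ n" by (intro power_increasing) (auto simp: Suc)
  finally show ?thesis by (simp add: Suc u_Suc)
qed (simp add: u_0)

text \<open>The exponential growth rate, taken as a supremum of roots for two reasons:
  \<open>u n \<le> growth ^ n\<close> then holds for every \<open>n\<close>, and the normalised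
  sequence cannot decay exponentially, which is the hypothesis \<open>rate\<close> of
  \<open>renewal_limit\<close>.\<close>

definition growth :: real where "growth = (SUP n\<in>{1..}. root n (u n))"

lemma bdd_above_roots: "bdd_above ((\<lambda>n. root n (u n)) ` {1..})"
proof (rule bdd_aboveI2)
  fix n :: nat assume "n \<in> {1..}"
  then have "root n (u n) \<le> root n ((real (card S) + 1) ^ n)"
    by (intro real_root_le_mono u_le_power) auto
  then show "root n (u n) \<le> real (card S) + 1"
    using \<open>n \<in> {1..}\<close> by (simp add: real_root_power_cancel)
qed

lemma u_le_growth: "u n \<le> growth ^ n"
proof (cases "n = 0")
  case False
  then have "root n (u n) \<le> growth"
    unfolding growth_def by (intro cSUP_upper bdd_above_roots) auto
  then have "root n (u n) ^ n \<le> growth ^ n"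
    using u_nonneg by (intro power_mono real_root_ge_zero) auto
  then show ?thesis using False u_nonneg by (simp add: real_root_pow_pos2)
qed (simp add: u_0)

lemma growth_ge_1: "1 \<le> growth"
  using u_le_growth[of 1] u_ge_1[of 1] by simp

definition v :: "nat \<Rightarrow> real" where "v n = u n / growth ^ n"

lemma v_bounds: "0 \<le> v n" "v n \<le> 1"
  using u_nonneg u_le_growth growth_ge_1 by (auto simp: v_def divide_le_eq)

text \<open>The weight of the distance between consecutive separators; the shift by one counts the
  separator that closes the gap. That these weights form a probability law is a result of
  \<open>renewal_limit\<close>.\<close>

definition gap_weight :: "nat \<Rightarrow> real" where
  "gap_weight j = (if j = 0 then 0 else gap_count (j - 1) / growth ^ j)"

lemma renewal_sum_Suc: "(\<Sum>j\<le>Suc n. gap_weight j * x (Suc n - j)) = (\<Sum>i\<le>n. gap_count i / growth ^ Suc i * x (n - i))"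
  by (subst sum.atMost_Suc_shift) (simp add: gap_weight_def)

lemma v_renewal: "0 < n \<Longrightarrow> v n = (\<Sum>j\<le>n. gap_weight j * v (n - j))"
proof (cases n)
  case (Suc m)
  have "growth ^ m = growth ^ i * growth ^ (m - i)" if "i \<le> m" for i
    using that by (simp add: power_add[symmetric])
  then have "(\<Sum>i\<le>m. gap_count i / growth ^ Suc i * v (m - i)) = (\<Sum>i\<le>m. gap_count i * u (m - i)) / growth ^ Suc m"
    unfolding sum_divide_distrib using growth_ge_1 by (intro sum.cong refl) (auto simp: v_def)
  then show ?thesis
    unfolding Suc renewal_sum_Suc by (simp add: v_def u_renewal)
qed simp

lemma gap_weight_nonneg: "0 \<le> gap_weight j"
  using gap_count_nonneg growth_ge_1 by (simp add: gap_weight_def)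

text \<open>By \<open>gap_count_le\<close> a gap of length \<open>i\<close> has weight at most
  \<open>sparsity ^ i\<close>, and the empty gap makes \<open>gap_weight 1\<close> positive; so
  \<open>renewal_limit\<close> applies.\<close>

lemma v_tendsto:
  obtains c where "0 < c" "v \<longlonglongrightarrow> c"
proof (rule renewal_limit[OF sparsity gap_weight_nonneg])
  \<comment> \<open>The constant \<open>1 / sparsity\<close> makes up for the index shift in
    \<open>gap_weight\<close>.\<close>
  show "gap_weight j \<le> (1 / sparsity) * sparsity ^ j" for j
  proof (cases j)
    case (Suc i)
    have "gap_count i \<le> sparsity ^ i * growth ^ Suc i"
      using order_trans[OF gap_count_le mult_left_mono[OF u_le_growth]] sparsity by simp
    then show ?thesis
      using growth_ge_1 sparsity by (simp add: Suc gap_weight_def divide_le_eq)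
  qed (use sparsity in \<open>simp add: gap_weight_def\<close>)
  show "gap_weight 0 = 0" by (simp add: gap_weight_def)
  show "0 < gap_weight 1" using growth_ge_1 by (simp add: gap_weight_def gap_count_def Nil)
  show "v 0 = 1" by (simp add: v_def u_0)
  show "\<exists>n. t ^ n < v n" if t: "0 < t" "t < 1" for t
  proof -
    have "t * growth < growth" using t growth_ge_1 by simp
    then obtain n where n: "1 \<le> n" "t * growth < root n (u n)"
      unfolding growth_def using less_cSUP_iff[OF _ bdd_above_roots] by fastforce
    have "(t * growth) ^ n < root n (u n) ^ n"
      using n t growth_ge_1 by (intro power_strict_mono) auto
    then have "t ^ n * growth ^ n < u n"
      using n u_nonneg by (simp add: power_mult_distrib real_root_pow_pos2)
    then show ?thesis using growth_ge_1 by (auto simp: v_def less_divide_eq)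
  qed
qed (use v_renewal v_bounds that in auto)

end

section \<open>Windows at a prescribed place in a long word\<close>

lemma sum_window_split:
  fixes F :: "'c list \<Rightarrow> 'c list \<Rightarrow> 'c list \<Rightarrow> 'b::comm_monoid_add"
  assumes "finite S" "e \<in> S"
  shows "(\<Sum>y\<in>words S a. \<Sum>x\<in>A. \<Sum>z\<in>words S b. F y x z) =
    (\<Sum>i\<le>a. \<Sum>j\<le>b. \<Sum>y\<in>sep_last S e (a - i). \<Sum>p\<in>words (S - {e}) i. \<Sum>x\<in>A.
      \<Sum>q\<in>words (S - {e}) j. \<Sum>z\<in>sep_first S e (b - j). F (y @ p) x (q @ z))"
proof -
  have "(\<Sum>y\<in>words S a. \<Sum>x\<in>A. \<Sum>z\<in>words S b. F y x z) =
    (\<Sum>y\<in>words S a. \<Sum>x\<in>A. \<Sum>j\<le>b. \<Sum>q\<in>words (S - {e}) j. \<Sum>z\<in>sep_first S e (b - j). F y x (q @ z))"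
    by (rule sum.cong[OF refl], rule sum.cong[OF refl], rule sum_words_split_first[OF assms])
  also have "\<dots> = (\<Sum>y\<in>words S a. \<Sum>j\<le>b. \<Sum>x\<in>A. \<Sum>q\<in>words (S - {e}) j. \<Sum>z\<in>sep_first S e (b - j). F y x (q @ z))"
    by (rule sum.cong[OF refl], rule sum.swap)
  also have "\<dots> = (\<Sum>j\<le>b. \<Sum>y\<in>words S a. \<Sum>x\<in>A. \<Sum>q\<in>words (S - {e}) j. \<Sum>z\<in>sep_first S e (b - j). F y x (q @ z))"
    by (rule sum.swap)
  also have "\<dots> = (\<Sum>j\<le>b. \<Sum>i\<le>a. \<Sum>y\<in>sep_last S e (a - i). \<Sum>p\<in>words (S - {e}) i. \<Sum>x\<in>A.
      \<Sum>q\<in>words (S - {e}) j. \<Sum>z\<in>sep_first S e (b - j). F (y @ p) x (q @ z))"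
    by (rule sum.cong[OF refl], rule sum_words_split_last[OF assms])
  also have "\<dots> = (\<Sum>i\<le>a. \<Sum>j\<le>b. \<Sum>y\<in>sep_last S e (a - i). \<Sum>p\<in>words (S - {e}) i. \<Sum>x\<in>A.
      \<Sum>q\<in>words (S - {e}) j. \<Sum>z\<in>sep_first S e (b - j). F (y @ p) x (q @ z))"
    by (rule sum.swap)
  finally show ?thesis .
qed

lemma sum_window_product:
  fixes \<alpha> \<beta> :: "'c list \<Rightarrow> real"
  shows "(\<Sum>y\<in>Y. \<Sum>p\<in>U. \<Sum>x\<in>A. \<Sum>q\<in>V. \<Sum>z\<in>Z. \<alpha> y * h p x q * \<beta> z) =
    (\<Sum>y\<in>Y. \<alpha> y) * (\<Sum>p\<in>U. \<Sum>x\<in>A. \<Sum>q\<in>V. h p x q) * (\<Sum>z\<in>Z. \<beta> z)"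
  by (simp only: sum_distrib_left[symmetric] sum_distrib_right[symmetric])

lemma power_window_split:
  fixes g :: real
  assumes "i \<le> a" "j \<le> b"
  shows "g ^ (a + d + b + 1) = g ^ (a - i) * g ^ (i + j + d + 1) * g ^ (b - j)"
proof -
  have "a + d + b + 1 = (a - i) + (i + j + d + 1) + (b - j)" using assms by simp
  then show ?thesis by (metis power_add)
qed

context separated_words
begin

definition window_total :: "'c list set \<Rightarrow> nat \<Rightarrow> nat \<Rightarrow> real" where
  "window_total A a b = (\<Sum>y\<in>words S a. \<Sum>x\<in>A. \<Sum>z\<in>words S b. of_bool (P (y @ x @ z)))"

end

context renewal_words
begin

definition v_lim :: real where "v_lim = lim v"

lemma v_lim: "v \<longlonglongrightarrow> v_lim" "0 < v_lim"
proof -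
  obtain c where c: "0 < c" "v \<longlonglongrightarrow> c" by (rule v_tendsto)
  then have "v_lim = c" unfolding v_lim_def by (intro limI)
  with c show "v \<longlonglongrightarrow> v_lim" "0 < v_lim" by auto
qed

text \<open>The exponent is the number of letters in the window and its two stretches, plus one for
  the boundary separator, so that \<open>power_window_split\<close> distributes the powers of
  \<open>growth\<close> exactly.\<close>

definition window_weight :: "nat \<Rightarrow> 'c list set \<Rightarrow> nat \<times> nat \<Rightarrow> real" where
  "window_weight d A = (\<lambda>(i, j). window_count A (i, j) / growth ^ (i + j + d + 1))"

lemma window_weight_nonneg: "0 \<le> window_weight d A k"
  using window_count_nonneg growth_ge_1 by (auto simp: window_weight_def split: prod.split)

lemma window_weight_summable:
  assumes "A \<subseteq> words S d"
  shows "window_weight d A summable_on UNIV"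
proof (rule summable_on_comparison_test)
  show "(\<lambda>(i, j). sparsity ^ i * sparsity ^ j) summable_on UNIV"
    using sparsity by (intro summable_on_product_nat summable_on_nat_iff_nonneg summable_geometric) auto
  fix k :: "nat \<times> nat"
  obtain i j where k: "k = (i, j)" by (cases k)
  have "count (i + d + j) \<le> growth ^ (i + j + d + 1)"
    using u_le_growth[of "Suc (i + d + j)"] by (simp add: u_Suc ac_simps)
  then have "sparsity ^ (i + j) * count (i + d + j) \<le> sparsity ^ (i + j) * growth ^ (i + j + d + 1)"
    using sparsity by (intro mult_left_mono) auto
  with window_count_le[OF assms, of i j]
  have "window_count A (i, j) \<le> sparsity ^ (i + j) * growth ^ (i + j + d + 1)" by linarith
  then show "window_weight d A k \<le> (case k of (i, j) \<Rightarrow> sparsity ^ i * sparsity ^ j)"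
    using growth_ge_1 by (simp add: k window_weight_def divide_le_eq power_add)
qed (rule window_weight_nonneg)

text \<open>The parts to the left and to the right contribute a factor \<open>v_lim\<close> each,
  and the normalising total count cancels one of them.\<close>

definition window_prob :: "nat \<Rightarrow> 'c list set \<Rightarrow> real" where
  "window_prob d A = v_lim * infsum (window_weight d A) UNIV"

text \<open>Cut at the nearest separators on both sides of the window: the three pieces satisfy
  \<open>P\<close> independently, and the outer two are counted by \<open>u\<close>.\<close>

lemma window_total_eq:
  assumes A: "A \<subseteq> words S d"
  shows "window_total A a b / growth ^ (a + d + b + 1) =
    (\<Sum>i\<le>a. \<Sum>j\<le>b. v (a - i) * window_weight d A (i, j) * v (b - j))"
proof -
  have *: "of_bool (P (y @ (p @ x @ q) @ z)) = of_bool (P y) * of_bool (P (p @ x @ q)) * (of_bool (P z) :: real)"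
    if "y \<in> sep_last S e n" "z \<in> sep_first S e m" "p \<in> words (S - {e}) i" "x \<in> A" "q \<in> words (S - {e}) j"
    for y p x q z n m i j
  proof -
    have "set (p @ x @ q) \<subseteq> S" "set z \<subseteq> S"
      using that A e_in_S by (auto simp: words_def sep_first_def split: if_splits)
    then show ?thesis using that split_last[of "(p @ x @ q) @ z" y n] split_first[of "p @ x @ q" z m] by simp
  qed
  have "window_total A a b = (\<Sum>i\<le>a. \<Sum>j\<le>b. \<Sum>y\<in>sep_last S e (a - i). \<Sum>p\<in>words (S - {e}) i. \<Sum>x\<in>A.
      \<Sum>q\<in>words (S - {e}) j. \<Sum>z\<in>sep_first S e (b - j). of_bool (P (y @ (p @ x @ q) @ z)))"
    unfolding window_total_def by (subst sum_window_split[OF finite_S e_in_S]) simp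
  also have "\<dots> = (\<Sum>i\<le>a. \<Sum>j\<le>b. \<Sum>y\<in>sep_last S e (a - i). \<Sum>p\<in>words (S - {e}) i. \<Sum>x\<in>A.
      \<Sum>q\<in>words (S - {e}) j. \<Sum>z\<in>sep_first S e (b - j). of_bool (P y) * of_bool (P (p @ x @ q)) * of_bool (P z))"
    by (intro sum.cong refl *)
  also have "\<dots> = (\<Sum>i\<le>a. \<Sum>j\<le>b. u (a - i) * window_count A (i, j) * u (b - j))"
    by (simp only: sum_window_product sum_sep_last sum_sep_first window_count_def prod.case)
  finally have "window_total A a b / growth ^ (a + d + b + 1) =
      (\<Sum>i\<le>a. \<Sum>j\<le>b. u (a - i) * window_count A (i, j) * u (b - j) / growth ^ (a + d + b + 1))"
    by (simp only: sum_divide_distrib)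
  also have "\<dots> = (\<Sum>i\<le>a. \<Sum>j\<le>b. v (a - i) * window_weight d A (i, j) * v (b - j))"
  proof (intro sum.cong refl)
    fix i j assume "i \<in> {..a}" "j \<in> {..b}"
    then have eq: "growth ^ (a + d + b + 1) = growth ^ (a - i) * growth ^ (i + j + d + 1) * growth ^ (b - j)"
      by (intro power_window_split) auto
    show "u (a - i) * window_count A (i, j) * u (b - j) / growth ^ (a + d + b + 1)
        = v (a - i) * window_weight d A (i, j) * v (b - j)"
      unfolding eq by (simp add: v_def window_weight_def)
  qed
  finally show ?thesis .
qed

text \<open>For fixed \<open>i\<close> and \<open>j\<close> the outer factors tend to
  \<open>v_lim\<close>, and the summable \<open>window_weight\<close> dominates. The filter is
  arbitrary because the two ends of the segment may recede independently.\<close>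

theorem window_prob_limit:
  assumes A: "A \<subseteq> words S d" and a: "filterlim a at_top F" and b: "filterlim b at_top F"
  shows "((\<lambda>t. window_total A (a t) (b t) / count (a t + d + b t)) \<longlongrightarrow> window_prob d A) F"
proof -
  have ai: "((\<lambda>t. v (a t - i)) \<longlongrightarrow> v_lim) F" "((\<lambda>t. v (b t - i)) \<longlongrightarrow> v_lim) F" for i
    by (intro filterlim_compose[OF v_lim(1)] filterlim_compose[OF filterlim_minus_const_nat_at_top] a b)+
  have bd: "\<bar>v i * v j\<bar> \<le> 1" for i j
    using v_bounds by (auto simp: abs_mult mult_le_one)
  have "((\<lambda>t. \<Sum>i\<le>a t. \<Sum>j\<le>b t. v (a t - i) * window_weight d A (i, j) * v (b t - j))
      \<longlongrightarrow> v_lim * v_lim * infsum (window_weight d A) UNIV) F"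
    by (rule window_sum_tendsto[OF a b window_weight_nonneg window_weight_summable[OF A], where B = 1])
       (intro always_eventually allI impI bd tendsto_mult ai)+
  then have 1: "((\<lambda>t. window_total A (a t) (b t) / growth ^ (a t + d + b t + 1))
      \<longlongrightarrow> v_lim * window_prob d A) F"
    unfolding window_total_eq[OF A] window_prob_def by (simp only: mult.assoc)
  have "filterlim (\<lambda>t. a t + d + b t + 1) at_top F"
    by (rule filterlim_at_top_mono[OF a]) (auto intro!: always_eventually)
  then have 2: "((\<lambda>t. v (a t + d + b t + 1)) \<longlongrightarrow> v_lim) F"
    by (rule filterlim_compose[OF v_lim(1)])
  have 3: "((\<lambda>t. (window_total A (a t) (b t) / growth ^ (a t + d + b t + 1)) / v (a t + d + b t + 1))
      \<longlongrightarrow> v_lim * window_prob d A / v_lim) F"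
    using v_lim by (intro tendsto_divide 1 2) auto
  have 4: "window_total A x y / growth ^ (x + d + y + 1) / v (x + d + y + 1)
      = window_total A x y / count (x + d + y)" for x y
    using growth_ge_1 by (simp add: v_def u_Suc)
  have 5: "v_lim * window_prob d A / v_lim = window_prob d A" using v_lim by simp
  show ?thesis using 3 by (simp only: 4 5)
qed

end

section \<open>Recurrent words: a single defect and its position\<close>

text \<open>\<open>L\<close>, \<open>R\<close> and \<open>C\<close> abstract left-burnable,
  right-burnable and recurrent words. \<open>C_split\<close> says that at a full column at least one
  of the two sides must burn by the fire from its own end. \<open>count_eq\<close> gives both sides
  of the defect the same growth, and \<open>defect_exists\<close> makes the total mass of defects
  positive.\<close>

locale two_sided_words = L: renewal_words S e L + R: renewal_words S e R + C: separated_words S e C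
  for S :: "'c set" and e L R C +
  assumes L_imp_C: "\<And>w. set w \<subseteq> S \<Longrightarrow> L w \<Longrightarrow> C w"
    and R_imp_C: "\<And>w. set w \<subseteq> S \<Longrightarrow> R w \<Longrightarrow> C w"
    and C_split: "\<And>x y. set x \<subseteq> S \<Longrightarrow> set y \<subseteq> S \<Longrightarrow> C (x @ e # y) \<longleftrightarrow> C x \<and> C y \<and> (L x \<or> R y)"
    and count_eq: "\<And>n. L.count n = R.count n"
    and defect_exists: "\<exists>w. set w \<subseteq> S - {e} \<and> C w \<and> \<not> L w"
begin

lemma C_Nil: "C []" using L_imp_C[of "[]"] L.Nil by simp

lemma u_eq: "R.u = L.u"
  by (rule ext) (simp add: L.u_def R.u_def count_eq)

lemma growth_eq: "R.growth = L.growth"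
  by (simp add: L.growth_def R.growth_def u_eq)

lemma v_eq: "R.v = L.v"
  by (rule ext) (simp add: L.v_def R.v_def u_eq growth_eq)

lemma v_lim_eq: "R.v_lim = L.v_lim"
  by (simp add: L.v_lim_def R.v_lim_def v_eq)

definition total :: "nat \<Rightarrow> real" where "total n = (if n = 0 then 1 else C.count (n - 1))"

text \<open>The exceptional block: the leftmost stretch between separators that does not burn from
  the left. By \<open>C_split\<close> everything after it burns from the right.\<close>

definition defect :: "nat \<Rightarrow> real" where
  "defect n = (\<Sum>w\<in>words (S - {e}) n. of_bool (C w \<and> \<not> L w))"

lemma total_Suc: "total (Suc n) = C.count n" and total_0: "total 0 = 1" by (simp_all add: total_def)

lemma total_nonneg: "0 \<le> total n" by (simp add: total_def C.count_nonneg)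

lemma sum_sep_first: "(\<Sum>z\<in>sep_first S e n. of_bool (C z)) = total n"
proof (cases n)
  case (Suc m)
  have "C (e # w) = C w" if "w \<in> words S m" for w
    using C_split[of "[]" w] C_Nil L.Nil that by (auto simp: words_def)
  then show ?thesis by (simp add: Suc sum_sep_first_Suc total_Suc C.count_def)
qed (simp add: sep_first_def total_0 C_Nil)

lemma sum_sep_last: "(\<Sum>z\<in>sep_last S e n. of_bool (C z)) = total n"
proof (cases n)
  case (Suc m)
  have "C (rev w @ [e]) = C (rev w)" if "w \<in> words S m" for w
    using C_split[of "rev w" "[]"] C_Nil R.Nil that by (auto simp: words_def)
  then have "(\<Sum>z\<in>sep_last S e n. of_bool (C z)) = (\<Sum>w\<in>words S m. of_bool (C (rev w)))"
    by (simp add: Suc Submission.sum_sep_last sum_sep_first_Suc)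
  then show ?thesis by (simp add: Suc total_Suc C.count_def sum_words_rev[of "\<lambda>w. of_bool (C w)"])
qed (simp add: sep_last_def sep_first_def total_0 C_Nil)

lemma C_split_first:
  assumes "set p \<subseteq> S" "z \<in> sep_first S e n"
  shows "C (p @ z) \<longleftrightarrow> C p \<and> C z \<and> (L p \<or> R z)"
proof (cases n)
  case (Suc m)
  then obtain w where "z = e # w" "w \<in> words S m" using assms by (auto simp: sep_first_def)
  then show ?thesis using assms C_split[of p w] C_split[of "[]" w] L.Nil C_Nil R.split[of "[]" w] R.Nil
    by (auto simp: words_def)
qed (use assms C_Nil R.Nil in \<open>auto simp: sep_first_def\<close>)

lemma C_split_last:
  assumes "set p \<subseteq> S" "z \<in> sep_last S e n"
  shows "C (z @ p) \<longleftrightarrow> C z \<and> C p \<and> (L z \<or> R p)"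
proof (cases n)
  case (Suc m)
  then obtain w where "z = rev w @ [e]" "w \<in> words S m" using assms by (auto simp: sep_last_def sep_first_def)
  then show ?thesis using assms C_split[of "rev w" p] C_split[of "rev w" "[]"] R.Nil C_Nil L.split[of "rev w" "[]"] L.Nil
    by (auto simp: words_def)
qed (use assms C_Nil L.Nil in \<open>auto simp: sep_last_def sep_first_def\<close>)

text \<open>Consider the stretch before the first \<open>e\<close>. If it burns from the left, any
  recurrent word may follow; if it is a defect, the remainder must burn from the right, and
  \<open>u_eq\<close> counts such remainders by \<open>L.u\<close>.\<close>

lemma total_renewal: "total (Suc n) = (\<Sum>i\<le>n. L.gap_count i * total (n - i)) + (\<Sum>i\<le>n. defect i * L.u (n - i))"
proof -
  have "total (Suc n) = (\<Sum>i\<le>n. \<Sum>p\<in>words (S - {e}) i. \<Sum>z\<in>sep_first S e (n - i). of_bool (C (p @ z)))"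
    unfolding total_Suc C.count_def by (rule sum_words_split_first[OF L.finite_S L.e_in_S])
  also have "\<dots> = (\<Sum>i\<le>n. \<Sum>p\<in>words (S - {e}) i. \<Sum>z\<in>sep_first S e (n - i).
      of_bool (L p) * of_bool (C z) + of_bool (C p \<and> \<not> L p) * of_bool (R z))"
  proof (intro sum.cong refl)
    fix i p z assume *: "p \<in> words (S - {e}) i" "z \<in> sep_first S e (n - i)"
    then have "set p \<subseteq> S" "set z \<subseteq> S" using L.e_in_S by (auto simp: words_def sep_first_def split: if_splits)
    then show "of_bool (C (p @ z)) = of_bool (L p) * of_bool (C z) + of_bool (C p \<and> \<not> L p) * (of_bool (R z) :: real)"
      using C_split_first[of p z] * L_imp_C[of p] R_imp_C[of z] by auto
  qed
  also have "\<dots> = (\<Sum>i\<le>n. L.gap_count i * total (n - i)) + (\<Sum>i\<le>n. defect i * L.u (n - i))"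
    by (simp add: L.gap_count_def defect_def sum.distrib sum_distrib_left[symmetric] sum_distrib_right[symmetric]
        sum_sep_first R.sum_sep_first u_eq)
  finally show ?thesis .
qed

definition total_weight :: "nat \<Rightarrow> real" where "total_weight n = total n / L.growth ^ n"

definition defect_weight :: "nat \<Rightarrow> real" where
  "defect_weight j = (if j = 0 then 0 else defect (j - 1) / L.growth ^ j)"

text \<open>Convolved with \<open>L.v\<close>, the unit mass at 0 yields the words without a defect,
  and the sum yields those with one: left-burnable part, defect, right-burnable part.\<close>

definition forcing :: "nat \<Rightarrow> real" where
  "forcing n = of_bool (n = 0) + (\<Sum>j\<le>n. defect_weight j * L.v (n - j))"

lemma total_weight_nonneg: "0 \<le> total_weight n" using total_nonneg L.growth_ge_1 by (simp add: total_weight_def)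

lemma defect_nonneg: "0 \<le> defect n" by (simp add: defect_def sum_nonneg)

lemma defect_weight_nonneg: "0 \<le> defect_weight n"
  using defect_nonneg L.growth_ge_1 by (simp add: defect_weight_def)

lemma total_weight_forced: "total_weight n = (\<Sum>j\<le>n. L.gap_weight j * total_weight (n - j)) + forcing n"
proof (cases n)
  case 0
  then show ?thesis by (simp add: total_weight_def total_0 forcing_def L.gap_weight_def defect_weight_def)
next
  case (Suc m)
  have g: "L.growth ^ m = L.growth ^ i * L.growth ^ (m - i)" if "i \<le> m" for i
    using that by (simp add: power_add[symmetric])
  have "(\<Sum>i\<le>m. L.gap_count i / L.growth ^ Suc i * total_weight (m - i)) = (\<Sum>i\<le>m. L.gap_count i * total (m - i)) / L.growth ^ Suc m"
    unfolding sum_divide_distrib using L.growth_ge_1 by (intro sum.cong refl) (auto simp: total_weight_def g)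
  moreover have "(\<Sum>j\<le>Suc m. defect_weight j * L.v (Suc m - j)) = (\<Sum>i\<le>m. defect i / L.growth ^ Suc i * L.v (m - i))"
    by (subst sum.atMost_Suc_shift) (simp add: defect_weight_def)
  moreover have "\<dots> = (\<Sum>i\<le>m. defect i * L.u (m - i)) / L.growth ^ Suc m"
    unfolding sum_divide_distrib using L.growth_ge_1 by (intro sum.cong refl) (auto simp: L.v_def g)
  ultimately show ?thesis
    unfolding Suc L.renewal_sum_Suc forcing_def by (simp add: total_weight_def total_renewal add_divide_distrib)
qed

lemma total_weight_eq: "total_weight n = (\<Sum>j\<le>n. L.v j * forcing (n - j))"
proof (rule renewal_equation_solution[where p = L.gap_weight])
  show "L.gap_weight 0 = 0" by (simp add: L.gap_weight_def)
  show "L.v 0 = 1" by (simp add: L.v_def L.u_0)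
qed (fact L.v_renewal, fact total_weight_forced)

text \<open>Partial sums, since summability is still open. \<open>total_weight n\<close> is at most
  \<open>n + 1\<close> times this sum, while \<open>defect_weight\<close> is exponentially small
  relative to \<open>total_weight\<close>; comparing the two bounds gives the summability. The 1
  stands for the words without a defect.\<close>

definition defect_sum :: "nat \<Rightarrow> real" where "defect_sum n = 1 + (\<Sum>j\<le>n. defect_weight j)"

lemma defect_sum_mono: "m \<le> n \<Longrightarrow> defect_sum m \<le> defect_sum n"
  unfolding defect_sum_def by (intro add_left_mono sum_mono2) (auto intro: defect_weight_nonneg)

lemma defect_sum_nonneg: "0 \<le> defect_sum n" by (simp add: defect_sum_def sum_nonneg defect_weight_nonneg)

lemma total_weight_le: "total_weight n \<le> (n + 1) * defect_sum n"
proof -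
  have f0: "0 \<le> forcing k" for k
    unfolding forcing_def by (intro add_nonneg_nonneg sum_nonneg mult_nonneg_nonneg defect_weight_nonneg L.v_bounds) auto
  have fD: "forcing k \<le> defect_sum k" for k
    unfolding forcing_def defect_sum_def
    by (intro add_mono sum_mono mult_left_le defect_weight_nonneg L.v_bounds) auto
  have f: "L.v j * forcing (n - j) \<le> defect_sum n" for j
  proof -
    have "L.v j * forcing (n - j) \<le> forcing (n - j)"
      by (intro mult_left_le_one_le f0 L.v_bounds)
    also have "\<dots> \<le> defect_sum (n - j)" by (rule fD)
    also have "\<dots> \<le> defect_sum n" by (rule defect_sum_mono) simp
    finally show ?thesis .
  qed
  have "total_weight n \<le> (\<Sum>j\<le>n. defect_sum n)" unfolding total_weight_eq by (rule sum_mono) (rule f)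
  then show ?thesis by (simp add: add.commute)
qed

lemma defect_le: "defect n \<le> L.sparsity ^ n * total (Suc n)"
proof -
  have "defect n \<le> C.window_count {[]} (0, n)"
    unfolding defect_def C.window_count_def by (simp, intro sum_mono) auto
  also have "\<dots> \<le> C.sparsity ^ n * C.count n"
    using C.window_count_le[of "{[]}" 0 0 n] by simp
  finally show ?thesis by (simp add: total_Suc C.sparsity_def L.sparsity_def)
qed

lemma defect_weight_le: "defect_weight (Suc n) \<le> (L.sparsity ^ n * (n + 2)) * defect_sum (Suc n)"
proof -
  have "defect_weight (Suc n) \<le> L.sparsity ^ n * total_weight (Suc n)"
    using defect_le[of n] L.growth_ge_1 by (simp add: defect_weight_def total_weight_def divide_right_mono)
  also have "\<dots> \<le> L.sparsity ^ n * ((n + 2) * defect_sum (Suc n))"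
    using total_weight_le[of "Suc n"] L.sparsity by (intro mult_left_mono) (auto simp: ac_simps)
  finally show ?thesis by (simp add: mult.assoc)
qed

text \<open>By \<open>defect_weight_le\<close> the sum from \<open>N\<close> on is at most the tail
  of the summable sequence \<open>g\<close> times \<open>defect_sum n\<close>. With \<open>N\<close>
  chosen so that this tail is below 1/2, the right-hand side is absorbed into the left.\<close>

lemma defect_sum_bounded: "\<exists>B. \<forall>n. defect_sum n \<le> B"
proof -
  define g where "g n = L.sparsity ^ n * real (n + 2)" for n
  have "summable (\<lambda>n. real (Suc n) * L.sparsity ^ n)" "summable (\<lambda>n. L.sparsity ^ n)"
    using geometric_deriv_sums[of L.sparsity] L.sparsity by (auto simp: sums_iff intro!: summable_geometric)
  from summable_add[OF this] have g: "summable g"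
    by (simp add: g_def[abs_def] algebra_simps)
  have g0: "0 \<le> g n" for n using L.sparsity by (simp add: g_def)
  obtain N where N: "\<forall>n\<ge>N. norm (\<Sum>i. g (i + n)) < 1 / 2"
    using suminf_exist_split[OF _ g, of "1 / 2"] by auto
  have "defect_sum n \<le> 2 * defect_sum N" if "N \<le> n" for n
  proof -
    have "defect_sum n = defect_sum N + (\<Sum>j\<in>{N..<n}. defect_weight (Suc j))"
    proof -
      have "{..n} = {..N} \<union> {Suc N..<Suc n}" using that by auto
      then show ?thesis
        by (simp add: defect_sum_def sum.union_disjoint sum.shift_bounds_Suc_ivl del: atMost_Suc)
           (subst sum.union_disjoint, auto simp: sum.shift_bounds_Suc_ivl[symmetric] simp del: sum.op_ivl_Suc)
    qed
    also have "(\<Sum>j\<in>{N..<n}. defect_weight (Suc j)) \<le> (\<Sum>j\<in>{N..<n}. g j * defect_sum n)"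
    proof (rule sum_mono)
      fix j assume "j \<in> {N..<n}"
      then show "defect_weight (Suc j) \<le> g j * defect_sum n"
        using order_trans[OF defect_weight_le[of j] mult_left_mono[OF defect_sum_mono[of "Suc j" n] g0[of j, unfolded g_def]]]
        by (simp add: g_def)
    qed
    also have "\<dots> = (\<Sum>j\<in>{N..<n}. g j) * defect_sum n" by (simp add: sum_distrib_right)
    also have "(\<Sum>j\<in>{N..<n}. g j) = (\<Sum>i<n - N. g (i + N))"
      by (rule sum.reindex_bij_witness[of _ "\<lambda>i. i + N" "\<lambda>j. j - N"]) auto
    also have "\<dots> \<le> (\<Sum>i. g (i + N))"
      using g g0 by (intro sum_le_suminf) (auto simp: summable_iff_shift)
    also have "\<dots> \<le> 1 / 2" using N[rule_format, of N] by simp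
    finally have "defect_sum n \<le> defect_sum N + 1 / 2 * defect_sum n" using defect_sum_nonneg[of n] by (simp add: mult_right_mono)
    then show ?thesis by simp
  qed
  then have "defect_sum n \<le> 2 * defect_sum N" for n
    using defect_sum_mono[of n N] defect_sum_nonneg[of N] by (cases "N \<le> n") auto
  then show ?thesis by blast
qed

lemma defect_weight_summable: "summable defect_weight"
proof -
  obtain B where B: "\<And>n. defect_sum n \<le> B" using defect_sum_bounded by blast
  have "(\<Sum>j\<in>X. defect_weight j) \<le> B" if "finite X" for X
  proof -
    have "(\<Sum>j\<in>X. defect_weight j) \<le> (\<Sum>j\<le>Max (insert 0 X). defect_weight j)"
      using that by (intro sum_mono2) (auto simp: defect_weight_nonneg)
    also have "\<dots> \<le> B" using B[of "Max (insert 0 X)"] by (simp add: defect_sum_def)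
    finally show ?thesis .
  qed
  then show ?thesis
    by (intro summableI_nonneg_bounded[of _ B] defect_weight_nonneg) auto
qed

lemma total_weight_linear_bound: "\<exists>B::real. 0 \<le> B \<and> (\<forall>n. total_weight n \<le> B * real (n + 1))"
proof -
  obtain B where B: "\<And>n. defect_sum n \<le> B" using defect_sum_bounded by blast
  have "0 \<le> B" using B[of 0] defect_sum_nonneg[of 0] by linarith
  moreover have "total_weight n \<le> B * real (n + 1)" for n
    using order_trans[OF total_weight_le[of n] mult_left_mono[OF B]] by (simp add: mult.commute add.commute)
  ultimately show ?thesis by (intro exI[of _ B] conjI allI)
qed

text \<open>\<open>forcing\<close> tends to \<open>M * v_lim\<close> with \<open>M\<close> the total
  mass of defects, so the Cesaro convolution gives \<open>\<kappa> = v_lim * (M * v_lim)\<close>. It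
  is positive because some defect exists.\<close>

lemma total_weight_asymp:
  obtains \<kappa> where "0 < \<kappa>" "(\<lambda>n. total_weight n / (n + 1)) \<longlonglongrightarrow> \<kappa>"
proof -
  define M where "M = infsum defect_weight UNIV"
  have sd: "defect_weight summable_on UNIV"
    by (rule summable_on_nat_iff_nonneg[OF defect_weight_summable defect_weight_nonneg])
  have "(\<lambda>n. \<Sum>j\<le>n. defect_weight j * L.v (n - j)) \<longlonglongrightarrow> M * L.v_lim"
    unfolding M_def by (rule convolution_tendsto) (use sd L.v_lim defect_weight_nonneg in simp_all)
  moreover have "(\<lambda>n. of_bool (n = (0::nat))) \<longlonglongrightarrow> (0::real)"
    by (rule tendsto_eventually) (auto simp: eventually_at_top_linorder intro!: exI[of _ 1])
  ultimately have "forcing \<longlonglongrightarrow> 0 + M * L.v_lim"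
    unfolding forcing_def[abs_def] by (intro tendsto_add)
  then have "(\<lambda>n. total_weight n / (n + 1)) \<longlonglongrightarrow> L.v_lim * (0 + M * L.v_lim)"
    unfolding total_weight_eq by (intro convolution_cesaro L.v_lim)
  moreover have "0 < M"
  proof -
    obtain x where x: "set x \<subseteq> S - {e}" "C x" "\<not> L x" using defect_exists by blast
    have "1 \<le> defect (length x)"
      unfolding defect_def using x member_le_sum[of x "words (S - {e}) (length x)" "\<lambda>w. of_bool (C w \<and> \<not> L w) :: real"]
        L.finite_S by (simp add: words_def) (use finite_words[of "S - {e}" "length x"] in \<open>simp add: words_def\<close>)
    then have "0 < defect_weight (Suc (length x))"
      using L.growth_ge_1 by (simp add: defect_weight_def)
    also have "\<dots> \<le> M"
      unfolding M_def using finite_sum_le_infsum[OF sd, of "{Suc (length x)}"] defect_weight_nonneg by simp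
    finally show ?thesis .
  qed
  ultimately show ?thesis using L.v_lim by (intro that[of "L.v_lim * (0 + M * L.v_lim)"]) auto
qed

lemma total_weight_shift_limit:
  assumes \<kappa>: "(\<lambda>n. total_weight n / (n + 1)) \<longlonglongrightarrow> \<kappa>"
    and x: "filterlim x at_top F" and N: "filterlim N at_top F"
    and ratio: "((\<lambda>t. real (x t) / real (N t)) \<longlongrightarrow> r) F"
  shows "((\<lambda>t. total_weight (x t - i) / real (N t)) \<longlongrightarrow> \<kappa> * r) F"
proof -
  have 1: "((\<lambda>t. total_weight (x t - i) / real (x t - i + 1)) \<longlongrightarrow> \<kappa>) F"
    using filterlim_compose[OF \<kappa> filterlim_compose[OF filterlim_minus_const_nat_at_top x]] by simp
  have "((\<lambda>t. (1 - real i) / real (N t)) \<longlongrightarrow> 0) F"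
    by (intro real_tendsto_divide_at_top[OF tendsto_const] filterlim_compose[OF filterlim_real_sequentially N])
  from tendsto_add[OF ratio this]
  have 2: "((\<lambda>t. real (x t) / real (N t) + (1 - real i) / real (N t)) \<longlongrightarrow> r) F" by simp
  have "((\<lambda>t. (total_weight (x t - i) / real (x t - i + 1)) * (real (x t) / real (N t) + (1 - real i) / real (N t))) \<longlongrightarrow> \<kappa> * r) F"
    by (intro tendsto_mult 1 2)
  moreover have "\<forall>\<^sub>F t in F. (total_weight (x t - i) / real (x t - i + 1)) * (real (x t) / real (N t) + (1 - real i) / real (N t))
      = total_weight (x t - i) / real (N t)"
    using x[unfolded filterlim_at_top, rule_format, of i]
  proof eventually_elim
    case (elim t)
    have "real (x t) / real (N t) + (1 - real i) / real (N t) = real (x t - i + 1) / real (N t)"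
      using elim by (simp add: add_divide_distrib[symmetric] of_nat_diff)
    then show ?case by simp
  qed
  ultimately show ?thesis by (rule Lim_transform_eventually)
qed

text \<open>The case in which the exceptional block lies between the two separators nearest to the
  window. It is only required to be summable: its contribution stays bounded while the total grows
  linearly.\<close>

definition defect_window :: "nat \<Rightarrow> 'c list set \<Rightarrow> nat \<times> nat \<Rightarrow> real" where
  "defect_window d A = (\<lambda>(i, j). (\<Sum>p\<in>words (S - {e}) i. \<Sum>x\<in>A. \<Sum>q\<in>words (S - {e}) j.
     of_bool (C (p @ x @ q) \<and> \<not> L (p @ x @ q))) / L.growth ^ (i + j + d + 1))"

lemma defect_window_nonneg: "0 \<le> defect_window d A k"
  using L.growth_ge_1 by (auto simp: defect_window_def sum_nonneg split: prod.split)

text \<open>Recurrent words exceed the pure exponential by a linear factor only, and the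
  \<open>i + j\<close> letters avoiding \<open>e\<close> cost \<open>sparsity ^ (i + j)\<close>,
  which beats that factor.\<close>

lemma defect_window_summable:
  assumes A: "A \<subseteq> words S d"
  shows "defect_window d A summable_on UNIV"
proof -
  obtain B :: real where B: "0 \<le> B" and "\<forall>n. total_weight n \<le> B * real (n + 1)" using total_weight_linear_bound by (elim exE conjE)
  then have B': "total_weight n \<le> B * real (n + 1)" for n by (elim allE)
  have "summable (\<lambda>n. real (Suc n) * L.sparsity ^ n)"
    using geometric_deriv_sums[of L.sparsity] L.sparsity by (auto simp: sums_iff)
  then have dom: "(\<lambda>k. (B * (d + 2)) * (case k of (i, j) \<Rightarrow> (real (Suc i) * L.sparsity ^ i) * (real (Suc j) * L.sparsity ^ j))) summable_on UNIV"
    using L.sparsity by (intro summable_on_cmult_right summable_on_product_nat summable_on_nat_iff_nonneg) auto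
  show ?thesis
  proof (rule summable_on_comparison_test[OF dom])
    fix k :: "nat \<times> nat"
    obtain i j where k: "k = (i, j)" by (cases k)
    let ?n = "i + j + d + 1"
    have "defect_window d A (i, j) \<le> C.window_count A (i, j) / L.growth ^ ?n"
      unfolding defect_window_def C.window_count_def prod.case using L.growth_ge_1
      by (intro divide_right_mono sum_mono) auto
    also have "\<dots> \<le> (L.sparsity ^ (i + j) * C.count (i + d + j)) / L.growth ^ ?n"
      using C.window_count_le[OF A, of i j] L.growth_ge_1 by (intro divide_right_mono) auto
    also have "\<dots> = L.sparsity ^ (i + j) * total_weight ?n"
      by (simp add: total_weight_def total_def ac_simps)
    also have "\<dots> \<le> L.sparsity ^ (i + j) * (B * (d + 2) * (real (Suc i) * real (Suc j)))"
    proof (rule mult_left_mono)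
      \<comment> \<open>Bounds the linear factor by a product of a function of \<open>i\<close> and
        a function of \<open>j\<close>, so that the majorant factorises.\<close>
      have "real ?n + 1 \<le> (real d + 2) * (real (Suc i) * real (Suc j))"
      proof -
        have "?n + 1 \<le> (d + 2) * (Suc i * Suc j)" by (simp add: algebra_simps)
        then have "real (?n + 1) \<le> real ((d + 2) * (Suc i * Suc j))" by (rule of_nat_mono)
        then show ?thesis by (simp only: of_nat_add of_nat_mult of_nat_1 of_nat_numeral)
      qed
      then have "B * (real ?n + 1) \<le> B * ((real d + 2) * (real (Suc i) * real (Suc j)))"
        using B by (rule mult_left_mono)
      then show "total_weight ?n \<le> B * (d + 2) * (real (Suc i) * real (Suc j))"
        using B'[of ?n] by (simp add: mult.assoc add.commute)
    qed (use L.sparsity in simp)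
    finally show "defect_window d A k \<le> (B * (d + 2)) * (case k of (i, j) \<Rightarrow> (real (Suc i) * L.sparsity ^ i) * (real (Suc j) * L.sparsity ^ j))"
      by (simp add: k power_add ac_simps)
  qed (rule defect_window_nonneg)
qed

text \<open>The three terms correspond to the position of the leftmost block that does not burn from the
  left: to the right of the window, at the window, or to the left of the window.\<close>

lemma window_total_eq:
  assumes A: "A \<subseteq> words S d"
  shows "C.window_total A m n / L.growth ^ (m + d + n + 1) =
    (\<Sum>i\<le>m. \<Sum>j\<le>n. L.v (m - i) * L.window_weight d A (i, j) * total_weight (n - j)) +
    (\<Sum>i\<le>m. \<Sum>j\<le>n. L.v (m - i) * defect_window d A (i, j) * L.v (n - j)) +
    (\<Sum>i\<le>m. \<Sum>j\<le>n. (total_weight (m - i) - L.v (m - i)) * R.window_weight d A (i, j) * L.v (n - j))"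
proof -
  let ?h = "\<lambda>i j. \<Sum>p\<in>words (S - {e}) i. \<Sum>x\<in>A. \<Sum>q\<in>words (S - {e}) j.
     of_bool (C (p @ x @ q) \<and> \<not> L (p @ x @ q)) :: real"
  \<comment> \<open>As \<open>L\<close> implies \<open>C\<close>, the difference
    \<open>of_bool (C y) - of_bool (L y)\<close> indicates that the part before the window does not
    burn from the left; the window and all that follows must then burn from the right.\<close>
  have *: "of_bool (C (y @ (p @ x @ q) @ z)) = of_bool (L y) * of_bool (L (p @ x @ q)) * of_bool (C z)
      + of_bool (L y) * of_bool (C (p @ x @ q) \<and> \<not> L (p @ x @ q)) * of_bool (R z)
      + (of_bool (C y) - of_bool (L y)) * of_bool (R (p @ x @ q)) * (of_bool (R z) :: real)"
    if "y \<in> sep_last S e k" "z \<in> sep_first S e l" "p \<in> words (S - {e}) i" "x \<in> A" "q \<in> words (S - {e}) j"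
    for y p x q z k l i j
  proof -
    let ?m = "p @ x @ q"
    have sub: "set ?m \<subseteq> S" "set z \<subseteq> S" "set y \<subseteq> S"
      using that A L.e_in_S by (auto simp: words_def sep_first_def sep_last_def split: if_splits)
    have iff: "C (y @ ?m @ z) \<longleftrightarrow> C y \<and> (C ?m \<and> C z \<and> (L ?m \<or> R z)) \<and> (L y \<or> R ?m \<and> R z)"
      using sub that C_split_last[of "?m @ z" y k] C_split_first[of ?m z l] R.split_first[of ?m z l] by simp
    have bools: "of_bool c = of_bool ly * of_bool lm * of_bool cz + of_bool ly * of_bool (cm \<and> \<not> lm) * of_bool rz
        + (of_bool cy - of_bool ly) * of_bool rm * (of_bool rz :: real)"
      if "c \<longleftrightarrow> cy \<and> (cm \<and> cz \<and> (lm \<or> rz)) \<and> (ly \<or> rm \<and> rz)"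
        "lm \<longrightarrow> cm" "ly \<longrightarrow> cy" "rm \<longrightarrow> cm" "rz \<longrightarrow> cz" for c cy cm cz ly lm rm rz
      using that by (cases ly; cases lm; cases cm; cases rm; cases rz; cases cz; cases cy; simp)
    show ?thesis
      by (rule bools[OF iff])
         (intro impI, erule L_imp_C[OF sub(1)] L_imp_C[OF sub(3)] R_imp_C[OF sub(1)] R_imp_C[OF sub(2)])+
  qed
  have "C.window_total A m n = (\<Sum>i\<le>m. \<Sum>j\<le>n. \<Sum>y\<in>sep_last S e (m - i). \<Sum>p\<in>words (S - {e}) i. \<Sum>x\<in>A.
      \<Sum>q\<in>words (S - {e}) j. \<Sum>z\<in>sep_first S e (n - j). of_bool (C (y @ (p @ x @ q) @ z)))"
    unfolding C.window_total_def by (subst sum_window_split[OF L.finite_S L.e_in_S]) simp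
  also have "\<dots> = (\<Sum>i\<le>m. \<Sum>j\<le>n. \<Sum>y\<in>sep_last S e (m - i). \<Sum>p\<in>words (S - {e}) i. \<Sum>x\<in>A.
      \<Sum>q\<in>words (S - {e}) j. \<Sum>z\<in>sep_first S e (n - j).
      of_bool (L y) * of_bool (L (p @ x @ q)) * of_bool (C z)
      + of_bool (L y) * of_bool (C (p @ x @ q) \<and> \<not> L (p @ x @ q)) * of_bool (R z)
      + (of_bool (C y) - of_bool (L y)) * of_bool (R (p @ x @ q)) * (of_bool (R z) :: real))"
    by (intro sum.cong refl *)
  also have "\<dots> = (\<Sum>i\<le>m. \<Sum>j\<le>n. L.u (m - i) * L.window_count A (i, j) * total (n - j)
      + L.u (m - i) * ?h i j * L.u (n - j) + (total (m - i) - L.u (m - i)) * R.window_count A (i, j) * L.u (n - j))"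
    by (simp only: sum.distrib sum_window_product sum_subtractf L.sum_sep_last R.sum_sep_first sum_sep_last sum_sep_first
        L.window_count_def R.window_count_def prod.case u_eq)
  finally have "C.window_total A m n / L.growth ^ (m + d + n + 1) =
      (\<Sum>i\<le>m. \<Sum>j\<le>n. (L.u (m - i) * L.window_count A (i, j) * total (n - j)
      + L.u (m - i) * ?h i j * L.u (n - j) + (total (m - i) - L.u (m - i)) * R.window_count A (i, j) * L.u (n - j))
        / L.growth ^ (m + d + n + 1))"
    by (simp only: sum_divide_distrib)
  also have "\<dots> = (\<Sum>i\<le>m. \<Sum>j\<le>n. L.v (m - i) * L.window_weight d A (i, j) * total_weight (n - j)
      + L.v (m - i) * defect_window d A (i, j) * L.v (n - j)
      + (total_weight (m - i) - L.v (m - i)) * R.window_weight d A (i, j) * L.v (n - j))"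
  proof (intro sum.cong refl)
    fix i j assume "i \<in> {..m}" "j \<in> {..n}"
    then have eq: "L.growth ^ (m + d + n + 1) = L.growth ^ (m - i) * L.growth ^ (i + j + d + 1) * L.growth ^ (n - j)"
      by (intro power_window_split) auto
    show "(L.u (m - i) * L.window_count A (i, j) * total (n - j)
      + L.u (m - i) * ?h i j * L.u (n - j) + (total (m - i) - L.u (m - i)) * R.window_count A (i, j) * L.u (n - j))
        / L.growth ^ (m + d + n + 1) = L.v (m - i) * L.window_weight d A (i, j) * total_weight (n - j)
      + L.v (m - i) * defect_window d A (i, j) * L.v (n - j)
      + (total_weight (m - i) - L.v (m - i)) * R.window_weight d A (i, j) * L.v (n - j)"
      unfolding eq
      by (simp add: L.v_def total_weight_def L.window_weight_def R.window_weight_def defect_window_def growth_eq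
          add_divide_distrib diff_divide_distrib left_diff_distrib)
  qed
  finally show ?thesis by (simp only: sum.distrib)
qed

text \<open>Each term of \<open>window_total_eq\<close> is divided by the length. With the defect to
  the right of the window there are about \<open>y t\<close> places for it, which gives
  \<open>\<kappa> * (1 - \<rho>)\<close>; to the left there are about \<open>x t\<close>, which
  gives \<open>\<kappa> * \<rho>\<close>; a defect at the window has vanishing weight. The total
  contributes \<open>\<kappa>\<close>, which cancels.\<close>

theorem window_prob_mixture:
  assumes A: "A \<subseteq> words S d" and x: "filterlim x at_top F" and y: "filterlim y at_top F"
    and ratio: "((\<lambda>t. real (x t) / real (x t + y t + d + 2)) \<longlongrightarrow> \<rho>) F"
      "((\<lambda>t. real (y t) / real (x t + y t + d + 2)) \<longlongrightarrow> 1 - \<rho>) F"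
  shows "((\<lambda>t. C.window_total A (x t) (y t) / C.count (x t + d + y t)) \<longlongrightarrow>
    (1 - \<rho>) * L.window_prob d A + \<rho> * R.window_prob d A) F"
proof -
  obtain \<kappa> where \<kappa>: "0 < \<kappa>" "(\<lambda>n. total_weight n / (n + 1)) \<longlonglongrightarrow> \<kappa>" by (rule total_weight_asymp)
  obtain B :: real where B: "0 \<le> B" and "\<forall>n. total_weight n \<le> B * real (n + 1)" using total_weight_linear_bound by (elim exE conjE)
  then have B': "total_weight n \<le> B * real (n + 1)" for n by (elim allE)
  \<comment> \<open>The offset 2 makes \<open>N t\<close> the exact denominator in the asymptotics
    of \<open>total_weight\<close> at index \<open>x t + d + y t + 1\<close>.\<close>
  define N where "N t = x t + y t + d + 2" for t
  have N: "filterlim N at_top F"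
    by (rule filterlim_at_top_mono[OF x]) (auto simp: N_def intro!: always_eventually)
  have vx: "((\<lambda>t. L.v (x t - i)) \<longlongrightarrow> L.v_lim) F" and vy: "((\<lambda>t. L.v (y t - i)) \<longlongrightarrow> L.v_lim) F" for i
    by (intro filterlim_compose[OF L.v_lim(1)] filterlim_compose[OF filterlim_minus_const_nat_at_top] x y)+
  have wx: "((\<lambda>t. total_weight (x t - i) / real (N t)) \<longlongrightarrow> \<kappa> * \<rho>) F" for i
    by (rule total_weight_shift_limit[OF \<kappa>(2) x N]) (use ratio in \<open>simp add: N_def\<close>)
  have wy: "((\<lambda>t. total_weight (y t - i) / real (N t)) \<longlongrightarrow> \<kappa> * (1 - \<rho>)) F" for i
    by (rule total_weight_shift_limit[OF \<kappa>(2) y N]) (use ratio in \<open>simp add: N_def\<close>)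
  have vN: "((\<lambda>t. f t / real (N t)) \<longlongrightarrow> 0) F" if "(f \<longlongrightarrow> l) F" for f l
    by (intro real_tendsto_divide_at_top[OF that] filterlim_compose[OF filterlim_real_sequentially N])
  have total_weight_bound: "\<bar>total_weight k / real (N t)\<bar> \<le> B" if "k \<le> x t \<or> k \<le> y t" for k t
  proof -
    have "total_weight k \<le> B * (real k + 1)" using B'[of k] by (simp add: add.commute)
    also have "\<dots> \<le> B * real (N t)" using that B by (intro mult_left_mono) (auto simp: N_def)
    finally show ?thesis using total_weight_nonneg[of k] by (simp add: N_def divide_le_eq)
  qed
  have v_bound: "\<bar>L.v k / real (N t)\<bar> \<le> 1" for k t
    using L.v_bounds[of k] by (simp add: N_def divide_le_eq)
  have v1: "\<bar>L.v k\<bar> \<le> 1" for k using L.v_bounds[of k] by simp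
  have T1: "((\<lambda>t. \<Sum>i\<le>x t. \<Sum>j\<le>y t. L.v (x t - i) * L.window_weight d A (i, j) * (total_weight (y t - j) / real (N t)))
      \<longlongrightarrow> (L.v_lim * (\<kappa> * (1 - \<rho>))) * infsum (L.window_weight d A) UNIV) F"
    by (rule window_sum_tendsto[OF x y L.window_weight_nonneg L.window_weight_summable[OF A], where B = "1 * B"])
       (intro always_eventually allI impI, unfold abs_mult,
         (rule mult_mono[OF v1 total_weight_bound]; simp)[], (intro tendsto_mult vx wy)[])
  have T2: "((\<lambda>t. \<Sum>i\<le>x t. \<Sum>j\<le>y t. L.v (x t - i) * defect_window d A (i, j) * (L.v (y t - j) / real (N t)))
      \<longlongrightarrow> (L.v_lim * 0) * infsum (defect_window d A) UNIV) F"
    by (rule window_sum_tendsto[OF x y defect_window_nonneg defect_window_summable[OF A], where B = "1 * 1"])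
       (intro always_eventually allI impI, unfold abs_mult,
         (rule mult_mono[OF v1 v_bound]; simp)[], (intro tendsto_mult vx vN[OF vy])[])
  have T3: "((\<lambda>t. \<Sum>i\<le>x t. \<Sum>j\<le>y t. (total_weight (x t - i) / real (N t) - L.v (x t - i) / real (N t)) * R.window_weight d A (i, j) * L.v (y t - j))
      \<longlongrightarrow> ((\<kappa> * \<rho> - 0) * L.v_lim) * infsum (R.window_weight d A) UNIV) F"
  proof (rule window_sum_tendsto[OF x y R.window_weight_nonneg R.window_weight_summable[OF A], where B = "(B + 1) * 1"])
    show "\<forall>\<^sub>F t in F. \<forall>i\<le>x t. \<forall>j\<le>y t.
        \<bar>(total_weight (x t - i) / real (N t) - L.v (x t - i) / real (N t)) * L.v (y t - j)\<bar> \<le> (B + 1) * 1"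
      unfolding abs_mult
      by (intro always_eventually allI impI mult_mono v1 order_trans[OF abs_triangle_ineq4] add_mono total_weight_bound v_bound)
         (use B in auto)
  qed (intro tendsto_mult tendsto_diff wx vy vN[OF vx])
  have eq: "C.window_total A (x t) (y t) / L.growth ^ (x t + d + y t + 1) / real (N t) =
    (\<Sum>i\<le>x t. \<Sum>j\<le>y t. L.v (x t - i) * L.window_weight d A (i, j) * (total_weight (y t - j) / real (N t))) +
    (\<Sum>i\<le>x t. \<Sum>j\<le>y t. L.v (x t - i) * defect_window d A (i, j) * (L.v (y t - j) / real (N t))) +
    (\<Sum>i\<le>x t. \<Sum>j\<le>y t. (total_weight (x t - i) / real (N t) - L.v (x t - i) / real (N t)) * R.window_weight d A (i, j) * L.v (y t - j))"
    for t
    unfolding window_total_eq[OF A] add_divide_distrib sum_divide_distrib by (simp add: diff_divide_distrib[symmetric])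
  have num: "((\<lambda>t. C.window_total A (x t) (y t) / L.growth ^ (x t + d + y t + 1) / real (N t)) \<longlongrightarrow>
      (L.v_lim * (\<kappa> * (1 - \<rho>))) * infsum (L.window_weight d A) UNIV
      + (L.v_lim * 0) * infsum (defect_window d A) UNIV
      + ((\<kappa> * \<rho> - 0) * L.v_lim) * infsum (R.window_weight d A) UNIV) F"
    unfolding eq by (intro tendsto_add T1 T2 T3)
  have "filterlim (\<lambda>t. x t + d + y t + 1) at_top F"
    by (rule filterlim_at_top_mono[OF x]) (auto intro!: always_eventually)
  from filterlim_compose[OF \<kappa>(2) this]
  have den: "((\<lambda>t. total_weight (x t + d + y t + 1) / real (N t)) \<longlongrightarrow> \<kappa>) F"
    by (simp add: N_def ac_simps)
  have "C.window_total A (x t) (y t) / L.growth ^ (x t + d + y t + 1) / real (N t) / (total_weight (x t + d + y t + 1) / real (N t))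
      = C.window_total A (x t) (y t) / C.count (x t + d + y t)" for t
    using L.growth_ge_1 by (simp add: total_weight_def total_Suc N_def)
  with tendsto_divide[OF num den] \<kappa>(1)
  have "((\<lambda>t. C.window_total A (x t) (y t) / C.count (x t + d + y t)) \<longlongrightarrow>
     ((L.v_lim * (\<kappa> * (1 - \<rho>))) * infsum (L.window_weight d A) UNIV
      + (L.v_lim * 0) * infsum (defect_window d A) UNIV
      + ((\<kappa> * \<rho> - 0) * L.v_lim) * infsum (R.window_weight d A) UNIV) / \<kappa>) F"
    by (simp only:)
  then show ?thesis
    using \<kappa>(1) by (simp add: L.window_prob_def R.window_prob_def v_lim_eq add_divide_distrib ac_simps)
qed

end

section \<open>Burning on the ladder\<close>

locale connected_pair_graph = pair_graph G for G :: "'a pair_pre_digraph" +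
  assumes connected: "Digraph_Component.connected (with_proj G)"
begin

abbreviation V\<^sub>G :: "'a set" where "V\<^sub>G \<equiv> pverts G"

lemma verts_nonempty: "V\<^sub>G \<noteq> {}"
  using connected by (simp add: Digraph_Component.connected_def strongly_connected_def mk_symmetric_def)

lemma arc_sym: "(x, y) \<in> parcs G \<Longrightarrow> (y, x) \<in> parcs G"
  using pair_sym_arcs by (auto simp: symmetric_def sym_def)

lemma arc_verts: "(x, y) \<in> parcs G \<Longrightarrow> x \<in> V\<^sub>G \<and> y \<in> V\<^sub>G"
  using arc_fst_in_verts[of "(x, y)"] arc_snd_in_verts[of "(x, y)"] by auto

lemma arc_irrefl: "(x, x) \<notin> parcs G"
  using pair_no_loops[of "(x, x)"] by auto

text \<open>Connectedness in the form used below: a fire that holds a proper nonempty part of a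
  column has an edge along which to spread within it.\<close>

lemma cut_arc:
  assumes X: "X \<subseteq> V\<^sub>G" "X \<noteq> {}" "X \<noteq> V\<^sub>G"
  obtains x y where "x \<in> X" "y \<in> V\<^sub>G - X" "(x, y) \<in> parcs G"
proof -
  obtain a b where ab: "a \<in> X" "b \<in> V\<^sub>G" "b \<notin> X" using X by blast
  have "a \<rightarrow>\<^sup>*\<^bsub>with_proj (mk_symmetric (with_proj G))\<^esub> b"
    using connected ab X by (auto simp: Digraph_Component.connected_def strongly_connected_def mk_symmetric_def)
  then have "(a, b) \<in> rtrancl_on V\<^sub>G (parcs G)"
    unfolding reachable_def
    by (rule back_subst[of "\<lambda>R. (a, b) \<in> R"])
       (auto simp: mk_symmetric_def dest: arc_sym intro!: arg_cong2[of _ _ _ _ rtrancl_on])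
  then have "b \<in> X \<or> (\<exists>x y. x \<in> X \<and> y \<in> V\<^sub>G - X \<and> (x, y) \<in> parcs G)"
  proof (induction rule: rtrancl_on_induct)
    case base
    then show ?case using ab by simp
  next
    case (step u v)
    then show ?case by blast
  qed
  with ab that show ?thesis by blast
qed

abbreviation adj :: "'a \<times> int \<Rightarrow> 'a \<times> int \<Rightarrow> bool" where
  "adj u v \<equiv> (u, v) \<in> parcs (ladder G)"

lemma adj_iff:
  "adj (x, k) (y, l) \<longleftrightarrow> (x, y) \<in> parcs G \<and> k = l \<or> x \<in> V\<^sub>G \<and> x = y \<and> \<bar>k - l\<bar> = 1"
  by (auto simp: ladder_def)

lemma adj_sym: "adj u v \<Longrightarrow> adj v u"
  by (cases u; cases v) (auto simp: adj_iff dest: arc_sym)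

lemma adj_verts: "adj u v \<Longrightarrow> fst u \<in> V\<^sub>G \<and> fst v \<in> V\<^sub>G"
  by (cases u; cases v) (auto simp: adj_iff dest: arc_verts)

lemma adj_irrefl: "\<not> adj u u"
  by (cases u) (auto simp: adj_iff arc_irrefl)

definition nbrs :: "'a \<times> int \<Rightarrow> ('a \<times> int) set" where
  "nbrs v = {u. adj u v}"

lemma nbrs_eq:
  assumes "x \<in> V\<^sub>G"
  shows "nbrs (x, k) = (\<lambda>y. (y, k)) ` {y. (x, y) \<in> parcs G} \<union> {(x, k - 1), (x, k + 1)}"
  using assms by (auto simp: nbrs_def adj_iff abs_if image_iff dest: arc_sym split: if_splits)

lemma out_degree_eq: "out_degree (with_proj G) x = card {y. (x, y) \<in> parcs G}"
proof -
  have "out_arcs (with_proj G) x = (\<lambda>y. (x, y)) ` {y. (x, y) \<in> parcs G}"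
    by (auto simp: out_arcs_def)
  then show ?thesis by (simp add: out_degree_def card_image inj_on_def)
qed

lemma finite_arcs_from: "finite {y. (x, y) \<in> parcs G}"
  by (rule finite_subset[OF _ pair_finite_verts]) (auto dest: arc_verts)

lemma finite_nbrs: "finite (nbrs v)"
proof (cases "fst v \<in> V\<^sub>G")
  case True
  then show ?thesis using nbrs_eq[of "fst v" "snd v"] finite_arcs_from by simp
next
  case False
  then have "nbrs v = {}" using adj_verts[of _ v] unfolding nbrs_def by blast
  then show ?thesis by simp
qed

lemma card_nbrs:
  assumes "x \<in> V\<^sub>G"
  shows "card (nbrs (x, k)) = out_degree (with_proj G) x + 2"
proof -
  have "card ((\<lambda>y. (y, k)) ` {y. (x, y) \<in> parcs G} \<union> {(x, k - 1), (x, k + 1)})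
      = card ((\<lambda>y. (y, k)) ` {y. (x, y) \<in> parcs G}) + card {(x, k - 1), (x, k + 1)}"
    by (rule card_Un_disjoint) (auto simp: finite_arcs_from)
  then show ?thesis
    by (simp add: nbrs_eq[OF assms] out_degree_eq card_image inj_on_def)
qed

lemma toppling_diag: "fst v \<in> V\<^sub>G \<Longrightarrow> toppling_matrix G v v = int (card (nbrs v))"
  using card_nbrs[of "fst v" "snd v"] by (simp add: toppling_matrix_def)

text \<open>The sign \<open>s\<close> selects the end of the ladder: \<open>s = 1\<close> is the left end, \<open>s = - 1\<close> the right end.\<close>

inductive_set far :: "int \<Rightarrow> ('a \<times> int) set \<Rightarrow> ('a \<times> int) set" for s W where
  base: "x \<in> V\<^sub>G \<Longrightarrow> (\<And>y i. (y, i) \<in> W \<Longrightarrow> s * j < s * i) \<Longrightarrow> (x, j) \<in> far s W"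
| step: "u \<in> far s W \<Longrightarrow> adj u v \<Longrightarrow> v \<notin> W \<Longrightarrow> v \<in> far s W"

lemma far_disjoint: "u \<in> far s W \<Longrightarrow> u \<notin> W"
  by (induction rule: far.induct) auto

lemma far_antimono: "u \<in> far s W \<Longrightarrow> W' \<subseteq> W \<Longrightarrow> u \<in> far s W'"
  by (induction rule: far.induct) (auto intro: far.intros)

text \<open>\<open>D\<close> is the region already burnt; this is the burning condition with the
  diagonal entry written as the number of neighbours.\<close>

abbreviation removable :: "('a \<times> int) set \<Rightarrow> ('a \<times> int \<Rightarrow> int) \<Rightarrow> 'a \<times> int \<Rightarrow> bool" where
  "removable D \<eta> v \<equiv> int (card (nbrs v)) < \<eta> v + int (card (nbrs v \<inter> D))"

definition burnable :: "(('a \<times> int) set \<Rightarrow> ('a \<times> int) set) \<Rightarrow> ('a \<times> int) set \<Rightarrow> ('a \<times> int \<Rightarrow> int) \<Rightarrow> bool" where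
  "burnable C V \<eta> \<longleftrightarrow> (\<forall>W\<subseteq>V. W \<noteq> {} \<longrightarrow>
     (\<exists>v\<in>W. removable (C W) \<eta> v))"

lemma burnableD:
  assumes "burnable C V \<eta>" "W \<subseteq> V" "W \<noteq> {}"
  obtains v where "v \<in> W" "removable (C W) \<eta> v"
  using assms unfolding burnable_def by blast

lemma burnable_subset: "burnable C V \<eta> \<Longrightarrow> V' \<subseteq> V \<Longrightarrow> burnable C V' \<eta>"
  unfolding burnable_def by blast

lemma card_nbrs_Int_mono: "nbrs v \<inter> A \<subseteq> B \<Longrightarrow> card (nbrs v \<inter> A) \<le> card (nbrs v \<inter> B)"
  using finite_nbrs[of v] by (intro card_mono) auto

lemma burnable_mono:
  assumes "burnable C V \<eta>" "\<And>v. v \<in> V \<Longrightarrow> \<eta> v \<le> \<eta>' v"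
  shows "burnable C V \<eta>'"
  unfolding burnable_def
proof (intro allI impI)
  fix W assume W: "W \<subseteq> V" "W \<noteq> {}"
  obtain v where v: "v \<in> W" "removable (C W) \<eta> v"
    using burnableD[OF assms(1) W] .
  have "\<eta> v \<le> \<eta>' v" using assms(2) v(1) W by blast
  with v show "\<exists>v\<in>W. removable (C W) \<eta>' v"
    by (intro bexI[of _ v]) auto
qed

lemma burnable_cong: "(\<And>v. v \<in> V \<Longrightarrow> \<eta> v = \<eta>' v) \<Longrightarrow> burnable C V \<eta> \<longleftrightarrow> burnable C V \<eta>'"
  using burnable_mono[of C V \<eta> \<eta>'] burnable_mono[of C V \<eta>' \<eta>] by fastforce

lemma burnable_far_imp_uminus:
  assumes "burnable (far s) V \<eta>"
  shows "burnable uminus V \<eta>"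
  unfolding burnable_def
proof (intro allI impI)
  fix W assume W: "W \<subseteq> V" "W \<noteq> {}"
  obtain v where v: "v \<in> W" "removable (far s W) \<eta> v"
    using burnableD[OF assms W] .
  have "card (nbrs v \<inter> far s W) \<le> card (nbrs v \<inter> - W)"
    by (rule card_nbrs_Int_mono) (use far_disjoint in blast)
  with v show "\<exists>v\<in>W. removable (- W) \<eta> v"
    by (intro bexI[of _ v]) auto
qed

lemma adj_pos:
  assumes "adj u v" "s * s = (1::int)" 
  shows "s * snd v \<le> s * snd u + 1" "s * snd u \<le> s * snd v + 1"
    "s * snd u \<noteq> s * snd v \<Longrightarrow> fst u = fst v"
proof -
  have s: "s = 1 \<or> s = - 1" using assms(2) by (metis square_eq_1_iff)
  obtain x k y l where uv: "u = (x, k)" "v = (y, l)" by (cases u; cases v)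
  show "s * snd v \<le> s * snd u + 1" "s * snd u \<le> s * snd v + 1"
    "s * snd u \<noteq> s * snd v \<Longrightarrow> fst u = fst v"
    using s assms(1) unfolding uv by (auto simp: adj_iff abs_if split: if_splits)
qed

end

section \<open>Burning across a column of maximal height\<close>

text \<open>Positions are multiplied by \<open>s\<close>, so that \<open>V1\<close> is always the
  side nearer to the end from which the fire comes. One argument then serves both ends, by way of
  \<open>reversed\<close>.\<close>

locale full_column = connected_pair_graph +
  fixes s k :: int and V1 V2 :: "('a \<times> int) set" and \<eta> :: "'a \<times> int \<Rightarrow> int"
  assumes s: "s * s = 1"
    and V1: "\<And>x j. (x, j) \<in> V1 \<Longrightarrow> s * j < s * k"
    and V2: "\<And>x j. (x, j) \<in> V2 \<Longrightarrow> s * k < s * j"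
    and full: "\<And>x. x \<in> V\<^sub>G \<Longrightarrow> \<eta> (x, k) = int (card (nbrs (x, k)))"
begin

abbreviation "K \<equiv> V\<^sub>G \<times> {k}"

lemma s_cases: "s = 1 \<or> s = - 1"
  using s by (simp only: square_eq_1_iff)

lemma K_pos: "v \<in> K \<longleftrightarrow> fst v \<in> V\<^sub>G \<and> s * snd v = s * k"
  using s_cases by (cases v) auto

lemma K_removable:
  assumes "v \<in> K" "adj u v" "u \<in> D"
  shows "removable D \<eta> v"
proof -
  have "u \<in> nbrs v \<inter> D" using assms by (auto simp: nbrs_def)
  then have "0 < card (nbrs v \<inter> D)" using finite_nbrs[of v] by (auto simp: card_gt_0_iff)
  moreover have "\<eta> v = int (card (nbrs v))" using assms(1) full by auto
  ultimately show ?thesis by simp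
qed

lemma K_below: "x \<in> V\<^sub>G \<Longrightarrow> adj (x, k - s) (x, k) \<and> s * (k - s) < s * k"
  using s_cases by (auto simp: adj_iff)

text \<open>A copy of \<open>G\<close> sits in the column, so a set closed under steps within the
  column contains none or all of it. It is applied both to burnt regions and to sets that cannot be
  reduced.\<close>

lemma K_propagates:
  assumes "D \<inter> K \<noteq> {}" "\<And>u v. u \<in> D \<Longrightarrow> u \<in> K \<Longrightarrow> adj u v \<Longrightarrow> v \<in> K \<Longrightarrow> v \<in> D"
  shows "K \<subseteq> D"
proof (rule ccontr)
  assume "\<not> K \<subseteq> D"
  define X where "X = {x \<in> V\<^sub>G. (x, k) \<in> D}"
  have "X \<subseteq> V\<^sub>G" "X \<noteq> {}" "X \<noteq> V\<^sub>G" using assms(1) \<open>\<not> K \<subseteq> D\<close> by (auto simp: X_def)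
  then obtain x y where "x \<in> X" "y \<in> V\<^sub>G - X" "(x, y) \<in> parcs G" by (rule cut_arc)
  then have "(x, k) \<in> D" "(x, k) \<in> K" "adj (x, k) (y, k)" "(y, k) \<in> K" "(y, k) \<notin> D" by (auto simp: X_def adj_iff)
  then show False using assms(2) by blast
qed

text \<open>Let no site of \<open>W\<close> be removable. If \<open>W\<close> avoids the column, the
  column is transparent and the fire reaches \<open>W1\<close> as it would without
  \<open>V2\<close>. If \<open>W\<close> meets the column, the fire cannot touch it, since a full
  site burns at its first burnt neighbour; so the fire is stopped by \<open>W1\<close> alone. Either
  way \<open>W1\<close> contradicts the burnability of \<open>V1\<close>, or \<open>W1\<close> is
  empty and the fire reaches the column or \<open>V2\<close>.\<close>

lemma burnable_far_join:
  assumes 1: "burnable (far s) V1 \<eta>" and 2: "burnable (far s) V2 \<eta>"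
  shows "burnable (far s) (V1 \<union> K \<union> V2) \<eta>"
  unfolding burnable_def
proof (intro allI impI, rule ccontr)
  fix W assume W: "W \<subseteq> V1 \<union> K \<union> V2" "W \<noteq> {}"
    and "\<not> (\<exists>v\<in>W. removable (far s W) \<eta> v)"
  then have stuck: "\<not> removable (far s W) \<eta> v" if "v \<in> W" for v
    using that by blast
  define W1 where "W1 = W \<inter> V1"
  have W_lt: "v \<in> W1" if "v \<in> W" "s * snd v < s * k" for v
  proof -
    have "v \<notin> V2" using V2[of "fst v" "snd v"] that(2) by auto
    moreover have "v \<notin> K" using K_pos that(2) by auto
    ultimately show ?thesis using W(1) that(1) by (auto simp: W1_def)
  qed
  have base_W: "(x, j) \<in> far s W" if "x \<in> V\<^sub>G" "\<And>y i. (y, i) \<in> W1 \<Longrightarrow> s * j < s * i" "s * j < s * k" for x j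
  proof (rule far.base[OF that(1)])
    fix y i assume yi: "(y, i) \<in> W"
    show "s * j < s * i"
    proof (cases "s * i < s * k")
      case True
      then show ?thesis using W_lt[OF yi] that(2) by simp
    next
      case False
      then show ?thesis using that(3) by simp
    qed
  qed
  have W1_lt: "s * i < s * k" if "(y, i) \<in> W1" for y i using V1 that by (auto simp: W1_def)
  have K_not_far: False if u: "u \<in> far s W" and uv: "adj u v" "v \<in> K" "v \<in> W" for u v
    using K_removable[OF uv(2) uv(1) u] stuck[OF uv(3)] by blast
  show False
  proof (cases "W \<inter> K = {}")
    case disj: True
    \<comment> \<open>With \<open>W\<close> away from the column, one burnt site of the column
      carries the fire through all of it.\<close>
    have K_all: "K \<subseteq> far s W" if "far s W \<inter> K \<noteq> {}"
      using that by (rule K_propagates) (rule far.step, assumption, assumption, use disj in blast)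
    show False
    proof (cases "W1 = {}")
      case True
      then have "W \<subseteq> V2" using W disj by (auto simp: W1_def)
      then show False using burnableD[OF 2 _ W(2)] stuck by metis
    next
      case False
      then obtain y0 i0 where y0: "(y0, i0) \<in> W1" by auto
      \<comment> \<open>The fire around \<open>W1\<close> may pass the column and wander where
        \<open>W\<close> would block it. So burning is claimed only up to the column, together with
        the whole column once the fire has passed it; this covers a return across the
        column.\<close>
      have claim: "(s * snd u \<le> s * k \<longrightarrow> u \<in> far s W) \<and> (s * k < s * snd u \<longrightarrow> K \<subseteq> far s W)"
        if "u \<in> far s W1" for u
        using that
      proof (induction rule: far.induct)
        case (base x j)
        have "s * j < s * k" using base(2)[OF y0] W1_lt[OF y0] by simp
        then show ?case using base_W[OF base(1) base(2)] by auto
      next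
        case (step u v)
        show ?case
        proof (cases "s * snd v \<le> s * k")
          case le: True
          have vW: "v \<notin> W"
          proof
            assume "v \<in> W"
            show False
            proof (cases "s * snd v < s * k")
              case True
              then show False using W_lt[OF \<open>v \<in> W\<close>] step(3) by simp
            next
              case False
              then have "v \<in> K" using le adj_verts[OF step(2)] K_pos by auto
              then show False using \<open>v \<in> W\<close> disj by blast
            qed
          qed
          show ?thesis
          proof (cases "s * snd u \<le> s * k")
            case True
            then have "v \<in> far s W" using far.step[of u s W v] step.IH step(2) vW by simp
            then show ?thesis using le by simp
          next
            case False
            then have "s * snd v = s * k" using le adj_pos[OF step(2) s] by linarith
            then have "v \<in> K" using adj_verts[OF step(2)] K_pos by auto
            then show ?thesis using False step.IH le by auto
          qed
        next
          case gt: False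
          have "K \<subseteq> far s W"
          proof (cases "s * snd u \<le> s * k")
            case True
            then have "s * snd u = s * k" using gt adj_pos(1)[OF step(2) s] by linarith
            then have "u \<in> K" using adj_verts[OF step(2)] K_pos by blast
            then show ?thesis using K_all True step.IH by blast
          next
            case False
            then show ?thesis using step.IH by simp
          qed
          then show ?thesis using gt by simp
        qed
      qed
      obtain v where v: "v \<in> W1" "removable (far s W1) \<eta> v"
        using burnableD[OF 1 _ False] by (auto simp: W1_def)
      have "card (nbrs v \<inter> far s W1) \<le> card (nbrs v \<inter> far s W)"
      proof (rule card_nbrs_Int_mono, rule subsetI)
        fix u assume u: "u \<in> nbrs v \<inter> far s W1"
        then have "adj u v" by (simp add: nbrs_def)
        then have "s * snd u \<le> s * k" using adj_pos[OF _ s, of u v] W1_lt[of "fst v" "snd v"] v(1) by simp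
        then show "u \<in> far s W" using claim u by blast
      qed
      then show False using stuck[of v] v by (auto simp: W1_def)
    qed
  next
    case meets: False
    \<comment> \<open>A burnt site of the column would spread to the whole column, including its
      sites in \<open>W\<close>.\<close>
    have noK: "far s W \<inter> K = {}"
    proof (rule ccontr)
      assume "far s W \<inter> K \<noteq> {}"
      then have "K \<subseteq> far s W"
        by (rule K_propagates) (rule far.step, assumption, assumption, use K_not_far in blast)
      then show False using meets far_disjoint by blast
    qed
    obtain x where x: "(x, k) \<in> W" "x \<in> V\<^sub>G" using meets by auto
    have lt: "s * snd u < s * k" if "u \<in> far s W" for u
      using that
    proof (induction rule: far.induct)
      case (base y j)
      then show ?case using x by simp
    next
      case (step u v)
      have "v \<in> far s W" using far.step[OF step(1-3)] .
      then have "v \<notin> K" using noK by blast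
      then have "s * snd v \<noteq> s * k" using K_pos[of v] adj_verts[OF step(2)] by blast
      then show ?case using adj_pos(1)[OF step(2) s] step.IH by linarith
    qed
    show False
    proof (cases "W1 = {}")
      case True
      then have "(x, k - s) \<in> far s W" using K_below[OF x(2)] by (intro base_W x) auto
      then show False using K_not_far[of "(x, k - s)" "(x, k)"] K_below[OF x(2)] x by auto
    next
      case False
      then obtain y0 i0 where y0: "(y0, i0) \<in> W1" by auto
      have claim: "u \<in> far s W" if "u \<in> far s W1" for u
        using that
      proof (induction rule: far.induct)
        case (base x j)
        have "s * j < s * k" using base(2)[OF y0] W1_lt[OF y0] by simp
        then show ?case using base_W[OF base(1) base(2)] by auto
      next
        case (step u v)
        have le: "s * snd v \<le> s * k" using lt[OF step.IH] adj_pos[OF step(2) s] by simp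
        show ?case
        proof (cases "v \<in> W")
          case True
          then have "\<not> s * snd v < s * k" using W_lt step(3) by blast
          then have "s * snd v = s * k" using le by linarith
          then have "v \<in> K" using adj_verts[OF step(2)] K_pos[of v] by blast
          then show ?thesis using K_not_far[OF step.IH step(2)] True by blast
        next
          case False
          then show ?thesis using far.step[OF step.IH step(2)] by blast
        qed
      qed
      obtain v where v: "v \<in> W1" "removable (far s W1) \<eta> v"
        using burnableD[OF 1 _ False] by (auto simp: W1_def)
      have "card (nbrs v \<inter> far s W1) \<le> card (nbrs v \<inter> far s W)"
        by (rule card_nbrs_Int_mono) (use claim in blast)
      then show False using stuck[of v] v by (auto simp: W1_def)
    qed
  qed
qed

lemma burnable_far_iff:
  "burnable (far s) (V1 \<union> K \<union> V2) \<eta> \<longleftrightarrow> burnable (far s) V1 \<eta> \<and> burnable (far s) V2 \<eta>"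
  using burnable_far_join burnable_subset[of _ "V1 \<union> K \<union> V2"] by blast

end

context full_column
begin

lemma reversed: "full_column G (- s) k V2 V1 \<eta>"
  using s V1 V2 full by unfold_locales auto

text \<open>If \<open>W\<close> avoids the column, its two parts are not adjacent and one of them
  can be reduced on its own. If \<open>W\<close> meets the column it contains all of it, and the
  part in \<open>V1\<close> gets no help from the other side; this is where one-sided burnability of
  \<open>V1\<close> is decisive.\<close>

lemma burnable_uminus_join:
  assumes 1: "burnable uminus V1 \<eta>" and 2: "burnable uminus V2 \<eta>" and far: "burnable (far s) V1 \<eta>"
  shows "burnable uminus (V1 \<union> K \<union> V2) \<eta>"
  unfolding burnable_def
proof (intro allI impI, rule ccontr)
  fix W assume W: "W \<subseteq> V1 \<union> K \<union> V2" "W \<noteq> {}"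
    and "\<not> (\<exists>v\<in>W. removable (- W) \<eta> v)"
  then have stuck: "\<not> removable (- W) \<eta> v" if "v \<in> W" for v
    using that by blast
  have V1_lt: "s * snd v < s * k" if "v \<in> V1" for v using V1[of "fst v" "snd v"] that by simp
  have V2_gt: "s * k < s * snd v" if "v \<in> V2" for v using V2[of "fst v" "snd v"] that by simp
  have W_lt: "v \<in> V1" if "v \<in> W" "s * snd v < s * k" for v
    using V2_gt[of v] K_pos[of v] W(1) that by (auto simp del: mem_Times_iff)
  have W_gt: "v \<in> V2" if "v \<in> W" "s * k < s * snd v" for v
    using V1_lt[of v] K_pos[of v] W(1) that by (auto simp del: mem_Times_iff)
  have K_not_far: False if u: "u \<notin> W" and uv: "adj u v" "v \<in> K" "v \<in> W" for u v
    using K_removable[OF uv(2) uv(1), of "- W"] u stuck[OF uv(3)] by blast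
  show False
  proof (cases "W \<inter> K = {}")
    case disj: True
    \<comment> \<open>A part of \<open>W\<close> without neighbours in the rest of \<open>W\<close>
      sees the same outside neighbours as within \<open>W\<close>.\<close>
    have *: False if sub: "W' \<subseteq> W" "W' \<noteq> {}" and b: "burnable uminus W' \<eta>"
      and sep: "\<And>u v. v \<in> W' \<Longrightarrow> adj u v \<Longrightarrow> u \<in> W \<Longrightarrow> u \<in> W'" for W'
    proof -
      obtain v where v: "v \<in> W'" "removable (- W') \<eta> v"
        using burnableD[OF b order_refl sub(2)] .
      have "card (nbrs v \<inter> - W') \<le> card (nbrs v \<inter> - W)"
        by (rule card_nbrs_Int_mono) (use sep[OF v(1)] in \<open>auto simp: nbrs_def\<close>)
      then show False using stuck[of v] v sub by auto
    qed
    have notK: "s * snd u \<noteq> s * k" if "adj u v" "u \<in> W" for u v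
      using K_pos[of u] adj_verts[OF that(1)] that(2) disj by blast
    show False
    proof (cases "W \<inter> V1 = {}")
      case False
      show False
      proof (rule *[of "W \<inter> V1"])
        show "burnable uminus (W \<inter> V1) \<eta>" by (rule burnable_subset[OF 1]) auto
        fix u v assume uv: "v \<in> W \<inter> V1" "adj u v" "u \<in> W"
        then have "s * snd v < s * k" using V1_lt by blast
        then have "s * snd u < s * k"
          using adj_pos(2)[OF uv(2) s] notK[OF uv(2,3)] by linarith
        then show "u \<in> W \<inter> V1" using W_lt uv(3) by blast
      qed (use False in auto)
    next
      case True
      then have "W \<subseteq> V2" using W disj by blast
      then show False using *[of W] W(2) burnable_subset[OF 2] by blast
    qed
  next
    case meets: False
    \<comment> \<open>A full site of \<open>W\<close> with a neighbour outside \<open>W\<close>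
      would be removable, so membership in \<open>W\<close> spreads along the column.\<close>
    have "K \<subseteq> W"
    proof (rule K_propagates[OF meets])
      fix u v assume uv: "u \<in> W" "u \<in> K" "adj u v" "v \<in> K"
      show "v \<in> W"
      proof (rule ccontr)
        assume "v \<notin> W"
        then show False using K_not_far[of v u] adj_sym[OF uv(3)] uv(1,2) by blast
      qed
    qed
    obtain x where x: "(x, k) \<in> W" "x \<in> V\<^sub>G" using meets by auto
    define W1 where "W1 = W \<inter> V1"
    show False
    proof (cases "W1 = {}")
      case True
      have "(x, k - s) \<notin> W" using W_lt[of "(x, k - s)"] K_below[OF x(2)] True by (auto simp: W1_def)
      then show False using K_not_far[of "(x, k - s)" "(x, k)"] K_below[OF x(2)] x by auto
    next
      case False
      then obtain y0 i0 where y0: "(y0, i0) \<in> W1" by auto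
      \<comment> \<open>The fire around \<open>W1\<close> halts before the column, because every
        site that it burns before the column is outside \<open>W\<close>, and a full site next to it
        would be removable.\<close>
      have lt: "s * snd u < s * k" if "u \<in> far s W1" for u
        using that
      proof (induction rule: far.induct)
        case (base y j)
        have "s * j < s * i0" using base(2)[OF y0] .
        also have "\<dots> < s * k" using V1_lt[of "(y0, i0)"] y0 by (simp add: W1_def)
        finally show ?case by simp
      next
        case (step u v)
        have "u \<notin> W" using W_lt[of u] step.IH far_disjoint[OF step(1)] by (auto simp: W1_def)
        moreover have "v \<in> W" if "v \<in> K" using that \<open>K \<subseteq> W\<close> by blast
        ultimately have "v \<notin> K" using K_not_far[of u v] step(2) by blast
        then have "s * snd v \<noteq> s * k" using K_pos[of v] adj_verts[OF step(2)] by blast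
        then show ?case using adj_pos(1)[OF step(2) s] step.IH by linarith
      qed
      have far_W: "u \<notin> W" if "u \<in> far s W1" for u
        using W_lt[of u] lt[OF that] far_disjoint[OF that] by (auto simp: W1_def)
      obtain v where v: "v \<in> W1" "removable (far s W1) \<eta> v"
        using burnableD[OF far _ False] by (auto simp: W1_def)
      have "card (nbrs v \<inter> far s W1) \<le> card (nbrs v \<inter> - W)"
        by (rule card_nbrs_Int_mono) (use far_W in blast)
      then show False using stuck[of v] v by (auto simp: W1_def)
    qed
  qed
qed

end

text \<open>The two sides have no holes: a site on the side of \<open>V1\<close> but outside
  \<open>V1\<close> lies beyond all of \<open>V1\<close>, hence is burnt from the start by the fire
  from that end; likewise for \<open>V2\<close>.\<close>

locale full_column_in_segment = full_column +
  assumes outside1: "\<And>x j y i. x \<in> V\<^sub>G \<Longrightarrow> s * j < s * k \<Longrightarrow> (x, j) \<notin> V1 \<Longrightarrow> (y, i) \<in> V1 \<Longrightarrow> s * j < s * i"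
    and outside2: "\<And>x j y i. x \<in> V\<^sub>G \<Longrightarrow> s * k < s * j \<Longrightarrow> (x, j) \<notin> V2 \<Longrightarrow> (y, i) \<in> V2 \<Longrightarrow> s * i < s * j"
    and stable: "\<And>v. v \<in> V1 \<union> V2 \<Longrightarrow> \<eta> v \<le> int (card (nbrs v))"
begin

lemma reversed_in_segment: "full_column_in_segment G (- s) k V2 V1 \<eta>"
proof -
  interpret R: full_column G "- s" k V2 V1 \<eta> by (rule reversed)
  show ?thesis
  proof unfold_locales
    fix x j y i assume "x \<in> V\<^sub>G" "- s * j < - s * k" "(x, j) \<notin> V2" "(y, i) \<in> V2"
    then show "- s * j < - s * i" using outside2[of x j y i] by simp
  next
    fix x j y i assume "x \<in> V\<^sub>G" "- s * k < - s * j" "(x, j) \<notin> V1" "(y, i) \<in> V1"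
    then show "- s * i < - s * j" using outside1[of x j y i] by simp
  next
    fix v assume "v \<in> V2 \<union> V1"
    then show "\<eta> v \<le> int (card (nbrs v))" using stable[of v] by blast
  qed
qed

text \<open>If the fire reached the column, it would burn all of it and everything behind it, so
  every site outside \<open>V1\<close> would be burnt. A recurrent \<open>V1\<close> then has an
  unburnt site that is removable relative to the fire. In \<open>W1\<close> this is excluded by
  assumption; elsewhere the site has no burnt neighbour, and its height would exceed the
  degree.\<close>

lemma stuck_far_before:
  assumes rec: "burnable uminus V1 \<eta>" and W1: "W1 \<subseteq> V1" "W1 \<noteq> {}"
    and stuck: "\<And>v. v \<in> W1 \<Longrightarrow> \<not> removable (far s W1) \<eta> v"
    and u: "u \<in> far s W1"
  shows "s * snd u < s * k"
proof -
  let ?D = "far s W1"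
  have V1_lt: "s * snd v < s * k" if "v \<in> V1" for v using V1[of "fst v" "snd v"] that by simp
  have W1_K: "v \<notin> W1" if "v \<in> K" for v
    using V1_lt[of v] subsetD[OF W1(1), of v] that unfolding K_pos by linarith
  obtain y0 i0 where y0: "(y0, i0) \<in> W1" using W1 by auto
  have "?D \<inter> K = {}"
  proof (rule ccontr)
    assume "?D \<inter> K \<noteq> {}"
    then have KD: "K \<subseteq> ?D"
      by (rule K_propagates) (rule far.step, assumption, assumption, erule W1_K)
    \<comment> \<open>\<open>W1\<close> lies before the column, so nothing stops the fire behind
      it.\<close>
    have up: "(x, k + s * int n) \<in> ?D" if x: "x \<in> V\<^sub>G" for x n
    proof (induction n)
      case 0
      then show ?case using KD x by auto
    next
      case (Suc n)
      have a: "adj (x, k + s * int n) (x, k + s * int (Suc n))"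
        using x s_cases by (auto simp: adj_iff)
      have "s * (k + s * int (Suc n)) = s * k + (s * s) * int (Suc n)" by (simp add: algebra_simps)
      then have "\<not> s * (k + s * int (Suc n)) < s * k" using s by simp
      then have "(x, k + s * int (Suc n)) \<notin> W1" using V1_lt[of "(x, k + s * int (Suc n))"] W1 by auto
      then show ?case using far.step[OF Suc a] by simp
    qed
    have ge_D: "v \<in> ?D" if v: "fst v \<in> V\<^sub>G" "s * k \<le> s * snd v" for v
    proof -
      have "snd v = k + s * int (nat (s * snd v - s * k))"
        using v s_cases by auto
      then show ?thesis using up[OF v(1), of "nat (s * snd v - s * k)"] by (metis prod.collapse)
    qed
    define T where "T = V1 - ?D"
    have W1T: "W1 \<subseteq> T" using W1 far_disjoint by (auto simp: T_def)
    obtain v where v: "v \<in> T" "removable (- T) \<eta> v"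
    proof (rule burnableD[OF rec])
      show "T \<subseteq> V1" by (auto simp: T_def)
      show "T \<noteq> {}" using W1T W1 by blast
    qed
    have "card (nbrs v \<inter> - T) \<le> card (nbrs v \<inter> ?D)"
    proof (rule card_nbrs_Int_mono, rule subsetI)
      fix u assume u: "u \<in> nbrs v \<inter> - T"
      then have uV: "fst u \<in> V\<^sub>G" using adj_verts[of u v] by (simp add: nbrs_def)
      show "u \<in> ?D"
      proof (cases "s * k \<le> s * snd u")
        case True
        then show ?thesis using ge_D uV by blast
      next
        case False
        show ?thesis
        proof (cases "u \<in> V1")
          case True
          then show ?thesis using u by (auto simp: T_def)
        next
          case notin: False
          have "(fst u, snd u) \<in> ?D"
          proof (rule far.base[OF uV])
            fix y i assume "(y, i) \<in> W1"
            then show "s * snd u < s * i"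
              using outside1[OF uV, of "snd u" y i] False notin W1 by auto
          qed
          then show ?thesis by simp
        qed
      qed
    qed
    then have *: "removable ?D \<eta> v" using v(2) by simp
    show False
    proof (cases "v \<in> W1")
      case True
      then show False using stuck * by blast
    next
      case False
      have "nbrs v \<inter> ?D = {}"
        using far.step[of _ s W1 v] False v(1) by (auto simp: nbrs_def T_def)
      then have "int (card (nbrs v)) < \<eta> v" using * by simp
      moreover have "\<eta> v \<le> int (card (nbrs v))" using stable[of v] v(1) by (simp add: T_def)
      ultimately show False by simp
    qed
  qed
  then have noK: "w \<notin> K" if "w \<in> ?D" for w using that by blast
  show ?thesis using u
  proof (induction rule: far.induct)
    case (base y j)
    have "s * j < s * i0" using base(2)[OF y0] .
    also have "\<dots> < s * k" using V1_lt[of "(y0, i0)"] y0 W1 by auto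
    finally show ?case by simp
  next
    case (step u v)
    have "v \<notin> K" using noK far.step[OF step(1-3)] by blast
    then have "s * snd v \<noteq> s * k" using K_pos[of v] adj_verts[OF step(2)] by blast
    then show ?case using adj_pos(1)[OF step(2) s] step.IH by linarith
  qed
qed

text \<open>If both one-sided fires get stuck, at \<open>W1\<close> and at \<open>W2\<close>, they
  stay on their own sides of the column, by \<open>stuck_far_before\<close>. The set
  \<open>T\<close> of sites that neither reaches contains the column, and recurrence yields a
  removable site of \<open>T\<close>. It is adjacent to at most one of the fires, so either it
  contradicts the choice of \<open>W1\<close> or \<open>W2\<close>, or its height exceeds its
  degree.\<close>

lemma burnable_uminus_meet:
  assumes rec: "burnable uminus (V1 \<union> K \<union> V2) \<eta>"
  shows "burnable (far s) V1 \<eta> \<or> burnable (far (- s)) V2 \<eta>"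
proof (rule ccontr)
  interpret R: full_column_in_segment G "- s" k V2 V1 \<eta> by (rule reversed_in_segment)
  assume neg: "\<not> (burnable (far s) V1 \<eta> \<or> burnable (far (- s)) V2 \<eta>)"
  have 1: "burnable uminus V1 \<eta>" and 2: "burnable uminus V2 \<eta>"
    by (rule burnable_subset[OF rec], blast)+
  from neg obtain W1 where W1: "W1 \<subseteq> V1" "W1 \<noteq> {}"
    and st1: "\<And>v. v \<in> W1 \<Longrightarrow> \<not> removable (far s W1) \<eta> v"
    unfolding burnable_def by blast
  from neg obtain W2 where W2: "W2 \<subseteq> V2" "W2 \<noteq> {}"
    and st2: "\<And>v. v \<in> W2 \<Longrightarrow> \<not> removable (far (- s) W2) \<eta> v"
    unfolding burnable_def by blast
  let ?L = "far s W1" and ?R = "far (- s) W2"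
  have L_lt: "s * snd u < s * k" if "u \<in> ?L" for u
    by (rule stuck_far_before[OF 1 W1 st1 that])
  have R_gt: "s * k < s * snd u" if "u \<in> ?R" for u
    using R.stuck_far_before[OF 2 W2 st2 that] by simp
  have V1_lt: "s * snd v < s * k" if "v \<in> V1" for v using V1[of "fst v" "snd v"] that by simp
  have V2_gt: "s * k < s * snd v" if "v \<in> V2" for v using V2[of "fst v" "snd v"] that by simp
  define T where "T = (V1 \<union> K \<union> V2) - ?L - ?R"
  have "v \<in> T" if "v \<in> K" for v
    using L_lt[of v] R_gt[of v] that K_pos[of v] unfolding T_def by (metis Diff_iff UnI1 UnI2 less_irrefl)
  then have "K \<subseteq> T" by blast
  then have T: "T \<noteq> {}" using verts_nonempty by auto
  obtain v where v: "v \<in> T" "removable (- T) \<eta> v"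
  proof (rule burnableD[OF rec])
    show "T \<subseteq> V1 \<union> K \<union> V2" by (auto simp: T_def)
  qed (rule T)
  have sub: "nbrs v \<inter> - T \<subseteq> ?L \<union> ?R"
  proof
    fix u assume u: "u \<in> nbrs v \<inter> - T"
    then have uV: "fst u \<in> V\<^sub>G" using adj_verts[of u v] by (simp add: nbrs_def)
    show "u \<in> ?L \<union> ?R"
    proof (cases "u \<in> V1 \<union> K \<union> V2")
      case True
      then show ?thesis using u by (auto simp: T_def)
    next
      case False
      then have "s * snd u \<noteq> s * k" using K_pos[of u] uV by blast
      then consider "s * snd u < s * k" | "s * k < s * snd u" by linarith
      then show ?thesis
      proof cases
        case 1
        have "(fst u, snd u) \<in> ?L"
        proof (rule far.base[OF uV])
          fix y i assume "(y, i) \<in> W1"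
          then show "s * snd u < s * i"
            using outside1[OF uV 1, of y i] False W1 by auto
        qed
        then show ?thesis by simp
      next
        case 2
        have "(fst u, snd u) \<in> ?R"
        proof (rule far.base[OF uV])
          fix y i assume "(y, i) \<in> W2"
          then show "- s * snd u < - s * i"
            using outside2[OF uV 2, of y i] False W2 by auto
        qed
        then show ?thesis by simp
      qed
    qed
  qed
  \<comment> \<open>An unburnt site outside \<open>W1\<close> that is adjacent to the fire
    \<open>?L\<close> would itself belong to \<open>?L\<close>.\<close>
  have no_nbr: "nbrs v \<inter> ?L = {}" if "v \<notin> W1"
    using far.step[of _ s W1 v] that v(1) by (auto simp: nbrs_def T_def)
  have no_nbr': "nbrs v \<inter> ?R = {}" if "v \<notin> W2"
    using far.step[of _ "- s" W2 v] that v(1) by (auto simp: nbrs_def T_def)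
  consider "v \<in> W1" | "v \<in> W2" | "v \<notin> W1" "v \<notin> W2" by blast
  then show False
  proof cases
    case 1
    then have "v \<notin> W2" using V1_lt[of v] V2_gt[of v] subsetD[OF W1(1), of v] subsetD[OF W2(1), of v] by linarith
    then have "nbrs v \<inter> - T \<subseteq> ?L" using sub no_nbr' by blast
    then have "card (nbrs v \<inter> - T) \<le> card (nbrs v \<inter> ?L)" by (rule card_nbrs_Int_mono)
    then show False using st1[OF 1] v(2) by simp
  next
    case 2
    then have "v \<notin> W1" using V1_lt[of v] V2_gt[of v] subsetD[OF W1(1), of v] subsetD[OF W2(1), of v] by linarith
    then have "nbrs v \<inter> - T \<subseteq> ?R" using sub no_nbr by blast
    then have "card (nbrs v \<inter> - T) \<le> card (nbrs v \<inter> ?R)" by (rule card_nbrs_Int_mono)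
    then show False using st2[OF 2] v(2) by simp
  next
    case 3
    then have "nbrs v \<inter> - T = {}" using sub no_nbr no_nbr' by blast
    then have "int (card (nbrs v)) < \<eta> v" using v(2) by simp
    moreover have "\<eta> v \<le> int (card (nbrs v))"
    proof (cases "v \<in> K")
      case True
      then show ?thesis using full by auto
    next
      case False
      then show ?thesis using stable[of v] v(1) by (simp add: T_def del: mem_Times_iff)
    qed
    ultimately show False by simp
  qed
qed

lemma burnable_uminus_iff:
  "burnable uminus (V1 \<union> K \<union> V2) \<eta> \<longleftrightarrow>
    burnable uminus V1 \<eta> \<and> burnable uminus V2 \<eta> \<and> (burnable (far s) V1 \<eta> \<or> burnable (far (- s)) V2 \<eta>)"
proof -
  interpret R: full_column_in_segment G "- s" k V2 V1 \<eta> by (rule reversed_in_segment)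
  have eq: "V2 \<union> K \<union> V1 = V1 \<union> K \<union> V2" by blast
  have "burnable uminus (V1 \<union> K \<union> V2) \<eta>"
    if "burnable uminus V1 \<eta>" "burnable uminus V2 \<eta>" "burnable (far (- s)) V2 \<eta>"
    using R.burnable_uminus_join[OF that(2,1,3)] unfolding eq .
  then show ?thesis
    using burnable_uminus_meet burnable_uminus_join burnable_subset[of uminus "V1 \<union> K \<union> V2" \<eta> V1]
      burnable_subset[of uminus "V1 \<union> K \<union> V2" \<eta> V2] by blast
qed

end

lemma image_Collect_transfer:
  assumes "f ` A = B" "\<And>x. x \<in> A \<Longrightarrow> R (f x) \<longleftrightarrow> Q x"
  shows "f ` {x \<in> A. Q x} = {y \<in> B. R y}"
  using assms by auto

lemma (in separated_words) window_total_card: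
  assumes A: "A \<subseteq> words S d"
  shows "window_total A a b = card {w \<in> words S (a + d + b). P w \<and> take d (drop a w) \<in> A}"
proof -
  have "real (card {w \<in> words S (a + d + b). P w \<and> take d (drop a w) \<in> A})
      = (\<Sum>w\<in>words S (a + (d + b)). of_bool (P w \<and> take d (drop a w) \<in> A))"
    using finite_S by (simp add: Int_def add.assoc)
  also have "\<dots> = (\<Sum>y\<in>words S a. \<Sum>x\<in>words S d. \<Sum>z\<in>words S b.
      of_bool (P (y @ x @ z) \<and> take d (drop a (y @ x @ z)) \<in> A))"
    by (simp only: sum_words_add)
  also have "\<dots> = (\<Sum>y\<in>words S a. \<Sum>x\<in>words S d. if x \<in> A then \<Sum>z\<in>words S b. of_bool (P (y @ x @ z)) else 0)"
  proof (intro sum.cong refl)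
    fix x y assume "y \<in> words S a" "x \<in> words S d"
    then have "take d (drop a (y @ x @ z)) = x" for z by (simp add: words_def)
    then show "(\<Sum>z\<in>words S b. of_bool (P (y @ x @ z) \<and> take d (drop a (y @ x @ z)) \<in> A)) =
        (if x \<in> A then \<Sum>z\<in>words S b. of_bool (P (y @ x @ z)) else (0::real))"
      by simp
  qed
  also have "\<dots> = (\<Sum>y\<in>words S a. \<Sum>x\<in>words S d \<inter> A. \<Sum>z\<in>words S b. of_bool (P (y @ x @ z)))"
    by (simp only: sum.inter_restrict[OF finite_words[OF finite_S]])
  also have "words S d \<inter> A = A" using A by blast
  finally show ?thesis by (simp add: window_total_def)
qed

section \<open>Configurations as words of columns\<close>

context connected_pair_graph
begin

text \<open>Translations for \<open>c = 1\<close>, reflections for \<open>c = - 1\<close>. The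
  former let every word start at column 0, the latter exchange the two ends.\<close>

definition affine :: "int \<Rightarrow> int \<Rightarrow> 'a \<times> int \<Rightarrow> 'a \<times> int" where
  "affine c t = (\<lambda>(x, j). (x, c * j + t))"

lemma affine_inverse:
  assumes "c * c = 1"
  shows "affine c (- c * t) (affine c t u) = u" "affine c t (affine c (- c * t) u) = u"
proof -
  have "c = 1 \<or> c = - 1" using assms by (simp only: square_eq_1_iff)
  then show "affine c (- c * t) (affine c t u) = u" "affine c t (affine c (- c * t) u) = u"
    by (cases u; auto simp: affine_def)+
qed

lemma bij_affine: "c * c = 1 \<Longrightarrow> bij (affine c t)"
  by (rule o_bij[of "affine c (- c * t)"]; rule ext; simp only: o_apply id_apply affine_inverse)

lemma adj_affine:
  assumes "c * c = 1"
  shows "adj (affine c t u) (affine c t v) \<longleftrightarrow> adj u v"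
proof -
  have "c = 1 \<or> c = - 1" using assms by (simp only: square_eq_1_iff)
  then show ?thesis by (cases u; cases v) (auto simp: adj_iff affine_def abs_if)
qed

lemma far_affine_imp:
  assumes c: "c * c = 1" and u: "u \<in> far s W"
  shows "affine c t u \<in> far (s * c) (affine c t ` W)"
  using u
proof (induction rule: far.induct)
  case (base x j)
  have "c = 1 \<or> c = - 1" using c by (simp only: square_eq_1_iff)
  then have mult: "s * c * (c * i + t) = s * i + s * c * t" for i
    by (auto simp: algebra_simps)
  have "(x, c * j + t) \<in> far (s * c) (affine c t ` W)"
  proof (rule far.base[OF base(1)])
    fix y i assume "(y, i) \<in> affine c t ` W"
    then obtain i' where "(y, i') \<in> W" "i = c * i' + t" by (auto simp: affine_def)
    then show "s * c * (c * j + t) < s * c * i" using base(2) by (simp add: mult)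
  qed
  then show ?case by (simp add: affine_def)
next
  case (step u v)
  have "affine c t v \<notin> affine c t ` W"
    using step(3) bij_is_inj[OF bij_affine[OF c]] by (simp add: inj_image_mem_iff)
  then show ?case using far.step[OF step.IH, of "affine c t v"] adj_affine[OF c] step(2) by simp
qed

lemma far_affine:
  assumes c: "c * c = 1"
  shows "far (s * c) (affine c t ` W) = affine c t ` far s W"
proof (rule antisym)
  show "affine c t ` far s W \<subseteq> far (s * c) (affine c t ` W)"
    using far_affine_imp[OF c] by blast
  show "far (s * c) (affine c t ` W) \<subseteq> affine c t ` far s W"
  proof
    fix u assume "u \<in> far (s * c) (affine c t ` W)"
    from far_affine_imp[OF c this, of "- c * t"]
    have "affine c (- c * t) u \<in> far s W"
      by (simp only: image_image affine_inverse[OF c] mult.assoc c mult_1_right image_ident)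
    then show "u \<in> affine c t ` far s W"
      using affine_inverse(2)[OF c, of t u] by (metis imageI)
  qed
qed

lemma burnable_transport:
  assumes \<phi>: "bij \<phi>" "\<And>u v. adj (\<phi> u) (\<phi> v) \<longleftrightarrow> adj u v" and C: "\<And>W. C' (\<phi> ` W) = \<phi> ` C W"
  shows "burnable C' (\<phi> ` V) \<eta> \<longleftrightarrow> burnable C V (\<eta> \<circ> \<phi>)"
proof -
  have inj: "inj \<phi>" using \<phi>(1) by (rule bij_is_inj)
  have nbrs: "nbrs (\<phi> v) = \<phi> ` nbrs v" for v
  proof (rule set_eqI)
    fix u
    obtain u' where "u = \<phi> u'" using bij_is_surj[OF \<phi>(1)] by (metis surjD)
    then show "u \<in> nbrs (\<phi> v) \<longleftrightarrow> u \<in> \<phi> ` nbrs v"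
      using inj by (simp add: nbrs_def \<phi>(2) inj_image_mem_iff)
  qed
  have card: "card (\<phi> ` X) = card X" for X by (rule card_image[OF inj_on_subset[OF inj]]) simp
  have cond: "removable (C' (\<phi> ` W)) \<eta> (\<phi> v) \<longleftrightarrow>
     removable (C W) ((\<eta> \<circ> \<phi>)) v" for v W
    by (simp add: nbrs C card image_Int[OF inj, symmetric])
  show ?thesis
  proof -
    have bex: "(\<exists>v\<in>\<phi> ` W. Q v) \<longleftrightarrow> (\<exists>v\<in>W. Q (\<phi> v))" for W Q by blast
    show ?thesis unfolding burnable_def all_subset_image image_is_empty bex cond ..
  qed
qed

lemma burnable_far_affine:
  "c * c = 1 \<Longrightarrow> burnable (far (s * c)) (affine c t ` V) \<eta> \<longleftrightarrow> burnable (far s) V (\<eta> \<circ> affine c t)"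
  by (rule burnable_transport) (auto simp: bij_affine adj_affine far_affine)

lemma burnable_uminus_affine:
  "c * c = 1 \<Longrightarrow> burnable uminus (affine c t ` V) \<eta> \<longleftrightarrow> burnable uminus V (\<eta> \<circ> affine c t)"
  by (rule burnable_transport) (auto simp: bij_affine adj_affine bij_image_Compl_eq)

definition letters :: "('a \<Rightarrow> int) set" where
  "letters = (\<Pi>\<^sub>E x\<in>V\<^sub>G. {1..int (out_degree (with_proj G) x) + 2})"

definition full_letter :: "'a \<Rightarrow> int" where
  "full_letter = (\<lambda>x\<in>V\<^sub>G. int (out_degree (with_proj G) x) + 2)"

definition config :: "('a \<Rightarrow> int) list \<Rightarrow> 'a \<times> int \<Rightarrow> int" where
  "config w = (\<lambda>(x, j). (w ! nat j) x)"

definition strip :: "nat \<Rightarrow> ('a \<times> int) set" where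
  "strip n = V\<^sub>G \<times> {0..<int n}"

definition burnable_word :: "(('a \<times> int) set \<Rightarrow> ('a \<times> int) set) \<Rightarrow> ('a \<Rightarrow> int) list \<Rightarrow> bool" where
  "burnable_word C w \<longleftrightarrow> burnable C (strip (length w)) (config w)"

lemma finite_letters: "finite letters"
  unfolding letters_def by (intro finite_PiE pair_finite_verts) auto

lemma full_letter: "full_letter \<in> letters"
  by (auto simp: letters_def full_letter_def)

lemma letter_le: "c \<in> letters \<Longrightarrow> x \<in> V\<^sub>G \<Longrightarrow> c x \<le> int (card (nbrs (x, k)))"
  unfolding letters_def by (drule (1) PiE_mem) (simp add: card_nbrs)

lemma full_letter_eq: "x \<in> V\<^sub>G \<Longrightarrow> full_letter x = int (card (nbrs (x, k)))"
  by (simp add: full_letter_def card_nbrs)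

lemma burnable_word_update:
  assumes w: "set w \<subseteq> letters" and i: "i < length w" and b: "burnable_word C w"
  shows "burnable_word C (w[i := full_letter])"
  unfolding burnable_word_def length_list_update
proof (rule burnable_mono[OF b[unfolded burnable_word_def]])
  fix v assume "v \<in> strip (length w)"
  then obtain x j where v: "v = (x, j)" "x \<in> V\<^sub>G" "nat j < length w" by (auto simp: strip_def)
  then have "w ! nat j \<in> letters" using w nth_mem by blast
  then show "config w v \<le> config (w[i := full_letter]) v"
    using v i letter_le[of "w ! nat j" x 0] full_letter_eq[of x 0]
    by (cases "nat j = i") (auto simp: config_def)
qed

lemma affine_strip: "affine 1 t ` strip n = V\<^sub>G \<times> {t..<t + int n}"
proof (rule set_eqI)
  fix u
  show "u \<in> affine 1 t ` strip n \<longleftrightarrow> u \<in> V\<^sub>G \<times> {t..<t + int n}"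
  proof
    assume "u \<in> V\<^sub>G \<times> {t..<t + int n}"
    then have "u = affine 1 t (fst u, snd u - t)" "(fst u, snd u - t) \<in> strip n"
      by (auto simp: affine_def strip_def)
    then show "u \<in> affine 1 t ` strip n" by blast
  qed (auto simp: affine_def strip_def)
qed

lemma strip_append:
  "strip (length (x @ c # y)) = strip (length x) \<union> V\<^sub>G \<times> {int (length x)} \<union> affine 1 (int (length x) + 1) ` strip (length y)"
  unfolding affine_strip by (auto simp: strip_def)

lemma config_append1: "v \<in> strip (length x) \<Longrightarrow> config (x @ y) v = config x v"
  by (auto simp: strip_def config_def nth_append nat_less_iff)

lemma config_append2:
  assumes "v \<in> strip (length y)"
  shows "(config (x @ c # y) \<circ> affine 1 (int (length x) + 1)) v = config y v"
proof -
  obtain z j where v: "v = (z, j)" "0 \<le> j" using assms by (auto simp: strip_def)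
  have "nat (j + (int (length x) + 1)) = length x + Suc (nat j)" using v by linarith
  then show ?thesis by (simp add: v config_def affine_def nth_append)
qed

lemma full_column_word:
  assumes x: "set x \<subseteq> letters" and y: "set y \<subseteq> letters"
  shows "full_column_in_segment G 1 (int (length x)) (strip (length x))
    (affine 1 (int (length x) + 1) ` strip (length y)) (config (x @ full_letter # y))"
proof unfold_locales
  fix v assume v: "v \<in> strip (length x) \<union> affine 1 (int (length x) + 1) ` strip (length y)"
  then have "v \<in> strip (length (x @ full_letter # y))" unfolding strip_append by blast
  then obtain z j where z: "v = (z, j)" "z \<in> V\<^sub>G" "nat j < length (x @ full_letter # y)"
    by (auto simp: strip_def simp del: length_append length_Cons)
  then have "(x @ full_letter # y) ! nat j \<in> set (x @ full_letter # y)" by (intro nth_mem)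
  then have "(x @ full_letter # y) ! nat j \<in> letters" using x y full_letter by auto
  then show "config (x @ full_letter # y) v \<le> int (card (nbrs v))"
    using letter_le z by (simp add: config_def)
qed (auto simp: affine_strip, auto simp: strip_def config_def full_letter_eq)

lemma burnable_word_part2:
  assumes "\<And>t V \<eta>. burnable C (affine 1 t ` V) \<eta> \<longleftrightarrow> burnable C V (\<eta> \<circ> affine 1 t)"
  shows "burnable C (affine 1 (int (length x) + 1) ` strip (length y)) (config (x @ c # y)) \<longleftrightarrow> burnable_word C y"
  unfolding assms burnable_word_def by (rule burnable_cong) (rule config_append2)

lemma burnable_word_part1:
  "burnable C (strip (length x)) (config (x @ y)) \<longleftrightarrow> burnable_word C x"
  unfolding burnable_word_def by (rule burnable_cong) (rule config_append1)

lemma far_shift: "burnable (far s) (affine 1 t ` V) \<eta> \<longleftrightarrow> burnable (far s) V (\<eta> \<circ> affine 1 t)"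
  using burnable_far_affine[of 1 s t] by simp

lemma uminus_shift: "burnable uminus (affine 1 t ` V) \<eta> \<longleftrightarrow> burnable uminus V (\<eta> \<circ> affine 1 t)"
  using burnable_uminus_affine[of 1 t] by simp

lemma burnable_word_far_split:
  assumes x: "set x \<subseteq> letters" and y: "set y \<subseteq> letters" and s: "s = 1 \<or> s = - 1"
  shows "burnable_word (far s) (x @ full_letter # y) \<longleftrightarrow> burnable_word (far s) x \<and> burnable_word (far s) y"
proof -
  interpret F: full_column_in_segment G 1 "int (length x)" "strip (length x)"
    "affine 1 (int (length x) + 1) ` strip (length y)" "config (x @ full_letter # y)"
    by (rule full_column_word[OF x y])
  interpret R: full_column G "- 1" "int (length x)" "affine 1 (int (length x) + 1) ` strip (length y)"
    "strip (length x)" "config (x @ full_letter # y)"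
    by (rule F.reversed)
  have comm: "A \<union> B \<union> C = C \<union> B \<union> (A :: ('a \<times> int) set)" for A B C by blast
  have "burnable_word (far s) (x @ full_letter # y) \<longleftrightarrow>
      burnable (far s) (strip (length x)) (config (x @ full_letter # y)) \<and>
      burnable (far s) (affine 1 (int (length x) + 1) ` strip (length y)) (config (x @ full_letter # y))"
    unfolding burnable_word_def strip_append
  proof (rule disjE[OF s])
    assume "s = 1"
    then show "burnable (far s) (strip (length x) \<union> V\<^sub>G \<times> {int (length x)} \<union> affine 1 (int (length x) + 1) ` strip (length y)) (config (x @ full_letter # y)) \<longleftrightarrow>
      burnable (far s) (strip (length x)) (config (x @ full_letter # y)) \<and>
      burnable (far s) (affine 1 (int (length x) + 1) ` strip (length y)) (config (x @ full_letter # y))"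
      by (simp only: F.burnable_far_iff)
  next
    assume "s = - 1"
    then show "burnable (far s) (strip (length x) \<union> V\<^sub>G \<times> {int (length x)} \<union> affine 1 (int (length x) + 1) ` strip (length y)) (config (x @ full_letter # y)) \<longleftrightarrow>
      burnable (far s) (strip (length x)) (config (x @ full_letter # y)) \<and>
      burnable (far s) (affine 1 (int (length x) + 1) ` strip (length y)) (config (x @ full_letter # y))"
      by (simp only: comm[of "strip (length x)"] R.burnable_far_iff conj_commute)
  qed
  then show ?thesis
    by (simp only: burnable_word_part1 burnable_word_part2[OF far_shift])
qed

lemma burnable_word_uminus_split:
  assumes x: "set x \<subseteq> letters" and y: "set y \<subseteq> letters"
  shows "burnable_word uminus (x @ full_letter # y) \<longleftrightarrow> burnable_word uminus x \<and> burnable_word uminus y \<and>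
    (burnable_word (far 1) x \<or> burnable_word (far (- 1)) y)"
proof -
  interpret F: full_column_in_segment G 1 "int (length x)" "strip (length x)"
    "affine 1 (int (length x) + 1) ` strip (length y)" "config (x @ full_letter # y)"
    by (rule full_column_word[OF x y])
  show ?thesis
    unfolding burnable_word_def[of _ "x @ full_letter # y"] strip_append F.burnable_uminus_iff
      burnable_word_part1 burnable_word_part2[OF far_shift] burnable_word_part2[OF uminus_shift] ..
qed

text \<open>The reflection of the strip onto itself sends column \<open>j\<close> to
  \<open>length w - 1 - j\<close> and swaps the ends. It yields the equality of the left and right
  counts.\<close>

lemma burnable_word_rev:
  "burnable_word (far (- 1)) (rev w) \<longleftrightarrow> burnable_word (far 1) w"
proof -
  let ?n = "int (length w)"
  have img: "affine (- 1) (?n - 1) ` strip (length w) = strip (length w)"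
  proof (rule set_eqI)
    fix u
    show "u \<in> affine (- 1) (?n - 1) ` strip (length w) \<longleftrightarrow> u \<in> strip (length w)"
    proof
      assume "u \<in> strip (length w)"
      then have "u = affine (- 1) (?n - 1) (affine (- 1) (?n - 1) u)" "affine (- 1) (?n - 1) u \<in> strip (length w)"
        by (auto simp: affine_def strip_def)
      then show "u \<in> affine (- 1) (?n - 1) ` strip (length w)" by blast
    qed (auto simp: affine_def strip_def)
  qed
  have "burnable_word (far (- 1)) (rev w) \<longleftrightarrow>
      burnable (far (1 * - 1)) (affine (- 1) (?n - 1) ` strip (length w)) (config (rev w))"
    by (simp add: burnable_word_def img)
  also have "\<dots> \<longleftrightarrow> burnable (far 1) (strip (length w)) (config (rev w) \<circ> affine (- 1) (?n - 1))"
    by (rule burnable_far_affine) simp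
  also have "\<dots> \<longleftrightarrow> burnable_word (far 1) w"
    unfolding burnable_word_def
  proof (rule burnable_cong)
    fix v assume "v \<in> strip (length w)"
    then obtain x j where v: "v = (x, j)" "0 \<le> j" "j < ?n" by (auto simp: strip_def)
    then have "nat (?n - 1 - j) = length w - Suc (nat j)" "nat j < length w" by linarith+
    then show "(config (rev w) \<circ> affine (- 1) (?n - 1)) v = config w v"
      by (simp add: v(1) config_def affine_def rev_nth algebra_simps)
  qed
  finally show ?thesis .
qed

lemma strip_0: "strip 0 = {}" by (simp add: strip_def)

text \<open>A single column of height one less than maximal burns from both ends, but not from one end.\<close>

lemma defect_letter:
  "\<exists>c\<in>letters - {full_letter}. burnable_word uminus [c] \<and> \<not> burnable_word (far 1) [c]"
proof -
  define c where "c = (\<lambda>x\<in>V\<^sub>G. int (out_degree (with_proj G) x) + 1)"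
  have c: "c x = int (card (nbrs (x, k))) - 1" if "x \<in> V\<^sub>G" for x k
    using that by (simp add: c_def card_nbrs)
  obtain x0 where x0: "x0 \<in> V\<^sub>G" using verts_nonempty by blast
  have "c x0 \<noteq> full_letter x0" using x0 by (simp add: c_def full_letter_def)
  then have "c \<noteq> full_letter" by auto
  moreover have "c \<in> letters" by (auto simp: c_def letters_def)
  ultimately have "c \<in> letters - {full_letter}" by simp
  moreover have strip: "strip (length [c]) = V\<^sub>G \<times> {0}" by (auto simp: strip_def)
  have conf: "config [c] (x, 0) = c x" for x by (simp add: config_def)
  have "burnable_word uminus [c]"
    unfolding burnable_word_def strip burnable_def
  proof (intro allI impI)
    fix W assume W: "W \<subseteq> V\<^sub>G \<times> {0::int}" "W \<noteq> {}"
    then obtain x where x: "(x, 0) \<in> W" "x \<in> V\<^sub>G" by auto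
    \<comment> \<open>Both horizontal neighbours are outside \<open>W\<close>, and together they
      outweigh the missing unit of height.\<close>
    have "{(x, - 1), (x, 1)} \<subseteq> nbrs (x, 0) \<inter> - W" using W x by (auto simp: nbrs_eq)
    then have "card {(x, - 1 :: int), (x, 1)} \<le> card (nbrs (x, 0) \<inter> - W)"
      using finite_nbrs by (intro card_mono) auto
    then have "removable (- W) (config [c]) (x, 0)"
      using c[OF x(2), of 0] by (simp add: conf)
    then show "\<exists>v\<in>W. removable (- W) (config [c]) v"
      using x(1) by blast
  qed
  moreover have "\<not> burnable_word (far 1) [c]"
  proof
    assume "burnable_word (far 1) [c]"
    then have b: "burnable (far 1) (V\<^sub>G \<times> {0}) (config [c])" by (simp only: burnable_word_def strip)
    have neg: "snd u < 0" if "u \<in> far 1 (V\<^sub>G \<times> {0})" for u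
      using that
    proof (induction rule: far.induct)
      case (base y j)
      then show ?case using x0 by auto
    next
      case (step u v)
      then have "snd v \<noteq> 0" using adj_verts[OF step(2)] by (cases v) auto
      then show ?case using adj_pos(1)[OF step(2), of 1] step.IH by simp
    qed
    obtain v where v: "v \<in> V\<^sub>G \<times> {0}"
      "removable (far 1 (V\<^sub>G \<times> {0})) (config [c]) v"
      by (rule burnableD[OF b order_refl]) (use x0 in auto)
    then obtain x where x: "v = (x, 0)" "x \<in> V\<^sub>G" by auto
    \<comment> \<open>The fire from the left offers one burnt neighbour only, which just balances
      the missing unit, whereas the inequality is strict.\<close>
    have "nbrs v \<inter> far 1 (V\<^sub>G \<times> {0}) \<subseteq> {(x, - 1)}"
      using neg x by (fastforce simp: nbrs_eq)
    then have "card (nbrs v \<inter> far 1 (V\<^sub>G \<times> {0})) \<le> card {(x, - 1 :: int)}"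
      by (intro card_mono) auto
    then show False using v(2) c[OF x(2), of 0] by (simp add: x(1) conf)
  qed
  ultimately show ?thesis by blast
qed

lemma renewal_words_far:
  assumes s: "s = 1 \<or> s = - 1"
  shows "renewal_words letters full_letter (burnable_word (far s))"
proof unfold_locales
  show "burnable_word (far s) []" by (simp add: burnable_word_def burnable_def strip_0)
qed (rule finite_letters full_letter burnable_word_update burnable_word_far_split[OF _ _ s]; assumption)+

sublocale sandpile: two_sided_words letters full_letter
  "burnable_word (far 1)" "burnable_word (far (- 1))" "burnable_word uminus"
proof -
  interpret L: renewal_words letters full_letter "burnable_word (far 1)" by (rule renewal_words_far) simp
  interpret R: renewal_words letters full_letter "burnable_word (far (- 1))" by (rule renewal_words_far) simp
  show "two_sided_words letters full_letter
    (burnable_word (far 1)) (burnable_word (far (- 1))) (burnable_word uminus)"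
  proof unfold_locales
    fix n
    have "R.count n = (\<Sum>w\<in>words letters n. of_bool (burnable_word (far (- 1)) (rev w)))"
      unfolding R.count_def by (rule sum_words_rev[symmetric])
    then show "L.count n = R.count n" by (simp add: L.count_def burnable_word_rev)
  next
    show "\<exists>w. set w \<subseteq> letters - {full_letter} \<and> burnable_word uminus w \<and> \<not> burnable_word (far 1) w"
    proof -
      obtain c where "c \<in> letters - {full_letter}" "burnable_word uminus [c]" "\<not> burnable_word (far 1) [c]"
        using defect_letter by blast
      then show ?thesis by (intro exI[of _ "[c]"]) auto
    qed
  qed (use finite_letters full_letter burnable_word_update burnable_word_uminus_split burnable_far_imp_uminus in \<open>auto simp: burnable_word_def\<close>)
qed

definition word_of :: "int \<Rightarrow> int \<Rightarrow> ('a \<times> int \<Rightarrow> int) \<Rightarrow> ('a \<Rightarrow> int) list" where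
  "word_of n m \<eta> = map (\<lambda>j. \<lambda>x\<in>V\<^sub>G. \<eta> (x, j)) [n..m]"

lemma stable_configs_eq:
  "stable_configs G (segment G n m) = (\<Pi>\<^sub>E (x, j)\<in>V\<^sub>G \<times> {n..m}. {1..int (out_degree (with_proj G) x) + 2})"
  unfolding stable_configs_def segment_def by (rule PiE_cong) (auto simp: toppling_matrix_def)

lemma length_word_of: "length (word_of n m \<eta>) = nat (m - n + 1)"
  by (simp add: word_of_def)

lemma nth_word_of:
  assumes "n \<le> j" "j \<le> m"
  shows "word_of n m \<eta> ! nat (j - n) = (\<lambda>x\<in>V\<^sub>G. \<eta> (x, j))"
proof -
  have "[n..m] ! nat (j - n) = n + int (nat (j - n))" using assms by (intro nth_upto) auto
  then show ?thesis using assms by (simp add: word_of_def)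
qed

lemma bij_word_of:
  "bij_betw (word_of n m) (stable_configs G (segment G n m)) (words letters (nat (m - n + 1)))"
proof (rule bij_betw_byWitness[where f' = "\<lambda>w. \<lambda>(x, j)\<in>V\<^sub>G \<times> {n..m}. (w ! nat (j - n)) x"])
  show "\<forall>\<eta>\<in>stable_configs G (segment G n m). (\<lambda>(x, j)\<in>V\<^sub>G \<times> {n..m}. (word_of n m \<eta> ! nat (j - n)) x) = \<eta>"
  proof
    fix \<eta> assume "\<eta> \<in> stable_configs G (segment G n m)"
    then have "\<eta> \<in> extensional (V\<^sub>G \<times> {n..m})" by (simp add: stable_configs_eq PiE_iff)
    then show "(\<lambda>(x, j)\<in>V\<^sub>G \<times> {n..m}. (word_of n m \<eta> ! nat (j - n)) x) = \<eta>"
      by (intro extensionalityI[where A = "V\<^sub>G \<times> {n..m}"]) (auto simp: nth_word_of)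
  qed
  show "\<forall>w\<in>words letters (nat (m - n + 1)). word_of n m (\<lambda>(x, j)\<in>V\<^sub>G \<times> {n..m}. (w ! nat (j - n)) x) = w"
  proof
    fix w assume w: "w \<in> words letters (nat (m - n + 1))"
    show "word_of n m (\<lambda>(x, j)\<in>V\<^sub>G \<times> {n..m}. (w ! nat (j - n)) x) = w"
    proof (rule nth_equalityI)
      fix i assume "i < length (word_of n m (\<lambda>(x, j)\<in>V\<^sub>G \<times> {n..m}. (w ! nat (j - n)) x))"
      then have i: "i < nat (m - n + 1)" by (simp only: length_word_of)
      then have "w ! i \<in> letters" using w nth_mem[of i w] by (auto simp: words_def)
      then have ext: "w ! i \<in> extensional V\<^sub>G" by (simp add: letters_def PiE_iff)
      have "word_of n m (\<lambda>(x, j)\<in>V\<^sub>G \<times> {n..m}. (w ! nat (j - n)) x) ! nat ((n + int i) - n)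
          = (\<lambda>x\<in>V\<^sub>G. (w ! i) x)"
        using i by (subst nth_word_of) (auto simp: restrict_def fun_eq_iff)
      then show "word_of n m (\<lambda>(x, j)\<in>V\<^sub>G \<times> {n..m}. (w ! nat (j - n)) x) ! i = w ! i"
        by (simp add: extensional_restrict[OF ext])
    qed (use w in \<open>simp add: length_word_of words_def\<close>)
  qed
  show "word_of n m ` stable_configs G (segment G n m) \<subseteq> words letters (nat (m - n + 1))"
  proof (rule image_subsetI)
    fix \<eta> assume "\<eta> \<in> stable_configs G (segment G n m)"
    then have "(\<lambda>x\<in>V\<^sub>G. \<eta> (x, j)) \<in> letters" if "n \<le> j" "j \<le> m" for j
      using that by (force simp: stable_configs_eq letters_def)
    then show "word_of n m \<eta> \<in> words letters (nat (m - n + 1))"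
      by (auto simp: words_def length_word_of) (auto simp: word_of_def)
  qed
  show "(\<lambda>w. \<lambda>(x, j)\<in>V\<^sub>G \<times> {n..m}. (w ! nat (j - n)) x) ` words letters (nat (m - n + 1))
      \<subseteq> stable_configs G (segment G n m)"
  proof (rule image_subsetI)
    fix w assume w: "w \<in> words letters (nat (m - n + 1))"
    have "w ! nat (j - n) \<in> letters" if "n \<le> j" "j \<le> m" for j
    proof -
      have "nat (j - n) < length w" using w that by (auto simp: words_def)
      then show ?thesis using w nth_mem by (auto simp: words_def)
    qed
    then show "(\<lambda>(x, j)\<in>V\<^sub>G \<times> {n..m}. (w ! nat (j - n)) x) \<in> stable_configs G (segment G n m)"
      by (fastforce simp: stable_configs_eq letters_def)
  qed
qed

lemma burnable_word_of:
  assumes "\<And>t V \<eta>. burnable C (affine 1 t ` V) \<eta> \<longleftrightarrow> burnable C V (\<eta> \<circ> affine 1 t)"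
  shows "burnable_word C (word_of n m \<eta>) \<longleftrightarrow> burnable C (segment G n m) \<eta>"
proof -
  have "segment G n m = affine 1 n ` strip (nat (m - n + 1))"
    unfolding affine_strip segment_def by auto
  then have "burnable C (segment G n m) \<eta> \<longleftrightarrow> burnable C (strip (nat (m - n + 1))) (\<eta> \<circ> affine 1 n)"
    by (simp only: assms)
  also have "\<dots> \<longleftrightarrow> burnable_word C (word_of n m \<eta>)"
    unfolding burnable_word_def length_word_of
  proof (rule burnable_cong)
    fix v assume "v \<in> strip (nat (m - n + 1))"
    then obtain x j where v: "v = (x, j)" "x \<in> V\<^sub>G" "0 \<le> j" "j \<le> m - n"
      by (auto simp: strip_def split: if_splits)
    then show "(\<eta> \<circ> affine 1 n) v = config (word_of n m \<eta>) v"
      using nth_word_of[of n "j + n" m \<eta>] by (simp add: config_def affine_def)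
  qed
  finally show ?thesis by simp
qed

lemma word_of_window:
  assumes "n \<le> - int k" "int k \<le> m"
  shows "take (2 * k + 1) (drop (nat (- int k - n)) (word_of n m \<eta>)) =
    word_of (- int k) (int k) (restrict \<eta> (segment G (- int k) (int k)))"
proof (rule nth_equalityI)
  show "length (take (2 * k + 1) (drop (nat (- int k - n)) (word_of n m \<eta>))) =
    length (word_of (- int k) (int k) (restrict \<eta> (segment G (- int k) (int k))))"
    using assms by (simp add: length_word_of)
  fix i assume "i < length (take (2 * k + 1) (drop (nat (- int k - n)) (word_of n m \<eta>)))"
  then have i: "i < 2 * k + 1" by simp
  let ?j = "int i - int k"
  have "take (2 * k + 1) (drop (nat (- int k - n)) (word_of n m \<eta>)) ! i = word_of n m \<eta> ! (nat (- int k - n) + i)"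
    using i assms by (simp add: length_word_of)
  also have "nat (- int k - n) + i = nat (?j - n)" using assms by linarith
  also have "word_of n m \<eta> ! nat (?j - n) = (\<lambda>x\<in>V\<^sub>G. \<eta> (x, ?j))"
    using i assms by (intro nth_word_of) auto
  also have "\<dots> = (\<lambda>x\<in>V\<^sub>G. restrict \<eta> (segment G (- int k) (int k)) (x, ?j))"
    using i by (auto simp: segment_def restrict_def fun_eq_iff)
  also have "\<dots> = word_of (- int k) (int k) (restrict \<eta> (segment G (- int k) (int k))) ! nat (?j - - int k)"
    using i by (intro nth_word_of[symmetric]) auto
  finally show "take (2 * k + 1) (drop (nat (- int k - n)) (word_of n m \<eta>)) ! i =
      word_of (- int k) (int k) (restrict \<eta> (segment G (- int k) (int k))) ! i"
    by simp
qed

lemma restrict_stable: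
  assumes "\<eta> \<in> stable_configs G (segment G n m)" "n \<le> - int k" "int k \<le> m"
  shows "restrict \<eta> (segment G (- int k) (int k)) \<in> stable_configs G (segment G (- int k) (int k))"
  using assms by (force simp: stable_configs_def segment_def)

abbreviation burnable_set :: "(('a \<times> int) set \<Rightarrow> ('a \<times> int) set) \<Rightarrow> int \<Rightarrow> int \<Rightarrow> ('a \<times> int \<Rightarrow> int) set" where
  "burnable_set C n m \<equiv> {\<eta> \<in> stable_configs G (segment G n m). burnable C (segment G n m) \<eta>}"

abbreviation window_event :: "(('a \<times> int) set \<Rightarrow> ('a \<times> int) set) \<Rightarrow> int \<Rightarrow> int \<Rightarrow> nat \<Rightarrow> ('a \<times> int \<Rightarrow> int) set \<Rightarrow> ('a \<times> int \<Rightarrow> int) set" where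
  "window_event C n m k A \<equiv> {\<eta> \<in> stable_configs G (segment G n m). burnable C (segment G n m) \<eta> \<and>
     restrict \<eta> (segment G (- int k) (int k)) \<in> A}"

text \<open>The window \<open>{- k..k}\<close> becomes the \<open>2 * k + 1\<close> letters after
  the first \<open>- k - n\<close>. The hypothesis \<open>shift\<close> is what makes the count
  independent of the column at which the word starts.\<close>

lemma card_burnable_window:
  assumes shift: "\<And>t V \<eta>. burnable C (affine 1 t ` V) \<eta> \<longleftrightarrow> burnable C V (\<eta> \<circ> affine 1 t)"
    and sep: "separated_words letters full_letter (burnable_word C)"
    and A: "A \<subseteq> stable_configs G (segment G (- int k) (int k))" and nm: "n \<le> - int k" "int k \<le> m"
  shows "real (card (window_event C n m k A)) =
    separated_words.window_total letters (burnable_word C) (word_of (- int k) (int k) ` A)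
      (nat (- int k - n)) (nat (m - int k))"
proof -
  interpret P: separated_words letters full_letter "burnable_word C" by (rule sep)
  let ?W = "word_of (- int k) (int k)"
  have bijk: "bij_betw ?W (stable_configs G (segment G (- int k) (int k))) (words letters (2 * k + 1))"
  proof -
    have "nat (int k - - int k + 1) = 2 * k + 1" by linarith
    then show ?thesis using bij_word_of[of "- int k" "int k"] by simp
  qed
  then have sub: "?W ` A \<subseteq> words letters (2 * k + 1)" using A unfolding bij_betw_def by blast
  let ?B = "{w \<in> words letters (nat (m - n + 1)). burnable_word C w \<and> take (2 * k + 1) (drop (nat (- int k - n)) w) \<in> ?W ` A}"
  have "bij_betw (word_of n m) (window_event C n m k A) ?B"
  proof (rule bij_betw_subset[OF bij_word_of])
    have mem: "?W (restrict \<eta> (segment G (- int k) (int k))) \<in> ?W ` A \<longleftrightarrow> restrict \<eta> (segment G (- int k) (int k)) \<in> A"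
      if "\<eta> \<in> stable_configs G (segment G n m)" for \<eta>
      using inj_on_image_mem_iff[OF bij_betw_imp_inj_on[OF bijk] restrict_stable[OF that nm] A] .
    show "word_of n m ` (window_event C n m k A) = ?B"
      by (rule image_Collect_transfer[OF bij_betw_imp_surj_on[OF bij_word_of]])
         (simp only: burnable_word_of[OF shift] word_of_window[OF nm] mem)
  qed auto
  then have "card (window_event C n m k A) = card ?B"
    by (rule bij_betw_same_card)
  moreover have "nat (m - n + 1) = nat (- int k - n) + (2 * k + 1) + nat (m - int k)" using nm by linarith
  ultimately show ?thesis
    by (simp only: P.window_total_card[OF sub])
qed

lemma card_burnable:
  assumes shift: "\<And>t V \<eta>. burnable C (affine 1 t ` V) \<eta> \<longleftrightarrow> burnable C V (\<eta> \<circ> affine 1 t)"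
    and sep: "separated_words letters full_letter (burnable_word C)"
  shows "real (card (burnable_set C n m)) =
    separated_words.count letters (burnable_word C) (nat (m - n + 1))"
proof -
  interpret P: separated_words letters full_letter "burnable_word C" by (rule sep)
  have "bij_betw (word_of n m) (burnable_set C n m)
     {w \<in> words letters (nat (m - n + 1)). burnable_word C w}"
    by (rule bij_betw_subset[OF bij_word_of])
       (auto intro!: image_Collect_transfer bij_betw_imp_surj_on[OF bij_word_of] simp: burnable_word_of[OF shift])
  from bij_betw_same_card[OF this] show ?thesis
    using finite_letters by (simp add: P.count_def Int_def)
qed

end

section \<open>Components of the complement\<close>

context connected_pair_graph
begin

definition reach :: "('a \<times> int) set \<Rightarrow> 'a \<times> int \<Rightarrow> 'a \<times> int \<Rightarrow> bool" where
  "reach W u v \<longleftrightarrow> u \<rightarrow>\<^sup>*\<^bsub>with_proj (ladder G) \<restriction> (pverts (ladder G) - W)\<^esub> v"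

lemma reach_def': "reach W u v \<longleftrightarrow>
  (u, v) \<in> rtrancl_on (V\<^sub>G \<times> UNIV - W) {(a, b). adj a b \<and> a \<in> V\<^sub>G \<times> UNIV - W \<and> b \<in> V\<^sub>G \<times> UNIV - W}"
proof -
  let ?H = "with_proj (ladder G) \<restriction> (pverts (ladder G) - W)"
  have "verts ?H = V\<^sub>G \<times> UNIV - W" by (simp add: ladder_def)
  moreover have "arcs_ends ?H = {(a, b). adj a b \<and> a \<in> V\<^sub>G \<times> UNIV - W \<and> b \<in> V\<^sub>G \<times> UNIV - W}"
    by (auto simp: arcs_ends_def arc_to_ends_def induce_subgraph_def ladder_def)
  ultimately show ?thesis by (simp only: reach_def reachable_def)
qed

lemma reach_refl: "fst u \<in> V\<^sub>G \<Longrightarrow> u \<notin> W \<Longrightarrow> reach W u u"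
  unfolding reach_def' by (rule rtrancl_on_refl) (cases u, simp)

lemma reach_not_in: "reach W u v \<Longrightarrow> u \<notin> W \<and> v \<notin> W \<and> fst u \<in> V\<^sub>G \<and> fst v \<in> V\<^sub>G"
  unfolding reach_def' by (frule in_rtrancl_on_in_F(1), drule in_rtrancl_on_in_F(2)) auto

lemma reach_step:
  assumes "reach W u v" "adj v w" "w \<notin> W"
  shows "reach W u w"
proof -
  have "v \<in> V\<^sub>G \<times> UNIV - W" "w \<in> V\<^sub>G \<times> UNIV - W"
    using reach_not_in[OF assms(1)] adj_verts[OF assms(2)] assms(3) by (cases v; cases w; simp)+
  then show ?thesis
    using assms(1,2) unfolding reach_def' by (auto intro: rtrancl_on_into_rtrancl_on)
qed

lemma reach_induct [consumes 1, case_names refl step]: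
  assumes "reach W u v" "P u" "\<And>v w. reach W u v \<Longrightarrow> P v \<Longrightarrow> adj v w \<Longrightarrow> w \<notin> W \<Longrightarrow> P w"
  shows "P v"
  using assms(1) unfolding reach_def'
proof (induction rule: rtrancl_on_induct)
  case base
  show ?case by (rule assms(2))
next
  case (step v w)
  then show ?case using assms(3)[of v w] by (simp add: reach_def')
qed

lemma reach_sym: "reach W u v \<Longrightarrow> reach W v u"
proof -
  have "sym {(a, b). adj a b \<and> a \<in> V\<^sub>G \<times> UNIV - W \<and> b \<in> V\<^sub>G \<times> UNIV - W}"
    by (rule symI) (auto dest: adj_sym)
  from rtrancl_on_sym[OF this, of "V\<^sub>G \<times> UNIV - W"]
  show "reach W u v \<Longrightarrow> reach W v u" unfolding reach_def' by (rule symD)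
qed

lemma reach_trans: "reach W u v \<Longrightarrow> reach W v w \<Longrightarrow> reach W u w"
  unfolding reach_def' by (rule rtrancl_on_trans)

lemma far_closed: "reach W u v \<Longrightarrow> u \<in> far s W \<Longrightarrow> v \<in> far s W"
  by (induction rule: reach_induct) (auto intro: far.step)

lemma column_closed:
  assumes D: "\<And>u v. u \<in> D \<Longrightarrow> adj u v \<Longrightarrow> v \<notin> W \<Longrightarrow> v \<in> D"
    and x: "x \<in> V\<^sub>G" "(x, j) \<in> D" and y: "y \<in> V\<^sub>G" and free: "\<And>z. (z, j) \<notin> W"
  shows "(y, j) \<in> D"
proof (rule ccontr)
  assume "(y, j) \<notin> D"
  define X where "X = {z \<in> V\<^sub>G. (z, j) \<in> D}"
  have "X \<subseteq> V\<^sub>G" "X \<noteq> {}" "X \<noteq> V\<^sub>G" using x y \<open>(y, j) \<notin> D\<close> by (auto simp: X_def)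
  then obtain a b where "a \<in> X" "b \<in> V\<^sub>G - X" "(a, b) \<in> parcs G" by (rule cut_arc)
  then have "(a, j) \<in> D" "adj (a, j) (b, j)" "(b, j) \<notin> D" by (auto simp: X_def adj_iff)
  then show False using D free by blast
qed

text \<open>\<open>J\<close> collects the columns beyond all of \<open>W\<close>; it is nonempty as
  \<open>W\<close> is finite. These columns are connected to each other without meeting
  \<open>W\<close>, and every other site of \<open>far s W\<close> is linked to them by the steps
  that put it there.\<close>

lemma far_reach:
  assumes s: "s * s = 1" and finite: "finite W" and u: "u \<in> far s W" and v: "v \<in> far s W"
  shows "reach W u v"
proof -
  define J where "J = {j. \<forall>y i. (y, i) \<in> W \<longrightarrow> s * j < s * i}"
  have s': "s = 1 \<or> s = - 1" using s by (simp only: square_eq_1_iff)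
  have J_down: "i \<in> J" if "j \<in> J" "s * i \<le> s * j" for i j
    using that unfolding J_def by (auto intro: le_less_trans)
  have J_free: "(z, j) \<notin> W" if "j \<in> J" for z j using that by (auto simp: J_def)
  obtain x0 where x0: "x0 \<in> V\<^sub>G" using verts_nonempty by blast
  \<comment> \<open>A set closed under steps outside \<open>W\<close> that contains one site over
    \<open>J\<close> contains all of them: move along the row of \<open>x\<close> to column
    \<open>j\<close>, then inside that column, which is free of \<open>W\<close>.\<close>
  have key: "b \<in> D" if D: "\<And>u v. u \<in> D \<Longrightarrow> adj u v \<Longrightarrow> v \<notin> W \<Longrightarrow> v \<in> D"
    and a: "(x, i) \<in> D" "x \<in> V\<^sub>G" "i \<in> J" and b: "b = (y, j)" "y \<in> V\<^sub>G" "j \<in> J" for D b x i y j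
  proof -
    have down: "(x, i - s * int n) \<in> D" for n
    proof (induction n)
      case 0
      show ?case using a by simp
    next
      case (Suc n)
      have "adj (x, i - s * int n) (x, i - s * int (Suc n))"
        using s' a by (auto simp: adj_iff)
      moreover have "i - s * int (Suc n) \<in> J"
        by (rule J_down[OF a(3)]) (use s' in auto)
      ultimately show ?case using D[OF Suc] J_free by blast
    qed
    have up: "i + s * int n \<in> J \<Longrightarrow> (x, i + s * int n) \<in> D" for n
    proof (induction n)
      case 0
      show ?case using a by simp
    next
      case (Suc n)
      have "adj (x, i + s * int n) (x, i + s * int (Suc n))"
        using s' a by (auto simp: adj_iff)
      moreover have "i + s * int n \<in> J"
        by (rule J_down[OF Suc.prems]) (use s' in auto)
      ultimately show ?case using D[OF Suc.IH] J_free Suc.prems by blast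
    qed
    have "(x, j) \<in> D"
    proof (cases "s * j \<le> s * i")
      case True
      then have "j = i - s * int (nat (s * i - s * j))" using s' by auto
      then show ?thesis using down by metis
    next
      case False
      then have "j = i + s * int (nat (s * j - s * i))" using s' by auto
      then show ?thesis using up b(3) by metis
    qed
    then show ?thesis
      unfolding b(1)
      by (intro column_closed[of D W x j y]) (erule (2) D, rule a(2), assumption, rule b(2), rule J_free[OF b(3)])
  qed
  have "\<exists>j. j \<in> J"
  proof (cases "W = {}")
    case False
    define m where "m = Min ((\<lambda>v. s * snd v) ` W)"
    have "s * (s * (m - 1)) < s * i" if "(y, i) \<in> W" for y i
    proof -
      have "m \<le> s * i" unfolding m_def using finite that by (intro Min_le) force+
      then show ?thesis using s by (simp add: mult.assoc[symmetric])
    qed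
    then show ?thesis unfolding J_def by blast
  qed (auto simp: J_def)
  then obtain j0 where j0: "j0 \<in> J" by blast
  have "reach W (x0, j0) w" if "w \<in> far s W" for w
    using that
  proof (induction rule: far.induct)
    case (base x j)
    let ?D = "{w. reach W (x0, j0) w}"
    have 1: "v \<in> ?D" if "u \<in> ?D" "adj u v" "v \<notin> W" for u v
      using reach_step[of W "(x0, j0)" u v] that by simp
    have 2: "(x0, j0) \<in> ?D"
      using reach_refl[of "(x0, j0)"] x0 J_free[OF j0] by simp
    have 3: "j \<in> J" using base(2) by (auto simp: J_def)
    have "(x, j) \<in> ?D"
      by (rule key[of ?D x0 j0 "(x, j)" x j]) (erule (2) 1, rule 2, rule x0, rule j0, rule refl, rule base(1), rule 3)
    then show ?case by simp
  next
    case (step u v)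
    show ?case by (rule reach_step[OF step.IH step(2,3)])
  qed
  note * = this
  show ?thesis by (rule reach_trans[OF reach_sym[OF *[OF u]] *[OF v]])
qed

lemma complement_components_iff:
  "C \<in> complement_components G W \<longleftrightarrow> C \<noteq> {} \<and> (\<forall>u\<in>C. \<forall>v\<in>C. reach W u v) \<and>
    (\<forall>u\<in>C. \<forall>v. v \<notin> C \<longrightarrow> \<not> reach W u v \<or> \<not> reach W v u)"
  unfolding complement_components_def pre_digraph.sccs_verts_def reach_def by simp

text \<open>Components are classes of \<open>reach\<close>, and \<open>far s W\<close> is one of
  them by \<open>far_reach\<close> and \<open>far_closed\<close>. A component containing any
  nonempty part of it therefore equals it, which gives the uniqueness that the definite descriptions
  require.\<close>

lemma far_component:
  assumes s: "s * s = 1" and finite: "finite W"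
    and B: "B \<subseteq> far s W" "B \<noteq> {}"
  shows "C \<in> complement_components G W \<and> B \<subseteq> C \<longleftrightarrow> C = far s W"
proof
  assume "C = far s W"
  then show "C \<in> complement_components G W \<and> B \<subseteq> C"
    using B far_reach[OF s finite] far_closed[of W _ _ s] unfolding complement_components_iff by blast
next
  assume C: "C \<in> complement_components G W \<and> B \<subseteq> C"
  then obtain b where b: "b \<in> C" "b \<in> far s W" using B by blast
  show "C = far s W"
  proof (rule antisym)
    show "C \<subseteq> far s W"
      using C b far_closed[of W b _ s] unfolding complement_components_iff by blast
    show "far s W \<subseteq> C"
    proof
      fix v assume v: "v \<in> far s W"
      have "reach W b v" "reach W v b" using far_reach[OF s finite] b(2) v by blast+
      then show "v \<in> C" using C b(1) unfolding complement_components_iff by blast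
    qed
  qed
qed

lemma left_component_eq:
  assumes "finite W"
  shows "left_component G W = far 1 W"
proof -
  \<comment> \<open>\<open>min k\<close> keeps the half-strip inside the given one up to
    \<open>k\<close>, the other bound places it beyond \<open>W\<close>; inserting \<open>k\<close>
    covers the case of an empty \<open>W\<close>.\<close>
  have lower: "V\<^sub>G \<times> {..min k (Min (insert k (snd ` W)) - 1)} \<subseteq> far 1 W" for k
  proof
    fix v assume "v \<in> V\<^sub>G \<times> {..min k (Min (insert k (snd ` W)) - 1)}"
    then obtain x j where v: "v = (x, j)" "x \<in> V\<^sub>G" "j \<le> Min (insert k (snd ` W)) - 1" by auto
    have "j < i" if "(y, i) \<in> W" for y i
    proof -
      have "Min (insert k (snd ` W)) \<le> i" using assms that by (intro Min_le) force+
      then show ?thesis using v(3) by simp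
    qed
    then show "v \<in> far 1 W" unfolding v(1) by (intro far.base v) auto
  qed
  have "C \<in> complement_components G W \<and> (\<exists>k. V\<^sub>G \<times> {..k} \<subseteq> C) \<longleftrightarrow> C = far 1 W" for C
  proof
    assume "C \<in> complement_components G W \<and> (\<exists>k. V\<^sub>G \<times> {..k} \<subseteq> C)"
    then obtain k where k: "C \<in> complement_components G W" "V\<^sub>G \<times> {..k} \<subseteq> C" by blast
    have "V\<^sub>G \<times> {..min k (Min (insert k (snd ` W)) - 1)} \<subseteq> C" using k(2) by auto
    moreover have "V\<^sub>G \<times> {..min k (Min (insert k (snd ` W)) - 1)} \<noteq> {}" using verts_nonempty by auto
    ultimately show "C = far 1 W" using far_component[OF _ assms lower, of k C] k(1) by simp
  next
    assume C: "C = far 1 W"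
    have "V\<^sub>G \<times> {..min 0 (Min (insert 0 (snd ` W)) - 1)} \<noteq> {}" using verts_nonempty by auto
    then show "C \<in> complement_components G W \<and> (\<exists>k. V\<^sub>G \<times> {..k} \<subseteq> C)"
      using far_component[OF _ assms lower, of 0 C] C by auto
  qed
  then show ?thesis unfolding left_component_def by simp
qed

lemma right_component_eq:
  assumes "finite W"
  shows "right_component G W = far (- 1) W"
proof -
  have upper: "V\<^sub>G \<times> {max k (Max (insert k (snd ` W)) + 1)..} \<subseteq> far (- 1) W" for k
  proof
    fix v assume "v \<in> V\<^sub>G \<times> {max k (Max (insert k (snd ` W)) + 1)..}"
    then obtain x j where v: "v = (x, j)" "x \<in> V\<^sub>G" "Max (insert k (snd ` W)) + 1 \<le> j" by auto
    have "i < j" if "(y, i) \<in> W" for y i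
    proof -
      have "i \<le> Max (insert k (snd ` W))" using assms that by (intro Max_ge) force+
      then show ?thesis using v(3) by simp
    qed
    then show "v \<in> far (- 1) W" unfolding v(1) by (intro far.base v) auto
  qed
  have "C \<in> complement_components G W \<and> (\<exists>k. V\<^sub>G \<times> {k..} \<subseteq> C) \<longleftrightarrow> C = far (- 1) W" for C
  proof
    assume "C \<in> complement_components G W \<and> (\<exists>k. V\<^sub>G \<times> {k..} \<subseteq> C)"
    then obtain k where k: "C \<in> complement_components G W" "V\<^sub>G \<times> {k..} \<subseteq> C" by blast
    have "V\<^sub>G \<times> {max k (Max (insert k (snd ` W)) + 1)..} \<subseteq> C" using k(2) by auto
    moreover have "V\<^sub>G \<times> {max k (Max (insert k (snd ` W)) + 1)..} \<noteq> {}" using verts_nonempty by auto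
    ultimately show "C = far (- 1) W" using far_component[OF _ assms upper, of k C] k(1) by simp
  next
    assume C: "C = far (- 1) W"
    have "V\<^sub>G \<times> {max 0 (Max (insert 0 (snd ` W)) + 1)..} \<noteq> {}" using verts_nonempty by auto
    then show "C \<in> complement_components G W \<and> (\<exists>k. V\<^sub>G \<times> {k..} \<subseteq> C)"
      using far_component[OF _ assms upper, of 0 C] C by auto
  qed
  then show ?thesis unfolding right_component_def by simp
qed

section \<open>From burning orders to burnability of all subsets\<close>

lemma stable_le: "\<eta> \<in> stable_configs G V \<Longrightarrow> V \<subseteq> V\<^sub>G \<times> UNIV \<Longrightarrow> v \<in> V \<Longrightarrow> 1 \<le> \<eta> v \<and> \<eta> v \<le> int (card (nbrs v))"
  unfolding stable_configs_def by (drule (1) PiE_mem, drule (1) subsetD) (auto simp: toppling_diag)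

definition burning_order :: "('a \<times> int \<Rightarrow> int) \<Rightarrow> int \<Rightarrow> ('a \<times> int) list \<Rightarrow> bool" where
  "burning_order \<eta> s vs \<longleftrightarrow> (\<forall>i<length vs. int (card (nbrs (vs ! i))) <
     \<eta> (vs ! i) + int (card (nbrs (vs ! i) \<inter> far s (set (drop i vs)))))"

lemma burning_order_Cons:
  "burning_order \<eta> s (v # vs) \<longleftrightarrow>
    removable (far s (set (v # vs))) \<eta> v \<and> burning_order \<eta> s vs"
  unfolding burning_order_def by (auto simp: All_less_Suc2)

text \<open>The first listed site that belongs to \<open>W\<close> is removable in \<open>W\<close>:
  at its turn the unburnt set still contains \<open>W\<close>, and a smaller set lets the fire reach
  at least as far.\<close>

lemma burning_order_imp_burnable:
  "burning_order \<eta> s vs \<Longrightarrow> burnable (far s) (set vs) \<eta>"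
proof (induction vs)
  case Nil
  show ?case by (simp add: burnable_def)
next
  case (Cons v vs)
  show ?case
    unfolding burnable_def
  proof (intro allI impI)
    fix W assume W: "W \<subseteq> set (v # vs)" "W \<noteq> {}"
    show "\<exists>v\<in>W. removable (far s W) \<eta> v"
    proof (cases "v \<in> W")
      case True
      have "card (nbrs v \<inter> far s (set (v # vs))) \<le> card (nbrs v \<inter> far s W)"
        by (rule card_nbrs_Int_mono) (use far_antimono W(1) in blast)
      moreover have "removable (far s (set (v # vs))) \<eta> v"
        using Cons.prems unfolding burning_order_Cons by blast
      ultimately show ?thesis using True by (intro bexI[of _ v]) linarith+
    next
      case False
      then have "W \<subseteq> set vs" using W by auto
      then show ?thesis using Cons W(2) unfolding burning_order_Cons burnable_def by blast
    qed
  qed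
qed

lemma burnable_imp_burning_order:
  assumes "finite V" "burnable (far s) V \<eta>"
  shows "\<exists>vs. distinct vs \<and> set vs = V \<and> burning_order \<eta> s vs"
  using assms
proof (induction V rule: finite_psubset_induct)
  case (psubset V)
  show ?case
  proof (cases "V = {}")
    case True
    then show ?thesis by (intro exI[of _ "[]"]) (simp add: burning_order_def)
  next
    case False
    obtain v where v: "v \<in> V" "removable (far s V) \<eta> v"
      using burnableD[OF psubset.prems order_refl False] .
    have "burnable (far s) (V - {v}) \<eta>" by (rule burnable_subset[OF psubset.prems]) auto
    then obtain vs where vs: "distinct vs" "set vs = V - {v}" "burning_order \<eta> s vs"
      using psubset.IH[of "V - {v}"] v(1) by blast
    have set: "set (v # vs) = V" using vs v by auto
    then show ?thesis
      using vs v by (intro exI[of _ "v # vs"]) (simp only: burning_order_Cons set, simp)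
  qed
qed

text \<open>Stable heights do not exceed the degree, so the height condition forces a neighbour in
  \<open>side W\<close>, and this places the site on the boundary towards that side. A burning order
  is then built by removing sites one at a time.\<close>

lemma burnable_configs_eq:
  assumes V: "finite V" "V \<subseteq> V\<^sub>G \<times> UNIV" and side: "\<And>W. finite W \<Longrightarrow> side W = far s W"
  shows "burnable_configs G side V = {\<eta> \<in> stable_configs G V. burnable (far s) V \<eta>}"
proof -
  have step: "(v \<in> boundary_towards G (side W) W \<and>
      \<eta> v > toppling_matrix G v v - int (card {u \<in> side W. (u, v) \<in> parcs (ladder G)})) \<longleftrightarrow>
      removable (far s W) \<eta> v"
    if \<eta>: "\<eta> \<in> stable_configs G V" and v: "v \<in> W" "W \<subseteq> V" for v W \<eta>
  proof -
    have fin: "finite W" using v V finite_subset by blast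
    have vV: "v \<in> V" "fst v \<in> V\<^sub>G" using v V by auto
    have eq: "{u \<in> side W. (u, v) \<in> parcs (ladder G)} = nbrs v \<inter> far s W"
      by (auto simp: side[OF fin] nbrs_def)
    have "v \<in> boundary_towards G (side W) W"
      if "removable (far s W) \<eta> v"
    proof -
      have "card (nbrs v \<inter> far s W) \<noteq> 0" using that stable_le[OF \<eta> V(2) vV(1)] by linarith
      then have "nbrs v \<inter> far s W \<noteq> {}" by auto
      then obtain u where u: "u \<in> far s W" "adj u v" by (auto simp: nbrs_def)
      then show ?thesis
        using v(1) adj_sym[OF u(2)] unfolding boundary_towards_def side[OF fin] by blast
    qed
    then show ?thesis unfolding eq toppling_diag[OF vV(2)] by auto
  qed
  have "(\<exists>vs. distinct vs \<and> set vs = V \<and>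
       (\<forall>i < length vs. let v = vs ! i; W = set (drop i vs) in
          v \<in> boundary_towards G (side W) W \<and>
          \<eta> v > toppling_matrix G v v - int (card {u \<in> side W. (u, v) \<in> parcs (ladder G)})))
     \<longleftrightarrow> (\<exists>vs. distinct vs \<and> set vs = V \<and> burning_order \<eta> s vs)" if \<eta>: "\<eta> \<in> stable_configs G V" for \<eta>
  proof (rule ex_cong1, rule conj_cong[OF refl], rule conj_cong[OF refl])
    fix vs assume set: "set vs = V"
    have mem: "vs ! i \<in> set (drop i vs)" if "i < length vs" for i
      using that by (metis Cons_nth_drop_Suc list.set_intros(1))
    have sub: "set (drop i vs) \<subseteq> V" for i using set set_drop_subset by metis
    show "(\<forall>i < length vs. let v = vs ! i; W = set (drop i vs) in
          v \<in> boundary_towards G (side W) W \<and>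
          \<eta> v > toppling_matrix G v v - int (card {u \<in> side W. (u, v) \<in> parcs (ladder G)}))
        \<longleftrightarrow> burning_order \<eta> s vs"
      unfolding burning_order_def Let_def using step[OF \<eta> mem sub] by blast
  qed
  then have "burnable_configs G side V = {\<eta> \<in> stable_configs G V. \<exists>vs. distinct vs \<and> set vs = V \<and> burning_order \<eta> s vs}"
    unfolding burnable_configs_def by blast
  also have "\<dots> = {\<eta> \<in> stable_configs G V. burnable (far s) V \<eta>}"
    using burnable_imp_burning_order[OF V(1)] burning_order_imp_burnable by blast
  finally show ?thesis .
qed

lemma finite_segment: "finite (segment G n m)"
  by (simp add: segment_def pair_finite_verts)

lemma segment_subset: "segment G n m \<subseteq> V\<^sub>G \<times> UNIV"
  by (auto simp: segment_def)

lemma left_burnable_configs_eq: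
  "left_burnable_configs G (segment G n m) =
    (burnable_set (far 1) n m)"
  unfolding left_burnable_configs_def
  by (rule burnable_configs_eq[OF finite_segment segment_subset left_component_eq])

lemma right_burnable_configs_eq:
  "right_burnable_configs G (segment G n m) =
    (burnable_set (far (- 1)) n m)"
  unfolding right_burnable_configs_def
  by (rule burnable_configs_eq[OF finite_segment segment_subset right_component_eq])

end

section \<open>The sandpile Markov chain\<close>

text \<open>A relation with the one-step diamond property: all paths to a normal form have the same length.\<close>

locale strong_diamond =
  fixes r :: "'s \<Rightarrow> 's \<Rightarrow> bool"
  assumes diamond: "r a b \<Longrightarrow> r a c \<Longrightarrow> b \<noteq> c \<Longrightarrow> \<exists>d. r b d \<and> r c d"
begin

lemma step_towards_normal:
  assumes "(r ^^ n) a z" "\<And>y. \<not> r z y" "r a b"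
  shows "\<exists>n'. n = Suc n' \<and> (r ^^ n') b z"
  using assms(1,3)
proof (induction n arbitrary: a b)
  case 0
  then show ?case using assms(2) by simp
next
  case (Suc n)
  obtain c where c: "r a c" "(r ^^ n) c z" using Suc.prems(1) by (rule relpowp_Suc_E2)
  show ?case
  proof (cases "b = c")
    case True
    then show ?thesis using c by simp
  next
    case False
    obtain d where d: "r b d" "r c d" using diamond[OF Suc.prems(2) c(1) False] by (elim exE conjE)
    obtain n' where n': "n = Suc n'" "(r ^^ n') d z" using Suc.IH[OF c(2) d(2)] by (elim exE conjE)
    have "(r ^^ Suc n') b z" by (rule relpowp_Suc_I2[OF d(1) n'(2)])
    then show ?thesis using n'(1) by simp
  qed
qed

lemma path_towards_normal:
  assumes "(r ^^ n) a z" "\<And>y. \<not> r z y" "(r ^^ k) a b"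
  shows "k \<le> n \<and> (r ^^ (n - k)) b z"
  using assms(3)
proof (induction k arbitrary: b)
  case 0
  then show ?case using assms(1) by simp
next
  case (Suc k)
  obtain c where c: "(r ^^ k) a c" "r c b" using Suc.prems by (rule relpowp_Suc_E)
  have IH: "k \<le> n" "(r ^^ (n - k)) c z" using Suc.IH[OF c(1)] by simp_all
  obtain n' where "n - k = Suc n'" "(r ^^ n') b z"
    using step_towards_normal[OF IH(2) assms(2) c(2)] by (elim exE conjE)
  moreover from this have "Suc k \<le> n" "n' = n - Suc k" by simp_all
  ultimately show ?case by simp
qed

lemma confluent_normal:
  assumes "r\<^sup>*\<^sup>* a z" "\<And>y. \<not> r z y" "r\<^sup>*\<^sup>* a b"
  shows "r\<^sup>*\<^sup>* b z"
proof -
  obtain n k where "(r ^^ n) a z" "(r ^^ k) a b" using assms(1,3) by (auto simp: rtranclp_power)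
  then have "(r ^^ (n - k)) b z" using path_towards_normal[OF _ assms(2)] by simp
  then show ?thesis by (rule relpowp_imp_rtranclp)
qed

end

locale sandpile_region = connected_pair_graph +
  fixes V :: "('a \<times> int) set"
  assumes finite_V: "finite V" and V_subset: "V \<subseteq> V\<^sub>G \<times> UNIV"
begin

abbreviation deg :: "'a \<times> int \<Rightarrow> int" where "deg v \<equiv> int (card (nbrs v))"

lemma V_verts: "v \<in> V \<Longrightarrow> fst v \<in> V\<^sub>G" using V_subset by auto

lemma toppling_off: "u \<noteq> v \<Longrightarrow> toppling_matrix G v u = - of_bool (u \<in> nbrs v)"
  using adj_sym[of u v] adj_sym[of v u] by (auto simp: toppling_matrix_def nbrs_def)

lemma toppling_eq: "v \<in> V \<Longrightarrow> toppling_matrix G v u = (if u = v then deg v else - of_bool (u \<in> nbrs v))"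
  using toppling_off[of u v] toppling_diag[OF V_verts] by auto

abbreviation topple :: "('a \<times> int \<Rightarrow> int) \<Rightarrow> ('a \<times> int \<Rightarrow> int) \<Rightarrow> bool" where
  "topple \<equiv> topple_step G V"

definition add_grains :: "('a \<times> int \<Rightarrow> int) \<Rightarrow> ('a \<times> int \<Rightarrow> int) \<Rightarrow> ('a \<times> int \<Rightarrow> int)" where
  "add_grains \<eta> g = (\<lambda>u\<in>V. \<eta> u + g u)"

lemma topple_iff: "topple \<eta> \<xi> \<longleftrightarrow> (\<exists>v\<in>V. deg v < \<eta> v \<and> \<xi> = (\<lambda>u\<in>V. \<eta> u - toppling_matrix G v u))"
  unfolding topple_step_def by (metis toppling_diag V_verts)

text \<open>Toppling one unstable site takes no grain from another, so two distinct topplings can be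
  performed in either order with the same result.\<close>

sublocale strong_diamond topple
proof
  fix a b c assume ab: "topple a b" and ac: "topple a c" and "b \<noteq> c"
  obtain v where v: "v \<in> V" "deg v < a v" "b = (\<lambda>u\<in>V. a u - toppling_matrix G v u)"
    using ab unfolding topple_iff by blast
  obtain w where w: "w \<in> V" "deg w < a w" "c = (\<lambda>u\<in>V. a u - toppling_matrix G w u)"
    using ac unfolding topple_iff by blast
  have "v \<noteq> w" using v(3) w(3) \<open>b \<noteq> c\<close> by auto
  have "deg w < b w" using v w \<open>v \<noteq> w\<close> by (simp add: toppling_eq)
  moreover have "deg v < c v" using v w \<open>v \<noteq> w\<close> by (simp add: toppling_eq)
  moreover have "(\<lambda>u\<in>V. b u - toppling_matrix G w u) = (\<lambda>u\<in>V. c u - toppling_matrix G v u)"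
    by (rule restrict_ext) (simp add: v(3) w(3))
  ultimately show "\<exists>d. topple b d \<and> topple c d"
    unfolding topple_iff using v(1) w(1) by blast
qed

lemma normal_iff: "(\<forall>\<xi>. \<not> topple \<eta> \<xi>) \<longleftrightarrow> (\<forall>v\<in>V. \<eta> v \<le> deg v)"
proof
  show "\<forall>v\<in>V. \<eta> v \<le> deg v" if no: "\<forall>\<xi>. \<not> topple \<eta> \<xi>"
  proof (rule ballI, rule ccontr)
    fix v assume "v \<in> V" "\<not> \<eta> v \<le> deg v"
    then have "topple \<eta> (\<lambda>u\<in>V. \<eta> u - toppling_matrix G v u)"
      unfolding topple_iff by (intro bexI[of _ v]) auto
    then show False using no by (elim allE notE)
  qed
  show "\<forall>\<xi>. \<not> topple \<eta> \<xi>" if "\<forall>v\<in>V. \<eta> v \<le> deg v"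
    using that unfolding topple_iff by (auto simp: not_less)
qed

lemma stable_iff:
  "\<eta> \<in> stable_configs G V \<longleftrightarrow> \<eta> \<in> extensional V \<and> (\<forall>v\<in>V. 1 \<le> \<eta> v) \<and> (\<forall>\<xi>. \<not> topple \<eta> \<xi>)"
proof -
  have "\<eta> \<in> stable_configs G V \<longleftrightarrow> \<eta> \<in> extensional V \<and> (\<forall>v\<in>V. 1 \<le> \<eta> v \<and> \<eta> v \<le> toppling_matrix G v v)"
    by (auto simp: stable_configs_def PiE_iff)
  also have "\<dots> \<longleftrightarrow> \<eta> \<in> extensional V \<and> (\<forall>v\<in>V. 1 \<le> \<eta> v \<and> \<eta> v \<le> deg v)"
    using toppling_diag[OF V_verts] by simp
  finally show ?thesis unfolding normal_iff by blast
qed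

lemma stable_normal: "\<eta> \<in> stable_configs G V \<Longrightarrow> \<not> topple \<eta> \<xi>"
  by (simp add: stable_iff)

lemma topple_positive: "topple \<eta> \<xi> \<Longrightarrow> \<forall>v\<in>V. 1 \<le> \<eta> v \<Longrightarrow> \<forall>v\<in>V. 1 \<le> \<xi> v"
  unfolding topple_iff by (auto simp: toppling_eq)

lemma topples_positive: "topple\<^sup>*\<^sup>* \<eta> \<xi> \<Longrightarrow> \<forall>v\<in>V. 1 \<le> \<eta> v \<Longrightarrow> \<forall>v\<in>V. 1 \<le> \<xi> v"
  by (induction rule: rtranclp_induct) (auto dest: topple_positive)

lemma topples_extensional: "topple\<^sup>*\<^sup>* \<eta> \<xi> \<Longrightarrow> \<eta> \<in> extensional V \<Longrightarrow> \<xi> \<in> extensional V"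
  by (induction rule: rtranclp_induct) (auto simp: topple_iff)

lemma topple_add:
  assumes "topple \<eta> \<xi>" "\<And>v. v \<in> V \<Longrightarrow> 0 \<le> g v"
  shows "topple (add_grains \<eta> g) (add_grains \<xi> g)"
proof -
  obtain v where v: "v \<in> V" "deg v < \<eta> v" "\<xi> = (\<lambda>u\<in>V. \<eta> u - toppling_matrix G v u)"
    using assms(1) unfolding topple_iff by blast
  have "deg v < add_grains \<eta> g v" using v assms(2)[of v] by (simp add: add_grains_def)
  moreover have "add_grains \<xi> g = (\<lambda>u\<in>V. add_grains \<eta> g u - toppling_matrix G v u)"
    unfolding add_grains_def by (rule restrict_ext) (simp add: v(3))
  ultimately show ?thesis unfolding topple_iff using v(1) by blast
qed

lemma topples_add:
  assumes "topple\<^sup>*\<^sup>* \<eta> \<xi>" "\<And>v. v \<in> V \<Longrightarrow> 0 \<le> g v"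
  shows "topple\<^sup>*\<^sup>* (add_grains \<eta> g) (add_grains \<xi> g)"
  using assms(1)
proof (induction rule: rtranclp_induct)
  case (step y z)
  have "topple (add_grains y g) (add_grains z g)" by (rule topple_add[OF step(2)]) (rule assms(2))
  then show ?case by (rule rtranclp.rtrancl_into_rtrancl[OF step.IH])
qed simp

lemma relpow_add:
  assumes "(topple ^^ k) \<eta> \<xi>" "\<And>v. v \<in> V \<Longrightarrow> 0 \<le> g v"
  shows "(topple ^^ k) (add_grains \<eta> g) (add_grains \<xi> g)"
  using assms(1)
proof (induction k arbitrary: \<xi>)
  case (Suc k)
  obtain \<zeta> where \<zeta>: "(topple ^^ k) \<eta> \<zeta>" "topple \<zeta> \<xi>" using Suc.prems by (rule relpowp_Suc_E)
  have "topple (add_grains \<zeta> g) (add_grains \<xi> g)" by (rule topple_add[OF \<zeta>(2)]) (rule assms(2))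
  then show ?case by (rule relpowp_Suc_I[OF Suc.IH[OF \<zeta>(1)]])
qed simp

text \<open>An endless sequence of topplings from \<open>\<zeta>\<close> would stay legal after
  adding \<open>g\<close>, against the bound on the length of all paths given by
  \<open>path_towards_normal\<close>. Termination is thus inherited from the larger
  configuration.\<close>

lemma stabilizes_below:
  assumes "topple\<^sup>*\<^sup>* (add_grains \<zeta> g) z" "\<And>\<xi>. \<not> topple z \<xi>" "\<And>v. v \<in> V \<Longrightarrow> 0 \<le> g v"
  shows "\<exists>z'. topple\<^sup>*\<^sup>* \<zeta> z' \<and> (\<forall>\<xi>. \<not> topple z' \<xi>)"
proof (rule ccontr)
  assume no: "\<nexists>z'. topple\<^sup>*\<^sup>* \<zeta> z' \<and> (\<forall>\<xi>. \<not> topple z' \<xi>)"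
  obtain n where n: "(topple ^^ n) (add_grains \<zeta> g) z" using assms(1) by (auto simp: rtranclp_power)
  have "\<exists>b. (topple ^^ k) \<zeta> b" for k
  proof (induction k)
    case (Suc k)
    then obtain b where b: "(topple ^^ k) \<zeta> b" by blast
    then have "topple\<^sup>*\<^sup>* \<zeta> b" by (rule relpowp_imp_rtranclp)
    then obtain \<xi> where "topple b \<xi>" using no by blast
    then show ?case using relpowp_Suc_I[OF b] by blast
  qed auto
  then obtain b where "(topple ^^ Suc n) \<zeta> b" by blast
  then have "(topple ^^ Suc n) (add_grains \<zeta> g) (add_grains b g)" by (rule relpow_add) (rule assms(3))
  then have "Suc n \<le> n" using path_towards_normal[OF n assms(2)] by blast
  then show False by simp
qed

abbreviation unit :: "'a \<times> int \<Rightarrow> 'a \<times> int \<Rightarrow> int" where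
  "unit v \<equiv> (\<lambda>u. if u = v then 1 else 0)"

lemma sandpile_step_iff:
  assumes "\<eta> \<in> extensional V"
  shows "sandpile_step G V \<eta> \<xi> \<longleftrightarrow> \<xi> \<in> stable_configs G V \<and> (\<exists>v\<in>V. topple\<^sup>*\<^sup>* (add_grains \<eta> (unit v)) \<xi>)"
proof -
  have "\<eta>(v := \<eta> v + 1) = add_grains \<eta> (unit v)" if "v \<in> V" for v
    using that assms by (auto simp: add_grains_def fun_eq_iff extensional_def)
  then show ?thesis unfolding sandpile_step_def by auto
qed

lemma add_grains_add: "add_grains (add_grains \<eta> g) h = add_grains \<eta> (\<lambda>u. g u + h u)"
  unfolding add_grains_def by (rule restrict_ext) simp

lemma add_grains_cong: "(\<And>v. v \<in> V \<Longrightarrow> g v = h v) \<Longrightarrow> add_grains \<eta> g = add_grains \<eta> h"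
  unfolding add_grains_def by (rule restrict_ext) simp

lemma stable_extensional: "\<eta> \<in> stable_configs G V \<Longrightarrow> \<eta> \<in> extensional V"
  by (simp add: stable_iff)

lemma chain_extensional_stable:
  "(sandpile_step G V)\<^sup>*\<^sup>* \<eta> \<xi> \<Longrightarrow> \<eta> \<in> stable_configs G V \<Longrightarrow> \<xi> \<in> stable_configs G V"
  by (induction rule: rtranclp_induct) (auto simp: sandpile_step_def)

lemma stable_positive: "\<eta> \<in> stable_configs G V \<Longrightarrow> v \<in> V \<Longrightarrow> 1 \<le> \<eta> v"
  by (simp add: stable_iff)

text \<open>The abelian property: grains may be added one at a time with stabilization in between.\<close>

lemma chain_of_topples:
  assumes "\<xi> \<in> stable_configs G V" "\<eta> \<in> stable_configs G V"
    and "topple\<^sup>*\<^sup>* (add_grains \<xi> h) \<eta>" "\<And>v. v \<in> V \<Longrightarrow> 0 \<le> h v"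
  shows "(sandpile_step G V)\<^sup>*\<^sup>* \<xi> \<eta>"
  using assms(1,3,4)
proof (induction "nat (\<Sum>v\<in>V. h v)" arbitrary: \<xi> h rule: less_induct)
  case less
  show ?case
  proof (cases "\<forall>v\<in>V. h v = 0")
    case True
    have "add_grains \<xi> h = \<xi>"
      using True stable_extensional[OF less.prems(1)]
      by (auto simp: add_grains_def fun_eq_iff extensional_def)
    then have "topple\<^sup>*\<^sup>* \<xi> \<eta>" using less.prems(2) by simp
    then have "\<xi> = \<eta>"
      by (cases rule: converse_rtranclpE) (use stable_normal[OF less.prems(1)] in auto)
    then show ?thesis by simp
  next
    case False
    then obtain v where v: "v \<in> V" "1 \<le> h v" using less.prems(3) by force
    define h' where "h' u = h u - unit v u" for u
    have h'0: "0 \<le> h' u" if "u \<in> V" for u using less.prems(3)[OF that] v by (simp add: h'_def)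
    have split: "add_grains \<xi> h = add_grains (add_grains \<xi> (unit v)) h'" unfolding add_grains_add by (rule add_grains_cong) (simp add: h'_def)
    obtain z where z: "topple\<^sup>*\<^sup>* (add_grains \<xi> (unit v)) z" "\<And>y. \<not> topple z y"
      using stabilizes_below[OF less.prems(2)[unfolded split] stable_normal[OF assms(2)] h'0] by blast
    have "\<forall>u\<in>V. 1 \<le> add_grains \<xi> (unit v) u"
      using stable_positive[OF less.prems(1)] by (force simp: add_grains_def)
    then have zs: "z \<in> stable_configs G V"
      unfolding stable_iff using topples_positive[OF z(1)] topples_extensional[OF z(1)] z(2) by (simp add: add_grains_def)
    have "sandpile_step G V \<xi> z"
      unfolding sandpile_step_iff[OF stable_extensional[OF less.prems(1)]] using zs v(1) z(1) by blast
    moreover have "topple\<^sup>*\<^sup>* (add_grains z h') \<eta>"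
      using confluent_normal[OF less.prems(2)[unfolded split] stable_normal[OF assms(2)] topples_add[OF z(1) h'0]] .
    then have "(sandpile_step G V)\<^sup>*\<^sup>* z \<eta>"
    proof (rule less.hyps[OF _ zs _ h'0, rotated])
      have "(\<Sum>u\<in>V. h u) = (\<Sum>u\<in>V. h' u) + 1"
        using v(1) finite_V by (simp add: h'_def sum_subtractf)
      moreover have "0 \<le> (\<Sum>u\<in>V. h' u)" by (rule sum_nonneg) (rule h'0)
      ultimately show "nat (\<Sum>u\<in>V. h' u) < nat (\<Sum>u\<in>V. h u)" by linarith
    qed
    ultimately show ?thesis by (rule converse_rtranclp_into_rtranclp)
  qed
qed

text \<open>The converse direction: topplings remain legal when later grains are already present, so
  all grains of the chain can be added at the start.\<close>

lemma topples_of_chain: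
  assumes "(sandpile_step G V)\<^sup>*\<^sup>* \<eta> \<xi>" "\<eta> \<in> stable_configs G V"
  shows "\<exists>g. (\<forall>v. 0 \<le> g v) \<and> topple\<^sup>*\<^sup>* (add_grains \<eta> g) \<xi>"
  using assms(1)
proof (induction rule: rtranclp_induct)
  case base
  have "add_grains \<eta> (\<lambda>_. 0) = \<eta>"
    using stable_extensional[OF assms(2)] by (auto simp: add_grains_def fun_eq_iff extensional_def)
  then show ?case by (intro exI[of _ "\<lambda>_. 0"]) simp
next
  case (step y z)
  obtain g where g: "\<forall>v. 0 \<le> g v" "topple\<^sup>*\<^sup>* (add_grains \<eta> g) y" using step.IH by (elim exE conjE)
  have "y \<in> extensional V"
    using chain_extensional_stable[OF step(1) assms(2)] by (rule stable_extensional)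
  then obtain v where v: "v \<in> V" "topple\<^sup>*\<^sup>* (add_grains y (unit v)) z"
    using step(2) unfolding sandpile_step_iff[OF \<open>y \<in> extensional V\<close>] by blast
  have "topple\<^sup>*\<^sup>* (add_grains (add_grains \<eta> g) (unit v)) (add_grains y (unit v))" by (rule topples_add[OF g(2)]) simp
  then have "topple\<^sup>*\<^sup>* (add_grains \<eta> (\<lambda>u. g u + unit v u)) z" unfolding add_grains_add using v(2) by simp
  then show ?case using g(1) by (intro exI[of _ "\<lambda>u. g u + unit v u"]) simp
qed

lemma nbrs_not_self: "v \<notin> nbrs v"
  using adj_irrefl by (simp add: nbrs_def)

lemma nbrs_sym: "u \<in> nbrs v \<longleftrightarrow> v \<in> nbrs u"
  using adj_sym[of u v] adj_sym[of v u] by (auto simp: nbrs_def)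

lemma card_nbrs_remove:
  assumes "v \<in> W" "u \<noteq> v"
  shows "int (card (nbrs u \<inter> - (W - {v}))) = int (card (nbrs u \<inter> - W)) + of_bool (u \<in> nbrs v)"
proof (cases "u \<in> nbrs v")
  case True
  then have "nbrs u \<inter> - (W - {v}) = insert v (nbrs u \<inter> - W)" using nbrs_sym by blast
  then show ?thesis using True assms finite_nbrs by simp
next
  case False
  then have "nbrs u \<inter> - (W - {v}) = nbrs u \<inter> - W" using nbrs_sym by blast
  then show ?thesis using False by simp
qed

text \<open>Only sets \<open>W\<close> containing the toppled site \<open>v\<close> are critical. If
  \<open>W\<close> is \<open>{v}\<close>, all neighbours are outside and \<open>v\<close> keeps a
  positive height. Otherwise a site removable in \<open>W - {v}\<close> serves for \<open>W\<close>:
  if it is adjacent to \<open>v\<close>, the grain received from \<open>v\<close> replaces the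
  outside neighbour that it loses.\<close>

lemma burnable_topple:
  assumes b: "burnable uminus V \<eta>" and t: "topple \<eta> \<xi>"
  shows "burnable uminus V \<xi>"
  unfolding burnable_def
proof (intro allI impI)
  obtain v where v: "v \<in> V" "deg v < \<eta> v" "\<xi> = (\<lambda>u\<in>V. \<eta> u - toppling_matrix G v u)"
    using t unfolding topple_iff by blast
  fix W assume W: "W \<subseteq> V" "W \<noteq> {}"
  show "\<exists>u\<in>W. removable (- W) \<xi> u"
  proof (cases "v \<in> W")
    case False
    obtain u where u: "u \<in> W" "removable (- W) \<eta> u"
      using burnableD[OF b W] .
    have "\<eta> u \<le> \<xi> u" using u(1) W False v by (auto simp: toppling_eq)
    then show ?thesis using u by (intro bexI[of _ u]) auto
  next
    case True
    show ?thesis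
    proof (cases "W = {v}")
      case single: True
      have "nbrs v \<inter> - W = nbrs v" using single nbrs_not_self by blast
      then show ?thesis using v single by (simp add: toppling_eq)
    next
      case False
      then have "W - {v} \<subseteq> V" "W - {v} \<noteq> {}" using W True by auto
      from burnableD[OF b this]
      obtain u where u: "u \<in> W - {v}" "removable (- (W - {v})) \<eta> u" .
      then have "u \<in> V" "u \<noteq> v" using W by auto
      then have "\<xi> u = \<eta> u + of_bool (u \<in> nbrs v)" using v by (simp add: toppling_eq)
      then show ?thesis
        using u card_nbrs_remove[OF True \<open>u \<noteq> v\<close>] by (intro bexI[of _ u]) auto
    qed
  qed
qed

lemma burnable_chain:
  assumes "(sandpile_step G V)\<^sup>*\<^sup>* \<eta> \<xi>" "\<eta> \<in> stable_configs G V" "burnable uminus V \<eta>"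
  shows "burnable uminus V \<xi>"
proof -
  obtain g where g: "\<forall>v. 0 \<le> g v" "topple\<^sup>*\<^sup>* (add_grains \<eta> g) \<xi>" using topples_of_chain[OF assms(1,2)] by blast
  have "burnable uminus V (add_grains \<eta> g)"
    by (rule burnable_mono[OF assms(3)]) (simp add: add_grains_def spec[OF g(1)])
  with g(2) show ?thesis
    by (induction rule: rtranclp_induct) (auto intro: burnable_topple)
qed

definition full_config :: "'a \<times> int \<Rightarrow> int" where "full_config = (\<lambda>v\<in>V. deg v)"

lemma deg_pos: "v \<in> V \<Longrightarrow> 1 \<le> deg v"
  using card_nbrs[of "fst v" "snd v"] V_verts[of v] by simp

lemma full_config_stable: "full_config \<in> stable_configs G V"
  using deg_pos by (auto simp: stable_iff normal_iff full_config_def)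

lemma full_config_reachable:
  assumes "\<xi> \<in> stable_configs G V"
  shows "(sandpile_step G V)\<^sup>*\<^sup>* \<xi> full_config"
proof (rule chain_of_topples[OF assms full_config_stable])
  have le: "\<xi> v \<le> deg v" if "v \<in> V" for v
    using assms that unfolding stable_iff normal_iff by blast
  show "topple\<^sup>*\<^sup>* (add_grains \<xi> (\<lambda>v. deg v - \<xi> v)) full_config"
  proof -
    have "add_grains \<xi> (\<lambda>v. deg v - \<xi> v) = full_config" by (simp add: add_grains_def full_config_def)
    then show ?thesis by simp
  qed
  show "0 \<le> deg v - \<xi> v" if "v \<in> V" for v using le[OF that] by simp
qed

text \<open>A site of \<open>W\<close> in its lowest column has a neighbour outside
  \<open>W\<close>, and at maximal height one is enough.\<close>

lemma full_config_burnable: "burnable uminus V full_config"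
  unfolding burnable_def
proof (intro allI impI)
  fix W assume W: "W \<subseteq> V" "W \<noteq> {}"
  have fin: "finite W" using W finite_V finite_subset by blast
  define j where "j = Min (snd ` W)"
  have "j \<in> snd ` W" unfolding j_def using fin W by (intro Min_in) auto
  then obtain x where x: "(x, j) \<in> W" by auto
  have "(x, j - 1) \<notin> W"
  proof
    assume "(x, j - 1) \<in> W"
    then have "j \<le> j - 1" unfolding j_def using fin by (intro Min_le) force+
    then show False by simp
  qed
  moreover have "(x, j - 1) \<in> nbrs (x, j)" using x W V_verts[of "(x, j)"] by (auto simp: nbrs_def adj_iff)
  ultimately have "0 < card (nbrs (x, j) \<inter> - W)" using finite_nbrs by (auto simp: card_gt_0_iff)
  then show "\<exists>v\<in>W. removable (- W) full_config v"
    using x W by (intro bexI[of _ "(x, j)"]) (auto simp: full_config_def)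
qed

text \<open>The maximal configuration can be reached from \<open>\<eta>\<close>, so by recurrence
  \<open>\<eta>\<close> can be reached from it, and burnability persists along the chain.\<close>

lemma recurrent_imp_burnable:
  assumes "\<eta> \<in> recurrent_configs G V"
  shows "burnable uminus V \<eta>"
proof -
  have "\<eta> \<in> stable_configs G V" using assms by (simp add: recurrent_configs_def)
  from full_config_reachable[OF this] have "(sandpile_step G V)\<^sup>*\<^sup>* full_config \<eta>"
    using assms by (simp add: recurrent_configs_def)
  then show ?thesis by (rule burnable_chain[OF _ full_config_stable full_config_burnable])
qed

text \<open>Adding one grain per missing neighbour and burning the region topples every site exactly once.\<close>

lemma burning_topples:
  assumes \<eta>: "\<eta> \<in> extensional V" and b: "burnable uminus V \<eta>"
  shows "topple\<^sup>*\<^sup>* (add_grains \<eta> (\<lambda>u. int (card (nbrs u \<inter> - V)))) \<eta>"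
proof -
  \<comment> \<open>The configuration when exactly the sites of \<open>V\<close> outside
    \<open>W\<close> have toppled once: each site has one extra grain for every neighbour in
    \<open>- W\<close> and, if toppled, has lost as many as it has neighbours. At
    \<open>W = V\<close> this is the start, at the empty set it is \<open>\<eta>\<close>.\<close>
  define \<zeta> where "\<zeta> W = (\<lambda>u\<in>V. \<eta> u + int (card (nbrs u \<inter> - W)) - (if u \<in> W then 0 else deg u))" for W
  have "topple\<^sup>*\<^sup>* (\<zeta> W) (\<zeta> {})" if "finite W" "W \<subseteq> V" for W
    using that
  proof (induction W rule: finite_psubset_induct)
    case (psubset W)
    show ?case
    proof (cases "W = {}")
      case False
      obtain v where v: "v \<in> W" "removable (- W) \<eta> v"
        using burnableD[OF b psubset.prems False] .
      have vV: "v \<in> V" using v psubset.prems by blast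
      have "deg v < \<zeta> W v" using v vV by (simp add: \<zeta>_def)
      moreover have "\<zeta> (W - {v}) = (\<lambda>u\<in>V. \<zeta> W u - toppling_matrix G v u)"
        unfolding \<zeta>_def
      proof (rule restrict_ext)
        fix u assume u: "u \<in> V"
        show "\<eta> u + int (card (nbrs u \<inter> - (W - {v}))) - (if u \<in> W - {v} then 0 else deg u) =
          (\<lambda>u\<in>V. \<eta> u + int (card (nbrs u \<inter> - W)) - (if u \<in> W then 0 else deg u)) u - toppling_matrix G v u"
        proof (cases "u = v")
          case True
          have "nbrs v \<inter> - (W - {v}) = nbrs v \<inter> - W" using nbrs_not_self by blast
          then show ?thesis using True v vV by (simp add: toppling_eq)
        next
          case False
          show ?thesis
            unfolding card_nbrs_remove[OF v(1) False] toppling_eq[OF vV] using u False by simp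
        qed
      qed
      ultimately have "topple (\<zeta> W) (\<zeta> (W - {v}))" unfolding topple_iff using vV by blast
      moreover have "topple\<^sup>*\<^sup>* (\<zeta> (W - {v})) (\<zeta> {})"
        using psubset.IH[of "W - {v}"] v psubset.prems by blast
      ultimately show ?thesis by (rule converse_rtranclp_into_rtranclp)
    qed simp
  qed
  from this[OF finite_V order_refl] have "topple\<^sup>*\<^sup>* (\<zeta> V) (\<zeta> {})" .
  moreover have "\<zeta> {} = \<eta>" using \<eta> by (auto simp: \<zeta>_def fun_eq_iff extensional_def)
  moreover have "\<zeta> V = add_grains \<eta> (\<lambda>u. int (card (nbrs u \<inter> - V)))" by (auto simp: \<zeta>_def add_grains_def)
  ultimately show ?thesis by simp
qed

text \<open>Recurrence in additive form: the addition of \<open>g\<close> can be repaired by further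
  grains \<open>h\<close>. The property passes to smaller additions and to sums of nonnegative ones,
  so single grains suffice.\<close>

definition undoable :: "('a \<times> int \<Rightarrow> int) \<Rightarrow> ('a \<times> int \<Rightarrow> int) \<Rightarrow> bool" where
  "undoable \<eta> g \<longleftrightarrow> (\<exists>h. (\<forall>v\<in>V. 0 \<le> h v) \<and> topple\<^sup>*\<^sup>* (add_grains \<eta> (\<lambda>u. g u + h u)) \<eta>)"

lemma undoableI:
  "\<forall>v\<in>V. 0 \<le> h v \<Longrightarrow> topple\<^sup>*\<^sup>* (add_grains \<eta> (\<lambda>u. g u + h u)) \<eta> \<Longrightarrow> undoable \<eta> g"
  unfolding undoable_def by (intro exI[of _ h] conjI)

lemma undoableE:
  assumes "undoable \<eta> g"
  obtains h where "\<forall>v\<in>V. 0 \<le> h v" "topple\<^sup>*\<^sup>* (add_grains \<eta> (\<lambda>u. g u + h u)) \<eta>"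
  using assms unfolding undoable_def by (elim exE conjE)

lemma undoable_le:
  assumes "undoable \<eta> g" "\<And>v. v \<in> V \<Longrightarrow> g' v \<le> g v"
  shows "undoable \<eta> g'"
proof -
  obtain h where h: "\<forall>v\<in>V. 0 \<le> h v" "topple\<^sup>*\<^sup>* (add_grains \<eta> (\<lambda>u. g u + h u)) \<eta>"
    using assms(1) by (rule undoableE)
  have "add_grains \<eta> (\<lambda>u. g u + h u) = add_grains \<eta> (\<lambda>u. g' u + (g u - g' u + h u))" by (rule add_grains_cong) simp
  then have "topple\<^sup>*\<^sup>* (add_grains \<eta> (\<lambda>u. g' u + (g u - g' u + h u))) \<eta>" using h(2) by simp
  moreover have "\<forall>v\<in>V. 0 \<le> g v - g' v + h v" using h(1) assms(2) by (simp add: add_increasing)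
  ultimately show ?thesis by (intro undoableI)
qed

lemma undoable_add:
  assumes "undoable \<eta> g" "undoable \<eta> g'" "\<And>v. v \<in> V \<Longrightarrow> 0 \<le> g' v"
  shows "undoable \<eta> (\<lambda>u. g u + g' u)"
proof -
  obtain h where h: "\<forall>v\<in>V. 0 \<le> h v" "topple\<^sup>*\<^sup>* (add_grains \<eta> (\<lambda>u. g u + h u)) \<eta>"
    using assms(1) by (rule undoableE)
  obtain h' where h': "\<forall>v\<in>V. 0 \<le> h' v" "topple\<^sup>*\<^sup>* (add_grains \<eta> (\<lambda>u. g' u + h' u)) \<eta>"
    using assms(2) by (rule undoableE)
  have "topple\<^sup>*\<^sup>* (add_grains (add_grains \<eta> (\<lambda>u. g u + h u)) (\<lambda>u. g' u + h' u)) (add_grains \<eta> (\<lambda>u. g' u + h' u))"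
    by (rule topples_add[OF h(2)]) (use assms(3) h' in simp)
  then have "topple\<^sup>*\<^sup>* (add_grains (add_grains \<eta> (\<lambda>u. g u + h u)) (\<lambda>u. g' u + h' u)) \<eta>" using h'(2) by simp
  moreover have "add_grains (add_grains \<eta> (\<lambda>u. g u + h u)) (\<lambda>u. g' u + h' u) = add_grains \<eta> (\<lambda>u. (g u + g' u) + (h u + h' u))"
    unfolding add_grains_add by (rule add_grains_cong) simp
  ultimately have "topple\<^sup>*\<^sup>* (add_grains \<eta> (\<lambda>u. (g u + g' u) + (h u + h' u))) \<eta>" by simp
  moreover have "\<forall>v\<in>V. 0 \<le> h v + h' v" using h h' by simp
  ultimately show ?thesis by (intro undoableI)
qed

lemma undoable_scale:
  assumes "undoable \<eta> g" "\<And>v. v \<in> V \<Longrightarrow> 0 \<le> g v" "undoable \<eta> (\<lambda>_. 0)"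
  shows "undoable \<eta> (\<lambda>u. int k * g u)"
proof (induction k)
  case 0
  show ?case using assms(3) by simp
next
  case (Suc k)
  have "undoable \<eta> (\<lambda>u. int k * g u + g u)" by (rule undoable_add[OF Suc assms(1,2)])
  then show ?case by (simp add: distrib_right add.commute)
qed

text \<open>Together with \<open>\<eta> u \<ge> 1\<close>, adding \<open>deg u\<close> grains at
  \<open>u\<close> makes it unstable, and toppling it once trades these grains for one grain at each
  neighbour. By confluence the result still stabilises to \<open>\<eta>\<close>.\<close>

lemma undoable_nbr:
  assumes st: "\<eta> \<in> stable_configs G V" and u: "u \<in> V" "undoable \<eta> (unit u)" "undoable \<eta> (\<lambda>_. 0)"
    and w: "w \<in> V" "w \<in> nbrs u"
  shows "undoable \<eta> (unit w)"
proof -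
  have "undoable \<eta> (\<lambda>v. int (card (nbrs u)) * unit u v)"
    by (rule undoable_scale[OF u(2) _ u(3)]) simp
  then obtain h where h: "\<forall>v\<in>V. 0 \<le> h v" "topple\<^sup>*\<^sup>* (add_grains \<eta> (\<lambda>v. deg u * unit u v + h v)) \<eta>"
    by (rule undoableE)
  let ?\<zeta> = "add_grains \<eta> (\<lambda>v. deg u * unit u v + h v)"
  have "deg u < ?\<zeta> u" using u(1) h(1) stable_positive[OF st u(1)] by (simp add: add_grains_def add_pos_nonneg)
  then have "topple ?\<zeta> (\<lambda>v\<in>V. ?\<zeta> v - toppling_matrix G u v)" unfolding topple_iff using u(1) by blast
  then have "topple\<^sup>*\<^sup>* (\<lambda>v\<in>V. ?\<zeta> v - toppling_matrix G u v) \<eta>"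
    using confluent_normal[OF h(2) stable_normal[OF st]] by blast
  moreover have "(\<lambda>v\<in>V. ?\<zeta> v - toppling_matrix G u v) = add_grains \<eta> (\<lambda>v. of_bool (v \<in> nbrs u) + h v)"
    unfolding add_grains_def
  proof (rule restrict_ext)
    fix v assume "v \<in> V"
    then show "(\<lambda>v\<in>V. \<eta> v + (deg u * unit u v + h v)) v - toppling_matrix G u v = \<eta> v + (of_bool (v \<in> nbrs u) + h v)"
      using nbrs_not_self[of u] by (simp add: toppling_eq[OF u(1)])
  qed
  ultimately have "undoable \<eta> (\<lambda>v. of_bool (v \<in> nbrs u))" using undoableI[OF h(1)] by simp
  then show ?thesis by (rule undoable_le) (use w in auto)
qed

text \<open>A state reached from \<open>\<eta>\<close> arises by adding some \<open>g\<close>. Every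
  nonnegative \<open>g\<close> is a sum of single grains, hence undoable, and the repairing grains
  \<open>h\<close> lead back to \<open>\<eta>\<close>.\<close>

lemma burnable_imp_recurrent:
  assumes st: "\<eta> \<in> stable_configs G V" and units: "\<And>v. v \<in> V \<Longrightarrow> undoable \<eta> (unit v)"
    and zero: "undoable \<eta> (\<lambda>_. 0)"
  shows "\<eta> \<in> recurrent_configs G V"
proof -
  have all: "undoable \<eta> g" if g: "\<forall>v. 0 \<le> g v" for g
  proof -
    have "undoable \<eta> (\<lambda>u. if u \<in> X then g u else 0)" if "finite X" "X \<subseteq> V" for X
      using that
    proof (induction X rule: finite_induct)
      case empty
      then show ?case using zero by simp
    next
      case (insert x X)
      have "undoable \<eta> (\<lambda>u. int (nat (g x)) * unit x u)"
        by (rule undoable_scale[OF units _ zero]) (use insert in auto)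
      then have "undoable \<eta> (\<lambda>u. (if u \<in> X then g u else 0) + int (nat (g x)) * unit x u)"
        using insert by (intro undoable_add) auto
      then show ?case
        by (rule undoable_le) (use insert g in auto)
    qed
    from this[OF finite_V order_refl] show ?thesis by (rule undoable_le) simp
  qed
  have "(sandpile_step G V)\<^sup>*\<^sup>* \<xi> \<eta>" if \<xi>: "(sandpile_step G V)\<^sup>*\<^sup>* \<eta> \<xi>" for \<xi>
  proof -
    obtain g where g: "\<forall>v. 0 \<le> g v" "topple\<^sup>*\<^sup>* (add_grains \<eta> g) \<xi>" using topples_of_chain[OF \<xi> st] by blast
    obtain h where h: "\<forall>v\<in>V. 0 \<le> h v" "topple\<^sup>*\<^sup>* (add_grains \<eta> (\<lambda>u. g u + h u)) \<eta>"
      using all[OF g(1)] by (rule undoableE)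
    have "topple\<^sup>*\<^sup>* (add_grains (add_grains \<eta> g) h) (add_grains \<xi> h)" by (rule topples_add[OF g(2)]) (use h in simp)
    then have "topple\<^sup>*\<^sup>* (add_grains \<xi> h) \<eta>"
      unfolding add_grains_add using confluent_normal[OF h(2) stable_normal[OF st]] by blast
    then show ?thesis
      by (rule chain_of_topples[OF chain_extensional_stable[OF \<xi> st] st]) (use h in simp)
  qed
  then show ?thesis using st by (simp add: recurrent_configs_def)
qed

end

context connected_pair_graph
begin

text \<open>Burning adds grains at the sites with neighbours outside the segment and returns to
  \<open>\<eta>\<close>. This makes a single grain in the leftmost column undoable, and
  \<open>undoable_nbr\<close> carries the property along each row to the other end.\<close>

lemma recurrent_configs_segment:
  assumes "n \<le> m"
  shows "recurrent_configs G (segment G n m) =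
    (burnable_set uminus n m)"
proof -
  interpret S: sandpile_region G "segment G n m"
    by unfold_locales (use finite_segment segment_subset in auto)
  let ?V = "segment G n m"
  have "\<eta> \<in> recurrent_configs G ?V" if st: "\<eta> \<in> stable_configs G ?V" and b: "burnable uminus ?V \<eta>" for \<eta>
  proof (rule S.burnable_imp_recurrent[OF st])
    let ?\<beta> = "\<lambda>u. int (card (nbrs u \<inter> - ?V))"
    have "S.undoable \<eta> ?\<beta>"
      by (rule S.undoableI[of "\<lambda>_. 0"]) (use S.burning_topples[OF S.stable_extensional[OF st] b] in simp_all)
    note \<beta> = S.undoable_le[OF this]
    show zero: "S.undoable \<eta> (\<lambda>_. 0)" by (rule \<beta>) simp
    have "S.undoable \<eta> (S.unit (x, n + int k))" if x: "x \<in> V\<^sub>G" and "n + int k \<le> m" for x k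
      using that(2)
    proof (induction k)
      case 0
      show ?case
      proof (rule \<beta>)
        fix v
        have "(x, n - 1) \<in> nbrs (x, n) \<inter> - ?V" using x by (auto simp: nbrs_def adj_iff segment_def)
        then have "0 < card (nbrs (x, n) \<inter> - ?V)" using finite_nbrs by (auto simp: card_gt_0_iff)
        then show "S.unit (x, n + int 0) v \<le> int (card (nbrs v \<inter> - ?V))" by auto
      qed
    next
      case (Suc k)
      show ?case
      proof (rule S.undoable_nbr[OF st _ Suc.IH zero])
        show "(x, n + int k) \<in> ?V" "(x, n + int (Suc k)) \<in> ?V" "n + int k \<le> m"
          using x Suc.prems by (auto simp: segment_def)
        show "(x, n + int (Suc k)) \<in> nbrs (x, n + int k)" using x by (auto simp: nbrs_def adj_iff)
      qed
    qed
    note u = this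
    fix v assume "v \<in> ?V"
    then obtain x j where v: "v = (x, j)" "x \<in> V\<^sub>G" "n \<le> j" "j \<le> m" by (auto simp: segment_def)
    then have "j = n + int (nat (j - n))" by simp
    then show "S.undoable \<eta> (S.unit v)" using u[OF v(2), of "nat (j - n)"] v by simp
  qed
  moreover have "\<eta> \<in> stable_configs G ?V" if "\<eta> \<in> recurrent_configs G ?V" for \<eta>
    using that by (simp add: recurrent_configs_def)
  ultimately show ?thesis using S.recurrent_imp_burnable by blast
qed

end

section \<open>Weak limits\<close>

context connected_pair_graph
begin

abbreviation Seg :: "nat \<Rightarrow> ('a \<times> int) set" where "Seg k \<equiv> segment G (- int k) (int k)"

abbreviation St :: "nat \<Rightarrow> ('a \<times> int \<Rightarrow> int) set" where "St k \<equiv> stable_configs G (Seg k)"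

abbreviation \<Lambda> :: "('a \<times> int) set" where "\<Lambda> \<equiv> pverts (ladder G)"

lemma \<Lambda>_eq: "\<Lambda> = V\<^sub>G \<times> UNIV" by (simp add: ladder_def)

lemma Seg_subset: "Seg k \<subseteq> \<Lambda>" by (auto simp: \<Lambda>_eq segment_def)

lemma Seg_mono: "k \<le> k' \<Longrightarrow> Seg k \<subseteq> Seg k'" by (auto simp: segment_def)

lemma St_eq: "St k = (\<Pi>\<^sub>E u\<in>Seg k. {1..toppling_matrix G u u})"
  by (simp add: stable_configs_def)

lemma finite_St: "finite (St k)"
  unfolding St_eq by (intro finite_PiE finite_segment) auto

lemma restrict_St: "k \<le> k' \<Longrightarrow> \<zeta> \<in> St k' \<Longrightarrow> restrict \<zeta> (Seg k) \<in> St k"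
  unfolding St_eq using Seg_mono[of k k'] by (auto simp: PiE_iff)

lemma toppling_ge_1: "u \<in> \<Lambda> \<Longrightarrow> 1 \<le> toppling_matrix G u u"
  by (simp add: toppling_matrix_def)

definition radius :: "('a \<times> int) set \<Rightarrow> nat" where
  "radius J = Max (insert 0 ((\<lambda>u. nat \<bar>snd u\<bar>) ` J))"

lemma subset_Seg_radius:
  assumes "finite J" "J \<subseteq> \<Lambda>"
  shows "J \<subseteq> Seg (radius J)"
proof
  fix u assume u: "u \<in> J"
  have "nat \<bar>snd u\<bar> \<le> radius J" unfolding radius_def using assms(1) u by (intro Max_ge) auto
  then have "- int (radius J) \<le> snd u \<and> snd u \<le> int (radius J)" by linarith
  then show "u \<in> Seg (radius J)" using u assms(2) by (cases u) (auto simp: segment_def \<Lambda>_eq)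
qed

lemma radius_le:
  assumes "finite J" "J \<subseteq> Seg k"
  shows "radius J \<le> k"
proof -
  have "nat \<bar>snd u\<bar> \<le> k" if "u \<in> J" for u
    using subsetD[OF assms(2) that] by (auto simp: segment_def)
  then show ?thesis unfolding radius_def using assms(1) by (subst Max_le_iff) auto
qed

lemma space_infinite: "space (infinite_config_space G) = (\<Pi>\<^sub>E u\<in>\<Lambda>. {1..toppling_matrix G u u})"
  by (simp add: infinite_config_space_def space_PiM)

lemma restrict_infinite: "\<eta> \<in> space (infinite_config_space G) \<Longrightarrow> restrict \<eta> (Seg k) \<in> St k"
  unfolding space_infinite St_eq using Seg_subset[of k] by (auto simp: PiE_iff)

definition cylinder :: "('a \<times> int \<Rightarrow> int) measure \<Rightarrow> nat \<Rightarrow> ('a \<times> int \<Rightarrow> int) set \<Rightarrow> ('a \<times> int \<Rightarrow> int) set" where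
  "cylinder M k A = {\<eta> \<in> space M. restrict \<eta> (Seg k) \<in> A}"

lemma weak_limit_iff:
  "weak_limit G M \<nu> F \<longleftrightarrow> prob_space \<nu> \<and> sets \<nu> = sets (infinite_config_space G) \<and>
    (\<forall>k. \<forall>A\<subseteq>St k. ((\<lambda>i. measure (M i) (cylinder (M i) k A)) \<longlongrightarrow> measure \<nu> (cylinder \<nu> k A)) F)"
  by (simp add: weak_limit_def cylinder_def)

lemma cylinder_measurable:
  assumes "sets \<nu> = sets (infinite_config_space G)" "A \<subseteq> St k"
  shows "cylinder \<nu> k A \<in> sets \<nu>"
proof -
  let ?K = "PiM (Seg k) (\<lambda>u. count_space {1..toppling_matrix G u u})"
  have K: "?K = count_space (St k)"
    unfolding St_eq by (rule count_space_PiM_finite) (auto simp: finite_segment)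
  have "(\<lambda>\<eta>. restrict \<eta> (Seg k)) \<in> measurable (infinite_config_space G) ?K"
    unfolding infinite_config_space_def by (rule measurable_restrict_subset[OF Seg_subset])
  from measurable_sets[OF this, of A] assms(2) have "(\<lambda>\<eta>. restrict \<eta> (Seg k)) -` A \<inter> space (infinite_config_space G) \<in> sets (infinite_config_space G)"
    by (simp add: K)
  moreover have "(\<lambda>\<eta>. restrict \<eta> (Seg k)) -` A \<inter> space (infinite_config_space G) = cylinder \<nu> k A"
    using sets_eq_imp_space_eq[OF assms(1)] by (auto simp: cylinder_def)
  ultimately show ?thesis using assms(1) by simp
qed

lemma measure_eq_of_cylinders:
  assumes "prob_space \<nu>" "prob_space \<nu>'"
    and sets: "sets \<nu> = sets (infinite_config_space G)" "sets \<nu>' = sets (infinite_config_space G)"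
    and eq: "\<And>k A. A \<subseteq> St k \<Longrightarrow> measure \<nu> (cylinder \<nu> k A) = measure \<nu>' (cylinder \<nu>' k A)"
  shows "\<nu> = \<nu>'"
proof (rule measure_eqI_PiM_infinite)
  interpret P: prob_space \<nu> by fact
  interpret P': prob_space \<nu>' by fact
  show "finite_measure \<nu>" by unfold_locales
  let ?M = "\<lambda>u. count_space {1..toppling_matrix G u u}"
  show "sets \<nu> = sets (PiM \<Lambda> ?M)" "sets \<nu>' = sets (PiM \<Lambda> ?M)"
    using sets by (simp_all add: infinite_config_space_def)
  fix X :: "'a \<times> int \<Rightarrow> int set" and J :: "('a \<times> int) set"
  assume J: "finite J" "J \<subseteq> \<Lambda>"
  define A where "A = {\<zeta> \<in> St (radius J). \<forall>u\<in>J. \<zeta> u \<in> X u}"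
  have A: "A \<subseteq> St (radius J)" by (auto simp: A_def)
  have emb: "prod_emb \<Lambda> ?M J (Pi\<^sub>E J X) = cylinder N (radius J) A" if N: "sets N = sets (infinite_config_space G)" for N
  proof -
    have sp: "space N = space (infinite_config_space G)" by (rule sets_eq_imp_space_eq[OF N])
    have "restrict \<eta> J \<in> Pi\<^sub>E J X \<longleftrightarrow> restrict \<eta> (Seg (radius J)) \<in> A" if "\<eta> \<in> space N" for \<eta>
      using restrict_infinite[of \<eta> "radius J"] that subset_Seg_radius[OF J] unfolding sp
      by (auto simp: A_def PiE_iff)
    then show ?thesis
      unfolding cylinder_def prod_emb_def sp using space_infinite by auto
  qed
  show "emeasure \<nu> (prod_emb \<Lambda> ?M J (Pi\<^sub>E J X)) = emeasure \<nu>' (prod_emb \<Lambda> ?M J (Pi\<^sub>E J X))"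
    unfolding emb[OF sets(1)] P.emeasure_eq_measure eq[OF A]
    by (simp only: emb[OF sets(1), symmetric] emb[OF sets(2)] P'.emeasure_eq_measure)
qed

lemma weak_limit_unique:
  assumes "F \<noteq> bot" "weak_limit G M \<nu> F" "weak_limit G M \<nu>' F"
  shows "\<nu> = \<nu>'"
proof (rule measure_eq_of_cylinders)
  show "measure \<nu> (cylinder \<nu> k A) = measure \<nu>' (cylinder \<nu>' k A)" if "A \<subseteq> St k" for k A
    by (rule tendsto_unique[where f = "\<lambda>i. measure (M i) (cylinder (M i) k A)", OF assms(1)]) (use assms(2,3) that in \<open>auto simp: weak_limit_iff\<close>)
qed (use assms(2,3) in \<open>auto simp: weak_limit_iff\<close>)

text \<open>The limit measure is first built on real coordinates, and \<open>clip\<close> reads the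
  heights off again. The default 1 keeps every value within the admissible range.\<close>

definition clip :: "'a \<times> int \<Rightarrow> real \<Rightarrow> int" where
  "clip u x = (if 1 \<le> \<lfloor>x\<rfloor> \<and> \<lfloor>x\<rfloor> \<le> toppling_matrix G u u then \<lfloor>x\<rfloor> else 1)"

lemma clip_measurable: "u \<in> \<Lambda> \<Longrightarrow> clip u \<in> measurable borel (count_space {1..toppling_matrix G u u})"
proof -
  assume u: "u \<in> \<Lambda>"
  have "(\<lambda>z. if 1 \<le> z \<and> z \<le> toppling_matrix G u u then z else 1) \<in>
      measurable (count_space UNIV) (count_space {1..toppling_matrix G u u})"
    using toppling_ge_1[OF u] by (auto simp: measurable_count_space_eq1)
  from measurable_compose[OF measurable_real_floor this] show ?thesis
    unfolding clip_def[abs_def] .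
qed

lemma clip_int: "1 \<le> z \<Longrightarrow> z \<le> toppling_matrix G u u \<Longrightarrow> clip u (real_of_int z) = z"
  by (simp add: clip_def)

text \<open>Kolmogorov extension: heights are regarded as reals, the consistent laws
  \<open>Q\<close> are extended over all of \<open>\<Lambda>\<close>, and the result is carried back
  by \<open>clip\<close>, which inverts the embedding on stable configurations.\<close>

lemma projective_limit:
  fixes Q :: "nat \<Rightarrow> ('a \<times> int \<Rightarrow> int) pmf"
  assumes Q_St: "\<And>k. set_pmf (Q k) \<subseteq> St k"
    and Q_map: "\<And>k k'. k \<le> k' \<Longrightarrow> map_pmf (\<lambda>\<zeta>. restrict \<zeta> (Seg k)) (Q k') = Q k"
  shows "\<exists>\<nu>. prob_space \<nu> \<and> sets \<nu> = sets (infinite_config_space G) \<and>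
    (\<forall>k. \<forall>A\<subseteq>St k. measure \<nu> (cylinder \<nu> k A) = measure (Q k) A)"
proof -
  define B where "B J = PiM J (\<lambda>_. borel :: real measure)" for J :: "('a \<times> int) set"
  define X where "X J \<zeta> = (\<lambda>u\<in>J. real_of_int (\<zeta> u))" for J and \<zeta> :: "'a \<times> int \<Rightarrow> int"
  \<comment> \<open>Every finite \<open>J\<close> needs a law, so it is taken from a centred segment
    containing \<open>J\<close>; \<open>P_eq\<close> shows that a larger segment gives the
    same.\<close>
  define P where "P J = distr (measure_pmf (Q (radius J))) (B J) (X J)" for J
  have X_space: "X J \<zeta> \<in> space (B J)" for J \<zeta> by (simp add: X_def B_def space_PiM)
  have X_meas [measurable]: "X J \<in> measurable (measure_pmf p) (B J)" for J p
    using X_space by simp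
  have P_eq: "P J = distr (measure_pmf (Q k)) (B J) (X J)" if J: "finite J" "J \<subseteq> Seg k" for J k
  proof -
    have r: "radius J \<le> k" by (rule radius_le[OF J])
    have sub: "J \<subseteq> Seg (radius J)" using J Seg_subset by (intro subset_Seg_radius) auto
    have "measure_pmf (Q (radius J)) = distr (measure_pmf (Q k)) (count_space UNIV) (\<lambda>\<zeta>. restrict \<zeta> (Seg (radius J)))"
      unfolding Q_map[OF r, symmetric] map_pmf_rep_eq ..
    then have "P J = distr (measure_pmf (Q k)) (B J) (X J \<circ> (\<lambda>\<zeta>. restrict \<zeta> (Seg (radius J))))"
      unfolding P_def using X_space by (simp add: distr_distr)
    also have "X J \<circ> (\<lambda>\<zeta>. restrict \<zeta> (Seg (radius J))) = X J"
      using sub by (auto simp: X_def fun_eq_iff)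
    finally show ?thesis .
  qed
  interpret P: polish_projective \<Lambda> P
  proof (intro polish_projective.intro projective_family.intro)
    fix J H :: "('a \<times> int) set" assume JH: "J \<subseteq> H" "finite H" "H \<subseteq> \<Lambda>"
    have sub: "H \<subseteq> Seg (radius H)" by (rule subset_Seg_radius[OF JH(2,3)])
    have "distr (P H) (PiM J (\<lambda>_. borel)) (\<lambda>f. restrict f J)
        = distr (measure_pmf (Q (radius H))) (PiM J (\<lambda>_. borel)) ((\<lambda>f. restrict f J) \<circ> X H)"
      unfolding P_def by (rule distr_distr) (auto simp: B_def intro: measurable_restrict_subset[OF JH(1)] X_space[unfolded B_def])
    also have "(\<lambda>f. restrict f J) \<circ> X H = X J" using JH(1) by (auto simp: X_def fun_eq_iff)
    also have "distr (measure_pmf (Q (radius H))) (PiM J (\<lambda>_. borel)) (X J) = P J"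
      using P_eq[OF finite_subset[OF JH(1,2)] order_trans[OF JH(1) sub]] by (simp only: B_def)
    finally show "P J = distr (P H) (PiM J (\<lambda>_. borel)) (\<lambda>f. restrict f J)" ..
  next
    fix J :: "('a \<times> int) set" assume "finite J" "J \<subseteq> \<Lambda>"
    show "prob_space (P J)"
      unfolding P_def by (rule prob_space.prob_space_distr[OF measure_pmf.prob_space_axioms X_meas])
  qed
  define \<Phi> where "\<Phi> J \<omega> = (\<lambda>u\<in>J. clip u (\<omega> u))" for J and \<omega> :: "'a \<times> int \<Rightarrow> real"
  have \<Phi>_meas: "\<Phi> J \<in> measurable (B J) (PiM J (\<lambda>u. count_space {1..toppling_matrix G u u}))" if "J \<subseteq> \<Lambda>" for J
    unfolding \<Phi>_def[abs_def] B_def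
  proof (rule measurable_restrict)
    fix u assume u: "u \<in> J"
    show "(\<lambda>\<omega>. clip u (\<omega> u)) \<in> measurable (PiM J (\<lambda>_. borel)) (count_space {1..toppling_matrix G u u})"
      by (rule measurable_compose[OF measurable_component_singleton[where M = "\<lambda>_. borel"] clip_measurable])
         (use that u in auto)
  qed
  define \<nu> where "\<nu> = distr P.lim (infinite_config_space G) (\<Phi> \<Lambda>)"
  have lim_meas: "\<Phi> \<Lambda> \<in> measurable P.lim (infinite_config_space G)"
    using \<Phi>_meas[OF order_refl] unfolding infinite_config_space_def B_def
    by (simp cong: measurable_cong_sets)
  have "prob_space \<nu>" unfolding \<nu>_def by (rule P.P.prob_space_distr[OF lim_meas])
  moreover have sets: "sets \<nu> = sets (infinite_config_space G)" by (simp add: \<nu>_def)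
  moreover have "measure \<nu> (cylinder \<nu> k A) = measure (Q k) A" if A: "A \<subseteq> St k" for k A
  proof -
    define Y where "Y = \<Phi> (Seg k) -` A \<inter> space (B (Seg k))"
    have K: "PiM (Seg k) (\<lambda>u. count_space {1..toppling_matrix G u u}) = count_space (St k)"
      unfolding St_eq by (rule count_space_PiM_finite) (auto simp: finite_segment)
    have Y: "Y \<in> sets (B (Seg k))"
      unfolding Y_def using \<Phi>_meas[OF Seg_subset[of k]] A by (intro measurable_sets) (auto simp: K)
    have "emeasure \<nu> (cylinder \<nu> k A) = emeasure P.lim (\<Phi> \<Lambda> -` cylinder \<nu> k A \<inter> space P.lim)"
      using cylinder_measurable[OF sets A] by (simp add: \<nu>_def emeasure_distr[OF lim_meas])
    also have "\<Phi> \<Lambda> -` cylinder \<nu> k A \<inter> space P.lim = P.emb \<Lambda> (Seg k) Y"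
    proof -
      have "restrict (\<Phi> \<Lambda> \<omega>) (Seg k) = \<Phi> (Seg k) (restrict \<omega> (Seg k))" for \<omega>
        using Seg_subset[of k] by (auto simp: \<Phi>_def fun_eq_iff)
      moreover have "\<Phi> \<Lambda> \<omega> \<in> space \<nu>" if "\<omega> \<in> space P.lim" for \<omega>
        using measurable_space[OF lim_meas that] by (simp add: \<nu>_def)
      moreover have "restrict \<omega> (Seg k) \<in> space (B (Seg k))" for \<omega> by (simp add: B_def space_PiM)
      ultimately show ?thesis
        by (auto simp: cylinder_def prod_emb_def Y_def space_PiM)
    qed
    also have "emeasure P.lim \<dots> = emeasure (P (Seg k)) Y"
      using Y by (intro P.emeasure_lim_emb Seg_subset finite_segment) (simp add: B_def)
    also have "\<dots> = emeasure (measure_pmf (Q k)) (X (Seg k) -` Y \<inter> space (measure_pmf (Q k)))"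
      unfolding P_eq[OF finite_segment order_refl] by (rule emeasure_distr[OF X_meas Y])
    also have "X (Seg k) -` Y \<inter> space (measure_pmf (Q k)) = {\<zeta>. \<Phi> (Seg k) (X (Seg k) \<zeta>) \<in> A}"
      using X_space by (auto simp: Y_def)
    also have "emeasure (measure_pmf (Q k)) {\<zeta>. \<Phi> (Seg k) (X (Seg k) \<zeta>) \<in> A} = emeasure (measure_pmf (Q k)) A"
    proof (rule emeasure_eq_AE)
      have "\<Phi> (Seg k) (X (Seg k) \<zeta>) = \<zeta>" if "\<zeta> \<in> St k" for \<zeta>
      proof
        fix u
        show "\<Phi> (Seg k) (X (Seg k) \<zeta>) u = \<zeta> u"
          using that clip_int[of "\<zeta> u" u] unfolding St_eq
          by (cases u; cases "u \<in> Seg k") (auto simp: \<Phi>_def X_def PiE_iff extensional_def)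
      qed
      then show "AE \<zeta> in measure_pmf (Q k). (\<zeta> \<in> {\<zeta>. \<Phi> (Seg k) (X (Seg k) \<zeta>) \<in> A}) = (\<zeta> \<in> A)"
        using Q_St[of k] by (auto simp: AE_measure_pmf_iff)
    qed auto
    finally show ?thesis by (simp add: measure_def)
  qed
  ultimately show ?thesis by blast
qed

text \<open>For each \<open>k\<close> there are finitely many stable configurations, so no mass
  escapes: additivity, total mass 1 and consistency in \<open>k\<close> pass to the limits
  \<open>q\<close>, which then define a projective family.\<close>

lemma weak_limit_exists:
  assumes F: "F \<noteq> bot"
    and M: "\<And>k. \<forall>\<^sub>F i in F. prob_space (M i) \<and> sets (M i) = Pow (space (M i)) \<and>
      (\<forall>\<eta>\<in>space (M i). restrict \<eta> (Seg k) \<in> St k)"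
    and lim: "\<And>k A. A \<subseteq> St k \<Longrightarrow> ((\<lambda>i. measure (M i) (cylinder (M i) k A)) \<longlongrightarrow> q k A) F"
  shows "\<exists>\<nu>. weak_limit G M \<nu> F"
proof -
  have q_sum: "q k A = (\<Sum>\<zeta>\<in>A. q k {\<zeta>})" if A: "A \<subseteq> St k" for k A
  proof (rule tendsto_unique[OF F lim[OF A]])
    have finA: "finite A" using A finite_St finite_subset by blast
    have "((\<lambda>i. \<Sum>\<zeta>\<in>A. measure (M i) (cylinder (M i) k {\<zeta>})) \<longlongrightarrow> (\<Sum>\<zeta>\<in>A. q k {\<zeta>})) F"
      by (intro tendsto_sum lim) (use A in auto)
    moreover have "\<forall>\<^sub>F i in F. (\<Sum>\<zeta>\<in>A. measure (M i) (cylinder (M i) k {\<zeta>})) = measure (M i) (cylinder (M i) k A)"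
      using M[of k]
    proof eventually_elim
      case (elim i)
      then interpret prob_space "M i" by simp
      have "measure (M i) (\<Union>\<zeta>\<in>A. cylinder (M i) k {\<zeta>}) = (\<Sum>\<zeta>\<in>A. measure (M i) (cylinder (M i) k {\<zeta>}))"
        using elim by (intro finite_measure_finite_Union finA) (auto simp: cylinder_def disjoint_family_on_def)
      moreover have "(\<Union>\<zeta>\<in>A. cylinder (M i) k {\<zeta>}) = cylinder (M i) k A" by (auto simp: cylinder_def)
      ultimately show ?case by simp
    qed
    ultimately show "((\<lambda>i. measure (M i) (cylinder (M i) k A)) \<longlongrightarrow> (\<Sum>\<zeta>\<in>A. q k {\<zeta>})) F"
      by (rule Lim_transform_eventually)
  qed
  have q_nonneg: "0 \<le> q k A" if "A \<subseteq> St k" for k A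
    by (rule tendsto_lowerbound[OF lim[OF that] _ F]) simp
  have q_total: "q k (St k) = 1" for k
  proof (rule tendsto_unique[OF F lim[OF order_refl]])
    have "\<forall>\<^sub>F i in F. 1 = measure (M i) (cylinder (M i) k (St k))"
      using M[of k]
    proof eventually_elim
      case (elim i)
      then interpret prob_space "M i" by simp
      have "cylinder (M i) k (St k) = space (M i)" using elim by (auto simp: cylinder_def)
      then show ?case using prob_space by simp
    qed
    then show "((\<lambda>i. measure (M i) (cylinder (M i) k (St k))) \<longlongrightarrow> 1) F"
      by (rule Lim_transform_eventually[OF tendsto_const])
  qed
  have q_cons: "q k A = q k' {\<zeta> \<in> St k'. restrict \<zeta> (Seg k) \<in> A}" if A: "A \<subseteq> St k" and k: "k \<le> k'" for k k' A
  proof (rule tendsto_unique[OF F lim[OF A]])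
    have "\<forall>\<^sub>F i in F. measure (M i) (cylinder (M i) k' {\<zeta> \<in> St k'. restrict \<zeta> (Seg k) \<in> A}) = measure (M i) (cylinder (M i) k A)"
      using M[of k']
    proof eventually_elim
      case (elim i)
      have "restrict (restrict \<eta> (Seg k')) (Seg k) = restrict \<eta> (Seg k)" for \<eta> :: "'a \<times> int \<Rightarrow> int"
        using Seg_mono[OF k] by (simp add: Int_absorb1)
      then have "cylinder (M i) k' {\<zeta> \<in> St k'. restrict \<zeta> (Seg k) \<in> A} = cylinder (M i) k A"
        using elim by (auto simp: cylinder_def)
      then show ?case by simp
    qed
    moreover have "((\<lambda>i. measure (M i) (cylinder (M i) k' {\<zeta> \<in> St k'. restrict \<zeta> (Seg k) \<in> A}))
        \<longlongrightarrow> q k' {\<zeta> \<in> St k'. restrict \<zeta> (Seg k) \<in> A}) F"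
      by (rule lim) auto
    ultimately show "((\<lambda>i. measure (M i) (cylinder (M i) k A)) \<longlongrightarrow> q k' {\<zeta> \<in> St k'. restrict \<zeta> (Seg k) \<in> A}) F"
      by (rule Lim_transform_eventually[rotated])
  qed
  define f where "f k \<zeta> = (if \<zeta> \<in> St k then q k {\<zeta>} else 0)" for k \<zeta>
  define Q where "Q k = embed_pmf (f k)" for k
  have pmf_Q: "pmf (Q k) \<zeta> = f k \<zeta>" for k \<zeta>
    unfolding Q_def
  proof (rule pmf_embed_pmf)
    show "0 \<le> f k x" for x using q_nonneg[of "{x}" k] by (simp add: f_def)
    have "(\<integral>\<^sup>+x. ennreal (f k x) \<partial>count_space UNIV) = (\<Sum>x\<in>St k. ennreal (f k x))"
      by (rule nn_integral_count_space') (auto simp: finite_St f_def)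
    also have "\<dots> = ennreal (\<Sum>x\<in>St k. f k x)"
      using q_nonneg by (intro sum_ennreal) (simp add: f_def)
    also have "(\<Sum>x\<in>St k. f k x) = 1" using q_sum[of "St k" k] q_total[of k] by (simp add: f_def)
    finally show "(\<integral>\<^sup>+x. ennreal (f k x) \<partial>count_space UNIV) = 1" by simp
  qed
  have Q_St: "set_pmf (Q k) \<subseteq> St k" for k
    by (auto simp: set_pmf_iff pmf_Q f_def split: if_splits)
  have Q_measure: "measure (Q k) A = q k A" if A: "A \<subseteq> St k" for k A
  proof -
    have "finite A" using A finite_St finite_subset by blast
    then have "measure (Q k) A = (\<Sum>\<zeta>\<in>A. f k \<zeta>)" by (simp add: measure_measure_pmf_finite pmf_Q)
    also have "\<dots> = (\<Sum>\<zeta>\<in>A. q k {\<zeta>})" using A by (intro sum.cong) (auto simp: f_def)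
    finally show ?thesis using q_sum[OF A] by simp
  qed
  have Q_map: "map_pmf (\<lambda>\<zeta>. restrict \<zeta> (Seg k)) (Q k') = Q k" if k: "k \<le> k'" for k k'
  proof (rule pmf_eqI)
    fix \<zeta>
    let ?A = "{\<zeta>' \<in> St k'. restrict \<zeta>' (Seg k) = \<zeta>}"
    have "pmf (map_pmf (\<lambda>\<zeta>. restrict \<zeta> (Seg k)) (Q k')) \<zeta> = measure (Q k') ((\<lambda>\<zeta>. restrict \<zeta> (Seg k)) -` {\<zeta>})"
      by (rule pmf_map)
    also have "\<dots> = measure (Q k') (((\<lambda>\<zeta>. restrict \<zeta> (Seg k)) -` {\<zeta>}) \<inter> set_pmf (Q k'))"
      by (simp only: measure_Int_set_pmf)
    also have "((\<lambda>\<zeta>. restrict \<zeta> (Seg k)) -` {\<zeta>}) \<inter> set_pmf (Q k') = ?A \<inter> set_pmf (Q k')"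
      using Q_St[of k'] by auto
    also have "measure (Q k') (?A \<inter> set_pmf (Q k')) = q k' ?A"
      by (simp only: measure_Int_set_pmf) (rule Q_measure, auto)
    also have "\<dots> = f k \<zeta>"
    proof (cases "\<zeta> \<in> St k")
      case True
      then show ?thesis using q_cons[of "{\<zeta>}" k k'] k by (simp add: f_def)
    next
      case False
      then have A: "?A = {}" using restrict_St[OF k] by auto
      have "q k' ?A = 0" unfolding A using q_sum[of "{}" k'] by simp
      then show ?thesis using False by (simp add: f_def)
    qed
    finally show "pmf (map_pmf (\<lambda>\<zeta>. restrict \<zeta> (Seg k)) (Q k')) \<zeta> = pmf (Q k) \<zeta>" by (simp only: pmf_Q)
  qed
  obtain \<nu> where \<nu>: "prob_space \<nu>" "sets \<nu> = sets (infinite_config_space G)"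
    "\<And>k A. A \<subseteq> St k \<Longrightarrow> measure \<nu> (cylinder \<nu> k A) = measure (Q k) A"
    using projective_limit[of Q, OF Q_St Q_map] by blast
  have "weak_limit G M \<nu> F"
    unfolding weak_limit_iff using \<nu> lim Q_measure by simp
  then show ?thesis by blast
qed

end

lemma convex_combination:
  assumes "prob_space M" "prob_space N" "sets M = sets N" and p: "0 \<le> p" "p \<le> 1"
  shows "prob_space (convex_combination p M N)" "sets (convex_combination p M N) = sets M"
    "A \<in> sets M \<Longrightarrow> measure (convex_combination p M N) A = p * measure M A + (1 - p) * measure N A"
proof -
  interpret M: prob_space M by fact
  interpret N: prob_space N by fact
  have sp: "space N = space M" using sets_eq_imp_space_eq[OF assms(3)] by simp
  show sets: "sets (convex_combination p M N) = sets M"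
    by (simp add: convex_combination_def)
  have em: "emeasure (convex_combination p M N) A = ennreal p * emeasure M A + ennreal (1 - p) * emeasure N A"
    if A: "A \<in> sets M" for A
    unfolding convex_combination_def
  proof (rule emeasure_measure_of_sigma)
    show "sigma_algebra (space M) (sets M)" ..
    show "positive (sets M) (\<lambda>A. ennreal p * emeasure M A + ennreal (1 - p) * emeasure N A)"
      by (simp add: positive_def)
    show "countably_additive (sets M) (\<lambda>A. ennreal p * emeasure M A + ennreal (1 - p) * emeasure N A)"
    proof (rule countably_additiveI)
      fix X :: "nat \<Rightarrow> 'a set" assume X: "range X \<subseteq> sets M" "disjoint_family X"
      have "(\<Sum>i. emeasure M (X i)) = emeasure M (\<Union>i. X i)" "(\<Sum>i. emeasure N (X i)) = emeasure N (\<Union>i. X i)"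
        using X assms(3) by (auto intro!: suminf_emeasure)
      then show "(\<Sum>i. ennreal p * emeasure M (X i) + ennreal (1 - p) * emeasure N (X i)) =
          ennreal p * emeasure M (\<Union>i. X i) + ennreal (1 - p) * emeasure N (\<Union>i. X i)"
        by (simp add: suminf_add[symmetric])
    qed
  qed (rule A)
  have real: "emeasure (convex_combination p M N) A = ennreal (p * measure M A + (1 - p) * measure N A)"
    if "A \<in> sets M" for A
    using em[OF that] p by (simp add: M.emeasure_eq_measure N.emeasure_eq_measure ennreal_mult'[symmetric] ennreal_plus[symmetric] del: ennreal_plus)
  show "prob_space (convex_combination p M N)"
  proof
    have "space (convex_combination p M N) = space M" by (simp add: convex_combination_def)
    then show "emeasure (convex_combination p M N) (space (convex_combination p M N)) = 1"
      using real[of "space M"] M.prob_space N.prob_space sp by simp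
  qed
  show "measure (convex_combination p M N) A = p * measure M A + (1 - p) * measure N A" if "A \<in> sets M"
  proof -
    have "0 \<le> p * measure M A + (1 - p) * measure N A" using p by simp
    then show ?thesis
      unfolding measure_def[of "convex_combination p M N"] real[OF that] by (rule enn2real_ennreal)
  qed
qed

lemma convex_combination_swap:
  assumes "sets M = sets N"
  shows "convex_combination p M N = convex_combination (1 - p) N M"
  using assms sets_eq_imp_space_eq[OF assms] by (simp add: convex_combination_def add.commute)

lemma tendsto_floor_over_square: "(\<lambda>i. real_of_int \<lfloor>r * (real i)\<^sup>2\<rfloor> / (real i)\<^sup>2) \<longlonglongrightarrow> r"
proof -
  have "(\<lambda>i. real_of_int \<lfloor>r * (real i)\<^sup>2\<rfloor> / (real i)\<^sup>2 - r) \<longlonglongrightarrow> 0"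
  proof (rule Lim_null_comparison)
    show "\<forall>\<^sub>F i in sequentially. norm (real_of_int \<lfloor>r * (real i)\<^sup>2\<rfloor> / (real i)\<^sup>2 - r) \<le> 1 / (real i)\<^sup>2"
      using eventually_gt_at_top[of 0]
    proof eventually_elim
      case (elim i)
      have "real_of_int \<lfloor>r * (real i)\<^sup>2\<rfloor> / (real i)\<^sup>2 - r = (real_of_int \<lfloor>r * (real i)\<^sup>2\<rfloor> - r * (real i)\<^sup>2) / (real i)\<^sup>2"
        using elim by (simp add: field_simps)
      moreover have "\<bar>real_of_int \<lfloor>r * (real i)\<^sup>2\<rfloor> - r * (real i)\<^sup>2\<bar> \<le> 1" by linarith
      ultimately show ?case by (simp add: divide_right_mono)
    qed
    show "(\<lambda>i. 1 / (real i)\<^sup>2) \<longlonglongrightarrow> 0" by real_asymp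
  qed
  then show ?thesis by (simp add: LIM_zero_iff)
qed

section \<open>Limits of the finite-volume measures\<close>

context connected_pair_graph
begin

definition burn_measure :: "(('a \<times> int) set \<Rightarrow> ('a \<times> int) set) \<Rightarrow> int \<Rightarrow> int \<Rightarrow> ('a \<times> int \<Rightarrow> int) measure" where
  "burn_measure C n m = uniform_count_measure (burnable_set C n m)"

abbreviation window_word :: "nat \<Rightarrow> ('a \<times> int \<Rightarrow> int) \<Rightarrow> ('a \<Rightarrow> int) list" where
  "window_word k \<equiv> word_of (- int k) (int k)"

lemma finite_stable: "finite (stable_configs G (segment G n m))"
  unfolding stable_configs_def by (intro finite_PiE finite_segment) auto

lemma burn_measure_cylinder:
  assumes shift: "\<And>t V \<eta>. burnable C (affine 1 t ` V) \<eta> \<longleftrightarrow> burnable C V (\<eta> \<circ> affine 1 t)"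
    and sep: "separated_words letters full_letter (burnable_word C)"
    and A: "A \<subseteq> St k" and nm: "n \<le> - int k" "int k \<le> m"
  shows "measure (burn_measure C n m) (cylinder (burn_measure C n m) k A) =
    separated_words.window_total letters (burnable_word C) (window_word k ` A) (nat (- int k - n)) (nat (m - int k)) /
    separated_words.count letters (burnable_word C) (nat (- int k - n) + (2 * k + 1) + nat (m - int k))"
proof -
  have "cylinder (burn_measure C n m) k A = (window_event C n m k A)"
    by (auto simp: cylinder_def burn_measure_def space_uniform_count_measure)
  then have "measure (burn_measure C n m) (cylinder (burn_measure C n m) k A) =
      real (card (window_event C n m k A)) /
      real (card (burnable_set C n m))"
    unfolding burn_measure_def using finite_stable by (subst measure_uniform_count_measure) auto
  moreover have "nat (m - n + 1) = nat (- int k - n) + (2 * k + 1) + nat (m - int k)" using nm by linarith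
  ultimately show ?thesis
    by (simp only: card_burnable_window[OF shift sep A nm] card_burnable[OF shift sep])
qed

lemma window_word_image: "A \<subseteq> St k \<Longrightarrow> window_word k ` A \<subseteq> words letters (2 * k + 1)"
proof -
  have "nat (int k - - int k + 1) = 2 * k + 1" by linarith
  then show "A \<subseteq> St k \<Longrightarrow> window_word k ` A \<subseteq> words letters (2 * k + 1)"
    using bij_betw_imp_surj_on[OF bij_word_of[of "- int k" "int k"]] by auto
qed

lemma filterlim_distance:
  "filterlim n at_bot F \<Longrightarrow> filterlim (\<lambda>i. nat (- int k - n i)) at_top F"
  "filterlim m at_top F \<Longrightarrow> filterlim (\<lambda>i. nat (m i - int k)) at_top F"
proof -
  show "filterlim (\<lambda>i. nat (- int k - n i)) at_top F" if "filterlim n at_bot F"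
    unfolding filterlim_at_top
  proof
    fix Z :: nat
    show "\<forall>\<^sub>F i in F. Z \<le> nat (- int k - n i)"
      using that[unfolded filterlim_at_bot, rule_format, of "- int k - int Z"] by eventually_elim linarith
  qed
  show "filterlim (\<lambda>i. nat (m i - int k)) at_top F" if "filterlim m at_top F"
    unfolding filterlim_at_top
  proof
    fix Z :: nat
    show "\<forall>\<^sub>F i in F. Z \<le> nat (m i - int k)"
      using that[unfolded filterlim_at_top, rule_format, of "int k + int Z"] by eventually_elim linarith
  qed
qed

lemma eventually_window:
  assumes "filterlim n at_bot F" "filterlim m at_top F"
  shows "\<forall>\<^sub>F i in F. n i \<le> - int k \<and> int k \<le> m i"
  using assms(1)[unfolded filterlim_at_bot, rule_format, of "- int k"]
    assms(2)[unfolded filterlim_at_top, rule_format, of "int k"] by eventually_elim simp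

definition far_prob :: "int \<Rightarrow> nat \<Rightarrow> ('a \<times> int \<Rightarrow> int) set \<Rightarrow> real" where
  "far_prob s k A = renewal_words.window_prob letters full_letter (burnable_word (far s)) (2 * k + 1) (window_word k ` A)"

lemma far_cylinder_limit:
  assumes s: "s = 1 \<or> s = - 1" and n: "filterlim n at_bot F" and m: "filterlim m at_top F" and A: "A \<subseteq> St k"
  shows "((\<lambda>i. measure (burn_measure (far s) (n i) (m i)) (cylinder (burn_measure (far s) (n i) (m i)) k A))
    \<longlongrightarrow> far_prob s k A) F"
proof -
  interpret P: renewal_words letters full_letter "burnable_word (far s)" by (rule renewal_words_far[OF s])
  have "((\<lambda>i. P.window_total (window_word k ` A) (nat (- int k - n i)) (nat (m i - int k)) /
      P.count (nat (- int k - n i) + (2 * k + 1) + nat (m i - int k))) \<longlongrightarrow> far_prob s k A) F"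
    unfolding far_prob_def by (rule P.window_prob_limit[OF window_word_image[OF A] filterlim_distance(1)[OF n] filterlim_distance(2)[OF m]])
  moreover have "\<forall>\<^sub>F i in F. P.window_total (window_word k ` A) (nat (- int k - n i)) (nat (m i - int k)) /
      P.count (nat (- int k - n i) + (2 * k + 1) + nat (m i - int k)) =
      measure (burn_measure (far s) (n i) (m i)) (cylinder (burn_measure (far s) (n i) (m i)) k A)"
    using eventually_window[OF n m, of k]
    by eventually_elim (simp only: burn_measure_cylinder[OF far_shift P.separated_words_axioms A])
  ultimately show ?thesis by (rule Lim_transform_eventually)
qed

lemma burn_measure_far_prob_space:
  assumes s: "s = 1 \<or> s = - 1"
  shows "prob_space (burn_measure (far s) n m)"
proof -
  interpret P: renewal_words letters full_letter "burnable_word (far s)" by (rule renewal_words_far[OF s])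
  have "real (card (burnable_set (far s) n m)) = P.count (nat (m - n + 1))"
    by (rule card_burnable[OF far_shift P.separated_words_axioms])
  also have "\<dots> = P.u (Suc (nat (m - n + 1)))" by (rule P.u_Suc[symmetric])
  finally have "card (burnable_set (far s) n m) \<noteq> 0"
    using P.u_ge_1[of "Suc (nat (m - n + 1))"] by simp
  then show ?thesis
    unfolding burn_measure_def by (intro prob_space_uniform_count_measure) (auto simp: finite_stable)
qed

text \<open>Justifies the definite descriptions behind \<open>mu_left\<close> and
  \<open>mu_right\<close>: existence comes from the renewal limits of cylinder probabilities,
  uniqueness from the fact that cylinders determine the measure.\<close>

lemma far_weak_limit:
  assumes s: "s = 1 \<or> s = - 1"
  shows "weak_limit G (\<lambda>(n, m). burn_measure (far s) n m)
    (THE \<nu>. weak_limit G (\<lambda>(n, m). burn_measure (far s) n m) \<nu> (at_bot \<times>\<^sub>F at_top)) (at_bot \<times>\<^sub>F at_top)"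
proof -
  let ?F = "at_bot \<times>\<^sub>F at_top :: (int \<times> int) filter"
  let ?M = "\<lambda>(n, m). burn_measure (far s) n m"
  have F: "?F \<noteq> bot" by (simp add: prod_filter_eq_bot)
  have "\<exists>\<nu>. weak_limit G ?M \<nu> ?F"
  proof (rule weak_limit_exists[OF F])
    fix k A assume "A \<subseteq> St k"
    from far_cylinder_limit[OF s filterlim_fst filterlim_snd this]
    show "((\<lambda>i. measure (?M i) (cylinder (?M i) k A)) \<longlongrightarrow> far_prob s k A) ?F"
      by (simp add: case_prod_unfold)
  next
    fix k
    show "\<forall>\<^sub>F i in ?F. prob_space (?M i) \<and> sets (?M i) = Pow (space (?M i)) \<and>
        (\<forall>\<eta>\<in>space (?M i). restrict \<eta> (Seg k) \<in> St k)"
      using eventually_window[OF filterlim_fst filterlim_snd, where k = k]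
    proof eventually_elim
      case (elim i)
      then show ?case
        using burn_measure_far_prob_space[OF s, of "fst i" "snd i"] restrict_stable[of _ "fst i" "snd i" k]
        by (auto simp: case_prod_unfold burn_measure_def space_uniform_count_measure sets_uniform_count_measure)
    qed
  qed
  then show ?thesis
    by (rule theI'[OF ex_ex1I]) (rule weak_limit_unique[OF F])
qed

lemma mu_left_limit: "weak_limit G (\<lambda>(n, m). burn_measure (far 1) n m) (mu_left G) (at_bot \<times>\<^sub>F at_top)"
  using far_weak_limit[of 1] unfolding mu_left_def left_burnable_configs_eq burn_measure_def by simp

lemma mu_right_limit: "weak_limit G (\<lambda>(n, m). burn_measure (far (- 1)) n m) (mu_right G) (at_bot \<times>\<^sub>F at_top)"
  using far_weak_limit[of "- 1"] unfolding mu_right_def right_burnable_configs_eq burn_measure_def by simp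

lemma far_limit_cylinder:
  assumes s: "s = 1 \<or> s = - 1" and A: "A \<subseteq> St k"
    and \<nu>: "weak_limit G (\<lambda>(n, m). burn_measure (far s) n m) \<nu> (at_bot \<times>\<^sub>F at_top)"
  shows "measure \<nu> (cylinder \<nu> k A) = far_prob s k A"
proof (rule tendsto_unique)
  show "(at_bot \<times>\<^sub>F at_top :: (int \<times> int) filter) \<noteq> bot" by (simp add: prod_filter_eq_bot)
  show "((\<lambda>i. measure (case i of (n, m) \<Rightarrow> burn_measure (far s) n m)
      (cylinder (case i of (n, m) \<Rightarrow> burn_measure (far s) n m) k A)) \<longlongrightarrow> measure \<nu> (cylinder \<nu> k A)) (at_bot \<times>\<^sub>F at_top)"
    using \<nu> A by (simp add: weak_limit_iff)
  show "((\<lambda>i. measure (case i of (n, m) \<Rightarrow> burn_measure (far s) n m)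
      (cylinder (case i of (n, m) \<Rightarrow> burn_measure (far s) n m) k A)) \<longlongrightarrow> far_prob s k A) (at_bot \<times>\<^sub>F at_top)"
    using far_cylinder_limit[OF s filterlim_fst filterlim_snd A] by (simp add: case_prod_unfold)
qed

lemma mu_left: "prob_space (mu_left G)" "sets (mu_left G) = sets (infinite_config_space G)"
    "A \<subseteq> St k \<Longrightarrow> measure (mu_left G) (cylinder (mu_left G) k A) = far_prob 1 k A"
  and mu_right: "prob_space (mu_right G)" "sets (mu_right G) = sets (infinite_config_space G)"
    "A \<subseteq> St k \<Longrightarrow> measure (mu_right G) (cylinder (mu_right G) k A) = far_prob (- 1) k A"
  using mu_left_limit mu_right_limit far_limit_cylinder[OF _ _ mu_left_limit] far_limit_cylinder[OF _ _ mu_right_limit]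
  by (auto simp: weak_limit_iff)

text \<open>Only bounded corrections separate the position of the origin in the segment from the
  ratios in \<open>window_prob_mixture\<close>, where the lengths are measured from the window
  instead.\<close>

lemma mu_cylinder_limit:
  assumes n: "filterlim n at_bot F" and m: "filterlim m at_top F" and A: "A \<subseteq> St k"
    and ratio: "((\<lambda>i. - real_of_int (n i) / (real_of_int (m i) - real_of_int (n i))) \<longlongrightarrow> \<rho>) F"
  shows "((\<lambda>i. measure (mu G (n i) (m i)) (cylinder (mu G (n i) (m i)) k A))
    \<longlongrightarrow> \<rho> * far_prob (- 1) k A + (1 - \<rho>) * far_prob 1 k A) F"
proof -
  define a where "a i = nat (- int k - n i)" for i
  define b where "b i = nat (m i - int k)" for i
  define d where "d = 2 * k + 1"
  define N where "N i = real_of_int (m i) - real_of_int (n i)" for i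
  have a: "filterlim a at_top F" and b: "filterlim b at_top F"
    unfolding a_def b_def by (intro filterlim_distance n m)+
  have ev: "\<forall>\<^sub>F i in F. n i \<le> - int k \<and> int k \<le> m i" by (rule eventually_window[OF n m])
  \<comment> \<open>The denominator of \<open>window_prob_mixture\<close> is
    \<open>m - n + 3\<close>, so passing from one ratio to the other costs a factor tending to 1 and
    a term tending to 0.\<close>
  have den: "\<forall>\<^sub>F i in F. real (a i + b i + d + 2) = N i + 3"
    using ev by eventually_elim (simp add: a_def b_def d_def N_def of_nat_diff)
  have "filterlim (\<lambda>i. real_of_int (m i)) at_top F"
    by (rule filterlim_compose[OF filterlim_real_of_int_at_top m])
  then have N: "filterlim N at_top F"
  proof (rule filterlim_at_top_mono)
    show "\<forall>\<^sub>F i in F. real_of_int (m i) \<le> N i"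
      using ev by eventually_elim (simp add: N_def)
  qed
  have N3: "filterlim (\<lambda>i. N i + 3) at_top F"
    by (rule filterlim_at_top_mono[OF N]) simp
  have null: "((\<lambda>i. c / (N i + 3)) \<longlongrightarrow> 0) F" for c :: real
    by (rule real_tendsto_divide_at_top[OF tendsto_const N3])
  have "((\<lambda>i. (- real_of_int (n i) / N i) * (1 - 3 / (N i + 3)) - real k / (N i + 3)) \<longlongrightarrow> \<rho> * (1 - 0) - 0) F"
    using ratio unfolding N_def[symmetric] by (intro tendsto_intros null)
  moreover have "\<forall>\<^sub>F i in F. (- real_of_int (n i) / N i) * (1 - 3 / (N i + 3)) - real k / (N i + 3)
      = real (a i) / real (a i + b i + d + 2)"
    using ev den N[unfolded filterlim_at_top_dense, rule_format, of 0]
  proof eventually_elim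
    case (elim i)
    have "1 - 3 / (N i + 3) = N i / (N i + 3)" using elim(3) by (simp add: field_simps)
    then have "(- real_of_int (n i) / N i) * (1 - 3 / (N i + 3)) - real k / (N i + 3) = (- real_of_int (n i) - real k) / (N i + 3)"
      using elim(3) by (simp add: diff_divide_distrib)
    moreover have "real (a i) = - real_of_int (n i) - real k" using elim(1) by (simp add: a_def of_nat_diff)
    ultimately show ?case by (simp only: elim(2))
  qed
  ultimately have ra: "((\<lambda>i. real (a i) / real (a i + b i + d + 2)) \<longlongrightarrow> \<rho>) F"
    by (simp add: Lim_transform_eventually)
  have "((\<lambda>i. 1 - real (a i) / real (a i + b i + d + 2) - (d + 2) / (N i + 3)) \<longlongrightarrow> 1 - \<rho> - 0) F"
    by (intro tendsto_intros ra null)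
  moreover have "\<forall>\<^sub>F i in F. 1 - real (a i) / real (a i + b i + d + 2) - (d + 2) / (N i + 3) = real (b i) / real (a i + b i + d + 2)"
    using den
  proof eventually_elim
    case (elim i)
    let ?T = "real (a i + b i + d + 2)"
    have "1 - real (a i) / ?T - real (d + 2) / ?T = (?T - real (a i) - real (d + 2)) / ?T"
    proof -
      have T: "?T \<noteq> 0" by simp
      show ?thesis by (simp only: diff_divide_distrib divide_self[OF T])
    qed
    also have "?T - real (a i) - real (d + 2) = real (b i)" by simp
    finally show ?case unfolding elim[symmetric] .
  qed
  ultimately have rb: "((\<lambda>i. real (b i) / real (a i + b i + d + 2)) \<longlongrightarrow> 1 - \<rho>) F"
    by (simp add: Lim_transform_eventually)
  have "((\<lambda>i. sandpile.C.window_total (window_word k ` A) (a i) (b i) / sandpile.C.count (a i + d + b i)) \<longlongrightarrow>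
      (1 - \<rho>) * far_prob 1 k A + \<rho> * far_prob (- 1) k A) F"
    unfolding far_prob_def d_def[symmetric]
    by (rule sandpile.window_prob_mixture[OF _ a b ra rb]) (use window_word_image[OF A] in \<open>simp add: d_def\<close>)
  moreover have "\<forall>\<^sub>F i in F. sandpile.C.window_total (window_word k ` A) (a i) (b i) / sandpile.C.count (a i + d + b i) =
      measure (mu G (n i) (m i)) (cylinder (mu G (n i) (m i)) k A)"
    using ev
  proof eventually_elim
    case (elim i)
    then have "n i \<le> m i" by simp
    then have "mu G (n i) (m i) = burn_measure uminus (n i) (m i)"
      by (simp add: mu_def burn_measure_def recurrent_configs_segment)
    then show ?case
      using burn_measure_cylinder[OF uminus_shift sandpile.C.separated_words_axioms A] elim
      by (simp add: a_def b_def d_def)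
  qed
  ultimately have "((\<lambda>i. measure (mu G (n i) (m i)) (cylinder (mu G (n i) (m i)) k A)) \<longlongrightarrow>
      (1 - \<rho>) * far_prob 1 k A + \<rho> * far_prob (- 1) k A) F"
    by (rule Lim_transform_eventually)
  then show ?thesis by (simp add: add.commute)
qed

text \<open>Here \<open>\<rho>\<close> is the limiting proportion of the segment to the left of the
  origin. The exceptional block lies there with probability \<open>\<rho>\<close>, and then the
  origin is in the right-burnable part; hence the weight \<open>\<rho>\<close> on
  \<open>mu_right\<close>.\<close>

theorem mu_weak_limit:
  assumes n: "filterlim n at_bot F" and m: "filterlim m at_top F" and \<rho>: "0 \<le> \<rho>" "\<rho> \<le> 1"
    and ratio: "((\<lambda>i. - real_of_int (n i) / (real_of_int (m i) - real_of_int (n i))) \<longlongrightarrow> \<rho>) F"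
  shows "weak_limit G (\<lambda>i. mu G (n i) (m i)) (convex_combination \<rho> (mu_right G) (mu_left G)) F"
proof -
  let ?C = "convex_combination \<rho> (mu_right G) (mu_left G)"
  have eq: "sets (mu_right G) = sets (mu_left G)" by (simp add: mu_left mu_right)
  note C = convex_combination[OF mu_right(1) mu_left(1) eq \<rho>]
  have "measure ?C (cylinder ?C k A) = \<rho> * far_prob (- 1) k A + (1 - \<rho>) * far_prob 1 k A" if A: "A \<subseteq> St k" for k A
  proof -
    have "cylinder ?C k A = cylinder (mu_right G) k A" "cylinder (mu_right G) k A = cylinder (mu_left G) k A"
      using sets_eq_imp_space_eq[OF C(2)] sets_eq_imp_space_eq[OF eq] by (simp_all add: cylinder_def)
    then show ?thesis
      using C(3)[OF cylinder_measurable[OF mu_right(2) A]] mu_left(3)[OF A] mu_right(3)[OF A] by simp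
  qed
  then show ?thesis
    unfolding weak_limit_iff using C(1,2) mu_right(2) mu_cylinder_limit[OF n m _ ratio] by simp
qed

text \<open>With \<open>x = - n / m\<close> the proportion is \<open>1 - 1 / (1 + x)\<close>. This
  expression has the limit \<open>\<rho>\<close> when \<open>x\<close> tends to
  \<open>\<rho> / (1 - \<rho>)\<close>, and the limit 1 when \<open>x\<close> tends to
  infinity.\<close>

lemma mu_weak_limit_ratio:
  assumes n: "filterlim n at_bot sequentially" and m: "filterlim m at_top sequentially" and \<rho>: "0 \<le> \<rho>" "\<rho> \<le> 1"
    and ratio: "if \<rho> = 1
      then filterlim (\<lambda>i. - real_of_int (n i) / real_of_int (m i)) at_top sequentially
      else (\<lambda>i. - real_of_int (n i) / real_of_int (m i)) \<longlonglongrightarrow> \<rho> / (1 - \<rho>)"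
  shows "weak_limit G (\<lambda>i. mu G (n i) (m i)) (convex_combination \<rho> (mu_right G) (mu_left G)) sequentially"
proof (rule mu_weak_limit[OF n m \<rho>])
  let ?x = "\<lambda>i. - real_of_int (n i) / real_of_int (m i)"
  have "\<forall>\<^sub>F i in sequentially. 1 - 1 / (1 + ?x i) = - real_of_int (n i) / (real_of_int (m i) - real_of_int (n i))"
    using eventually_window[OF n m, of 1]
  proof eventually_elim
    case (elim i)
    have "1 + ?x i = (real_of_int (m i) - real_of_int (n i)) / real_of_int (m i)" using elim by (simp add: field_simps)
    then show ?case using elim by (simp add: field_simps)
  qed
  moreover have "(\<lambda>i. 1 - 1 / (1 + ?x i)) \<longlonglongrightarrow> \<rho>"
  proof (cases "\<rho> = 1")
    case True
    have "filterlim (\<lambda>i. 1 + ?x i) at_top sequentially"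
      using ratio True by (intro filterlim_tendsto_add_at_top[OF tendsto_const]) simp
    from tendsto_diff[OF tendsto_const[of 1] real_tendsto_divide_at_top[OF tendsto_const[of 1] this]]
    show ?thesis using True by simp
  next
    case False
    have "(\<lambda>i. 1 - 1 / (1 + ?x i)) \<longlonglongrightarrow> 1 - 1 / (1 + \<rho> / (1 - \<rho>))"
    proof (intro tendsto_diff[OF tendsto_const tendsto_divide[OF tendsto_const tendsto_add[OF tendsto_const]]])
      show "?x \<longlonglongrightarrow> \<rho> / (1 - \<rho>)" using ratio False by simp
      show "1 + \<rho> / (1 - \<rho>) \<noteq> 0" using False \<rho> by (simp add: field_simps)
    qed
    moreover have "1 - 1 / (1 + \<rho> / (1 - \<rho>)) = \<rho>" using False \<rho> by (simp add: field_simps)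
    ultimately show ?thesis by simp
  qed
  ultimately show "(\<lambda>i. - real_of_int (n i) / (real_of_int (m i) - real_of_int (n i))) \<longlonglongrightarrow> \<rho>"
    by (rule Lim_transform_eventually[rotated])
qed

text \<open>By compactness of the unit interval, every sequence of segments has a subsequence along
  which the proportion converges; a weak limit of the whole sequence must be the mixture found
  there. Conversely every proportion is realised.\<close>

lemma weak_limit_points_eq:
  "weak_limit_points G = {convex_combination \<rho> (mu_left G) (mu_right G) | \<rho>. 0 \<le> \<rho> \<and> \<rho> \<le> 1}"
proof (rule antisym)
  have eq: "sets (mu_left G) = sets (mu_right G)" by (simp add: mu_left mu_right)
  show "weak_limit_points G \<subseteq> {convex_combination \<rho> (mu_left G) (mu_right G) | \<rho>. 0 \<le> \<rho> \<and> \<rho> \<le> 1}"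
  proof
    fix \<nu> assume "\<nu> \<in> weak_limit_points G"
    then obtain n m :: "nat \<Rightarrow> int" where n: "filterlim n at_bot sequentially" and m: "filterlim m at_top sequentially"
      and \<nu>: "weak_limit G (\<lambda>i. mu G (n i) (m i)) \<nu> sequentially"
      unfolding weak_limit_points_def by blast
    define x where "x i = - real_of_int (n i) / (real_of_int (m i) - real_of_int (n i))" for i
    \<comment> \<open>Truncation puts all terms into the unit interval for the compactness argument;
      eventually it changes nothing.\<close>
    define y where "y i = max 0 (min 1 (x i))" for i
    have xy: "\<forall>\<^sub>F i in sequentially. y i = x i"
      using eventually_window[OF n m, of 1]
    proof eventually_elim
      case (elim i)
      then have "0 \<le> x i" unfolding x_def by (intro divide_nonneg_nonneg) auto
      moreover have "x i \<le> 1" unfolding x_def using elim by (subst divide_le_eq_1_pos) auto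
      ultimately have "0 \<le> x i" "x i \<le> 1" by simp_all
      then show ?case by (simp add: y_def)
    qed
    have "\<forall>i. y i \<in> {0..1}" by (simp add: y_def)
    then obtain \<rho> r where r: "\<rho> \<in> {0..1}" "strict_mono r" "(y \<circ> r) \<longlonglongrightarrow> \<rho>"
      using compact_Icc[of 0 "1::real"] unfolding compact_def by blast
    have sub: "filterlim r at_top sequentially" by (rule filterlim_subseq[OF r(2)])
    have "(\<lambda>i. x (r i)) \<longlonglongrightarrow> \<rho>"
      by (rule Lim_transform_eventually[OF r(3)]) (use filterlim_iff[THEN iffD1, OF sub, rule_format, OF xy] in simp)
    then have "weak_limit G (\<lambda>i. mu G (n (r i)) (m (r i))) (convex_combination \<rho> (mu_right G) (mu_left G)) sequentially"
      using r(1) by (intro mu_weak_limit filterlim_compose[OF n sub] filterlim_compose[OF m sub]) (auto simp: x_def)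
    moreover have "weak_limit G (\<lambda>i. mu G (n (r i)) (m (r i))) \<nu> sequentially"
      using \<nu> unfolding weak_limit_iff by (auto intro: filterlim_compose[OF _ sub])
    ultimately have "\<nu> = convex_combination \<rho> (mu_right G) (mu_left G)"
      using weak_limit_unique[OF trivial_limit_sequentially] by blast
    then have "\<nu> = convex_combination (1 - \<rho>) (mu_left G) (mu_right G)"
      using convex_combination_swap[OF eq[symmetric]] by simp
    then show "\<nu> \<in> {convex_combination \<rho> (mu_left G) (mu_right G) | \<rho>. 0 \<le> \<rho> \<and> \<rho> \<le> 1}"
      using r(1) by (intro CollectI exI[of _ "1 - \<rho>"]) auto
  qed
  show "{convex_combination \<rho> (mu_left G) (mu_right G) | \<rho>. 0 \<le> \<rho> \<and> \<rho> \<le> 1} \<subseteq> weak_limit_points G"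
  proof clarify
    fix \<rho> :: real assume \<rho>: "0 \<le> \<rho>" "\<rho> \<le> 1"
    \<comment> \<open>The quadratic terms prescribe the proportion, and the additional
      \<open>i\<close> drives both ends to infinity even if \<open>\<rho>\<close> is 0 or 1.\<close>
    define n where "n i = - (\<lfloor>(1 - \<rho>) * (real i)\<^sup>2\<rfloor> + int i)" for i
    define m where "m i = \<lfloor>\<rho> * (real i)\<^sup>2\<rfloor> + int i" for i
    have n: "filterlim n at_bot sequentially"
    proof (rule filterlim_at_bot_mono)
      show "filterlim (\<lambda>i. - int i) at_bot sequentially"
        unfolding filterlim_at_bot
      proof
        fix Z :: int
        show "\<forall>\<^sub>F i in sequentially. - int i \<le> Z"
          using eventually_ge_at_top[of "nat (- Z)"] by eventually_elim linarith
      qed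
    qed (use \<rho> in \<open>simp add: n_def\<close>)
    have m: "filterlim m at_top sequentially"
      by (rule filterlim_at_top_mono[OF filterlim_int_sequentially]) (use \<rho> in \<open>simp add: m_def\<close>)
    have i0: "(\<lambda>i. real i / (real i)\<^sup>2) \<longlonglongrightarrow> 0" by real_asymp
    have nn: "(\<lambda>i. - real_of_int (n i) / (real i)\<^sup>2) \<longlonglongrightarrow> (1 - \<rho>) + 0"
      using tendsto_add[OF tendsto_floor_over_square[of "1 - \<rho>"] i0] by (simp add: n_def add_divide_distrib add.commute)
    have mm: "(\<lambda>i. real_of_int (m i) / (real i)\<^sup>2) \<longlonglongrightarrow> \<rho> + 0"
      using tendsto_add[OF tendsto_floor_over_square[of \<rho>] i0] by (simp add: m_def add_divide_distrib)
    have "(\<lambda>i. (- real_of_int (n i) / (real i)\<^sup>2) / (real_of_int (m i) / (real i)\<^sup>2 + - real_of_int (n i) / (real i)\<^sup>2))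
        \<longlonglongrightarrow> ((1 - \<rho>) + 0) / ((\<rho> + 0) + ((1 - \<rho>) + 0))"
      by (intro tendsto_divide tendsto_add nn mm) simp
    moreover have "\<forall>\<^sub>F i in sequentially. (- real_of_int (n i) / (real i)\<^sup>2) / (real_of_int (m i) / (real i)\<^sup>2 + - real_of_int (n i) / (real i)\<^sup>2)
        = - real_of_int (n i) / (real_of_int (m i) - real_of_int (n i))"
      using eventually_gt_at_top[of 0]
    proof eventually_elim
      case (elim i)
      have "real_of_int (m i) / (real i)\<^sup>2 + - real_of_int (n i) / (real i)\<^sup>2 = (real_of_int (m i) - real_of_int (n i)) / (real i)\<^sup>2"
        by (simp add: diff_divide_distrib)
      then show ?case using elim by simp
    qed
    ultimately have "(\<lambda>i. - real_of_int (n i) / (real_of_int (m i) - real_of_int (n i))) \<longlonglongrightarrow> ((1 - \<rho>) + 0) / ((\<rho> + 0) + ((1 - \<rho>) + 0))"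
      by (rule Lim_transform_eventually)
    then have "(\<lambda>i. - real_of_int (n i) / (real_of_int (m i) - real_of_int (n i))) \<longlonglongrightarrow> 1 - \<rho>" by simp
    then have "weak_limit G (\<lambda>i. mu G (n i) (m i)) (convex_combination (1 - \<rho>) (mu_right G) (mu_left G)) sequentially"
      using \<rho> by (intro mu_weak_limit n m) auto
    then have "weak_limit G (\<lambda>i. mu G (n i) (m i)) (convex_combination \<rho> (mu_left G) (mu_right G)) sequentially"
      by (simp only: convex_combination_swap[OF eq, of \<rho>])
    then show "convex_combination \<rho> (mu_left G) (mu_right G) \<in> weak_limit_points G"
      unfolding weak_limit_points_def using n m by blast
  qed
qed

end

theorem theorem11:
  fixes G :: "'a pair_pre_digraph"
  assumes "pair_graph G" and "Digraph_Component.connected (with_proj G)"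
  shows "(\<forall>\<rho>::real. \<forall>n m :: nat \<Rightarrow> int.
            0 \<le> \<rho> \<and> \<rho> \<le> 1 \<and>
            filterlim n at_bot sequentially \<and> filterlim m at_top sequentially \<and>
            (if \<rho> = 1
             then filterlim (\<lambda>i. - real_of_int (n i) / real_of_int (m i)) at_top sequentially
             else (\<lambda>i. - real_of_int (n i) / real_of_int (m i)) \<longlonglongrightarrow> \<rho> / (1 - \<rho>))
            \<longrightarrow> weak_limit G (\<lambda>i. mu G (n i) (m i))
                  (convex_combination \<rho> (mu_right G) (mu_left G)) sequentially)
       \<and> weak_limit_points G =
            {convex_combination \<rho> (mu_left G) (mu_right G) | \<rho>. 0 \<le> \<rho> \<and> \<rho> \<le> 1}"
proof -
  interpret pair_graph G by fact
  interpret connected_pair_graph G by unfold_locales fact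
  show ?thesis using mu_weak_limit_ratio weak_limit_points_eq by blast
qed

end
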